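(* Let $V=V_1+iV_2\in C^\infty(\mathbb{R}^n)$ with $V_1,V_2$ real valued, and let $p(x,\xi)=|\xi|^2+V(x)$ for $(x,\xi)\in\mathbb{R}^{2n}$. Assume that (i) $V_1(x)\ge 0$ for all $x\in\mathbb{R}^n$; (ii) $|V_2(x)|\lesssim 1+|V_2'(x)|^2$ for $x\in\mathbb{R}^n$; (iii) $\partial^\alpha V\in L^\infty(\mathbb{R}^n)$ for all multi-indices $\alpha$ with $|\alpha|\ge 2$. Let $P$ denote the $L^2$-graph closure of $p^w(x,hD_x)$ on $\mathcal{S}(\mathbb{R}^n)$. Then $P$ is the maximal realization of $p^w(x,hD_x)$, i.e. $P$ acts as $p^w(x,hD_x)$ with domain $$D_{max}=\left\{u\in L^2(\mathbb{R}^n): p^w(x,hD_x)u\in L^2(\mathbb{R}^n)\right\}.$$ Moreover, let $T\ge 0$ be such that $|V_2(x)|-T\lesssim |V_2'(x)|^2$ for $x\in\mathbb{R}^n$, and let $K>1$. Then there exist positive constants $h_0$, $A$, $M$ and $C$ such that for all $0<h<h_0$ and all $z\in\mathbb{C}$ with $|z|\ge KT+Mh$ and $\operatorname{Re} z\le Ah^{2/3}(|z|-T)^{1/3}$, the operator $P-z:D_{max}\to L^2(\mathbb{R}^n)$ is invertible and $$\left\|(P-z)^{-1}\right\|_{L^2\to L^2}\ \le\ C\,h^{-2/3}(|z|-T)^{-1/3}.$$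
   Context: Notation: $f\lesssim g$ means there is a constant $c>0$, independent of the variables, with $f\le cg$. $V_2'$ denotes the gradient of $V_2$, and $\mathcal{S}(\mathbb{R}^n)$ is the Schwartz space. For $0<h\le 1$ the semiclassical Weyl quantization is $$a^w(x,hD_x)u(x)=\int_{\mathbb{R}^{2n}}e^{2\pi i(x-y)\cdot\xi}\,a\!\left(\tfrac{x+y}{2},h\xi\right)u(y)\,dy\,d\xi,$$ so that $p^w(x,hD_x)=-\frac{h^2}{4\pi^2}\Delta+V(x)$. In the definition of $D_{max}$, $p^w(x,hD_x)u$ is understood in the sense of distributions. The $L^2$-graph closure of $p^w(x,hD_x)$ on $\mathcal{S}(\mathbb{R}^n)$ is the operator on $L^2(\mathbb{R}^n)$ whose graph is the closure in $L^2\times L^2$ of $\{(u,p^w(x,hD_x)u):u\in\mathcal{S}(\mathbb{R}^n)\}$. *)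

theory Defs
  imports "HOL-Analysis.Analysis"
begin

section \<open>Smooth functions, Schwartz functions, test functions\<close>

definition partial :: "'n \<Rightarrow> (real^'n \<Rightarrow> 'b::real_normed_vector) \<Rightarrow> real^'n \<Rightarrow> 'b" where
  "partial i f x = vector_derivative (\<lambda>t. f (x + t *\<^sub>R axis i 1)) (at 0)"

text \<open>
  Multi-indices are encoded as lists of coordinate directions: a multi-index \<open>\<alpha>\<close> corresponds to
  any list in which each \<open>i\<close> occurs \<open>\<alpha> i\<close> times, and \<open>\<bar>\<alpha>\<bar>\<close> is the length of the list. For smooth
  functions the order of the list is irrelevant.
\<close>

fun partials :: "'n list \<Rightarrow> (real^'n \<Rightarrow> 'b::real_normed_vector) \<Rightarrow> real^'n \<Rightarrow> 'b" where
  "partials [] f = f"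
| "partials (i # \<alpha>) f = partial i (partials \<alpha> f)"

definition gradient :: "(real^'n \<Rightarrow> real) \<Rightarrow> real^'n \<Rightarrow> real^'n" where
  "gradient f x = (\<chi> i. partial i f x)"

text \<open>
  \<open>C\<^sup>\<infinity>(\<real>\<^sup>n)\<close>: every iterated partial derivative is Frechet differentiable everywhere (hence also
  continuous).
\<close>

definition smooth :: "(real^'n \<Rightarrow> 'b::real_normed_vector) \<Rightarrow> bool" where
  "smooth f \<longleftrightarrow> (\<forall>\<alpha> x. partials \<alpha> f differentiable (at x))"

definition schwartz :: "(real^'n \<Rightarrow> complex) set" where
  "schwartz = {u. smooth u \<and> (\<forall>k \<beta>. bounded (range (\<lambda>x. norm x ^ k *\<^sub>R partials \<beta> u x)))}"

definition test_function :: "(real^'n \<Rightarrow> complex) set" where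
  "test_function = {\<phi>. smooth \<phi> \<and> compact (closure {x. \<phi> x \<noteq> 0})}"


section \<open>Lebesgue spaces\<close>

text \<open>
  Elements of \<open>L\<^sup>2\<close> and \<open>L\<^sup>\<infinity>\<close> are represented by functions; equality in these spaces is equality
  almost everywhere.
\<close>

definition Linf :: "(real^'n \<Rightarrow> complex) set" where
  "Linf = {f. f \<in> borel_measurable lborel \<and> (\<exists>B. AE x in lborel. norm (f x) \<le> B)}"

definition L2 :: "(real^'n \<Rightarrow> complex) set" where
  "L2 = {u. u \<in> borel_measurable lborel \<and> integrable lborel (\<lambda>x. (norm (u x))\<^sup>2)}"

definition L2_norm :: "(real^'n \<Rightarrow> complex) \<Rightarrow> real" where
  "L2_norm u = sqrt (LINT x|lborel. (norm (u x))\<^sup>2)"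


section \<open>Unbounded operators on \<open>L\<^sup>2\<close>, given by their graphs\<close>

type_synonym 'n L2_graph = "((real^'n \<Rightarrow> complex) \<times> (real^'n \<Rightarrow> complex)) set"

definition L2_closure :: "'n::finite L2_graph \<Rightarrow> 'n L2_graph" where
  "L2_closure G = {(u, f). u \<in> L2 \<and> f \<in> L2 \<and>
     (\<exists>v g. (\<forall>k::nat. (v k, g k) \<in> G \<and> v k \<in> L2 \<and> g k \<in> L2) \<and>
        (\<lambda>k. L2_norm (\<lambda>x. v k x - u x)) \<longlonglongrightarrow> 0 \<and>
        (\<lambda>k. L2_norm (\<lambda>x. g k x - f x)) \<longlonglongrightarrow> 0)}"

definition shifted :: "'n::finite L2_graph \<Rightarrow> complex \<Rightarrow> 'n L2_graph" where
  "shifted R z = {(u, \<lambda>x. f x - z * u x) | u f. (u, f) \<in> R}"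

text \<open>
  The graph \<open>R\<close> is that of a well-defined bijection \<open>D \<rightarrow> L\<^sup>2\<close>, modulo equality almost everywhere on
  both sides. The graph of its inverse is then \<open>R\<inverse>\<close>.
\<close>

definition L2_invertible :: "(real^'n \<Rightarrow> complex) set \<Rightarrow> 'n::finite L2_graph \<Rightarrow> bool" where
  "L2_invertible D R \<longleftrightarrow> Domain R = D \<and> Range R = L2 \<and>
     (\<forall>(u, f) \<in> R. \<forall>(v, g) \<in> R. (AE x in lborel. u x = v x) \<longleftrightarrow> (AE x in lborel. f x = g x))"

text \<open>The operator norm; it is \<open>\<infinity>\<close> for an unbounded operator.\<close>

definition L2_opnorm :: "'n::finite L2_graph \<Rightarrow> ennreal" where
  "L2_opnorm R = Inf {ennreal B | B. 0 \<le> B \<and> (\<forall>(g, u) \<in> R. L2_norm u \<le> B * L2_norm g)}"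


section \<open>Semiclassical Weyl quantization\<close>

text \<open>
  The double integral is iterated, with the integration in \<open>y\<close> carried out first: for symbols that
  are not integrable in \<open>\<xi>\<close> it does not converge absolutely as an integral over \<open>\<real>\<^sup>2\<^sup>n\<close>.
\<close>

definition weyl ::
  "real \<Rightarrow> (real^'n \<Rightarrow> real^'n \<Rightarrow> complex) \<Rightarrow> (real^'n \<Rightarrow> complex) \<Rightarrow> real^'n \<Rightarrow> complex" where
  "weyl h a u x =
     (LINT \<xi>|lborel. (LINT y|lborel.
        exp (2 * of_real pi * \<i> * of_real ((x - y) \<bullet> \<xi>)) * a (midpoint x y) (h *\<^sub>R \<xi>) * u y))"

definition weyl_closure ::
  "real \<Rightarrow> (real^'n \<Rightarrow> real^'n \<Rightarrow> complex) \<Rightarrow> 'n::finite L2_graph" where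
  "weyl_closure h a = L2_closure {(u, weyl h a u) | u. u \<in> schwartz}"

text \<open>
  The distribution \<open>a\<^sup>w(x,hD)u\<close>, evaluated at a test function. It is defined by duality for the
  bilinear pairing \<open>\<integral>u\<phi>\<close>: the transpose of the quantization of \<open>a(x,\<xi>)\<close> is that of \<open>a(x,-\<xi>)\<close>.
\<close>

definition weyl_distr ::
  "real \<Rightarrow> (real^'n \<Rightarrow> real^'n \<Rightarrow> complex) \<Rightarrow> (real^'n \<Rightarrow> complex) \<Rightarrow> (real^'n \<Rightarrow> complex) \<Rightarrow> complex"
  where
  "weyl_distr h a u \<phi> = (LINT x|lborel. u x * weyl h (\<lambda>x \<xi>. a x (- \<xi>)) \<phi> x)"

definition weyl_distr_eq ::
  "real \<Rightarrow> (real^'n \<Rightarrow> real^'n \<Rightarrow> complex) \<Rightarrow> (real^'n \<Rightarrow> complex) \<Rightarrow> (real^'n \<Rightarrow> complex) \<Rightarrow> bool"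
  where
  "weyl_distr_eq h a u f \<longleftrightarrow>
     (\<forall>\<phi>\<in>test_function. weyl_distr h a u \<phi> = (LINT x|lborel. f x * \<phi> x))"

definition D_max ::
  "real \<Rightarrow> (real^'n \<Rightarrow> real^'n \<Rightarrow> complex) \<Rightarrow> (real^'n \<Rightarrow> complex) set" where
  "D_max h a = {u \<in> L2. \<exists>f \<in> L2. weyl_distr_eq h a u f}"

end

theory Submission
  imports Defs "HOL-Probability.Probability"
begin

text \<open>
  Write \<open>\<eta> = h / 2\<pi>\<close> and \<open>P = - \<eta>\<^sup>2 \<Delta> + V\<close>. Fourier inversion on Schwartz functions identifies the Weyl
  quantization with \<open>P\<close>, which is its own transpose for the bilinear pairing \<open>\<integral> u \<phi>\<close>.

  A square integrable weak solution of \<open>P u + u = 0\<close> vanishes: mollify it and test with a cutoff times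
  its conjugate; since \<open>Re V \<ge> 0\<close> only the gradient of the cutoff survives. Together with
  \<open>\<parallel>\<phi>\<parallel> \<le> \<parallel>P \<phi> + \<phi>\<parallel>\<close> this makes \<open>P + 1\<close> bijective both on the closure and on the maximal domain,
  so the two realizations agree. As \<open>P\<close> is its own transpose, an a priori bound for \<open>P - z\<close> on test functions
  then already yields the resolvent.

  The a priori bound needs no pseudodifferential multiplier. Put \<open>\<mu> = Im z\<close>, \<open>\<Lambda> = \<bar>z\<bar> - T\<close>,
  \<open>q = \<Lambda> + \<bar>V2'\<bar>\<^sup>2\<close>, \<open>\<delta> = (\<eta>\<^sup>2 q)^(1/3)\<close> and \<open>s = (V2 - \<mu>) / \<delta>\<close>. The energy identity bounds \<open>\<eta> \<nabla>u\<close>,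
  the imaginary part of \<open>\<langle>(P - z) u, arctan(s) u\<rangle>\<close> bounds \<open>\<integral> \<delta> s arctan(s) \<bar>u\<bar>\<^sup>2\<close>, and integrating the
  divergence of \<open>arctan(s) \<delta>\<^sup>2 V2' / q \<bar>u\<bar>\<^sup>2\<close> controls \<open>\<integral> \<delta> \<bar>u\<bar>\<^sup>2\<close> where \<open>\<bar>s\<bar> \<le> 1\<close>, because there
  \<open>\<bar>V2'\<bar>\<^sup>2\<close> is at least of order \<open>\<Lambda>\<close>.
\<close>

section \<open>Partial derivatives\<close>

text \<open>Two obstacles shape the proof. An element of the maximal domain is merely square
  integrable, so it cannot be integrated by parts directly. A rough weak solution is therefore
  treated only at the point -1, where positivity of Re V and plain continuity of V suffice;
  everything else is proved on test functions and passed to the closure. The second obstacle is that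
  V2' is unbounded: a multiplier built on the constant scale (\<eta>^2 \<Lambda>)^(1/3) would have
  uncontrolled derivatives. Letting the scale depend on x through q makes
  \<open>\<eta> |\<theta>'|\<close> at most of order sqrt \<delta>, exactly what Young's inequality
  can balance between \<delta> |u|^2 and |\<eta> u'|^2. The price is that derivatives of \<delta>
  appear; they carry the factor \<delta> / q \<le> \<tau>, and \<tau> is made small by the lower
  bound M h on |z| - K T, with M = 1 / \<tau>^2. The function arctan is used because it is bounded,
  so that pairing with it costs only a constant, because s arctan s is bounded below for |s| \<ge>
  1, and because its derivative is bounded below for |s| \<le> 1: each region is served by one of
  the two identities.\<close>

definition has_partial :: "(real^'n \<Rightarrow> 'b::real_normed_vector) \<Rightarrow> 'n \<Rightarrow> real^'n \<Rightarrow> 'b \<Rightarrow> bool" where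
  "has_partial f i x d \<longleftrightarrow> ((\<lambda>t. f (x + t *\<^sub>R axis i 1)) has_vector_derivative d) (at 0)"

lemma has_partial_eq: "has_partial f i x d \<Longrightarrow> partial i f x = d"
  unfolding has_partial_def partial_def by (rule vector_derivative_at)

lemma has_derivative_imp_has_partial:
  assumes "(f has_derivative f') (at x)"
  shows "has_partial f i x (f' (axis i 1))"
proof -
  have 1: "((\<lambda>t::real. x + t *\<^sub>R axis i 1) has_derivative (\<lambda>t. t *\<^sub>R axis i 1)) (at 0)"
    by (auto intro!: derivative_eq_intros)
  have "((\<lambda>t::real. f (x + t *\<^sub>R axis i 1)) has_derivative (\<lambda>t. f' (t *\<^sub>R axis i 1))) (at 0)"
    using has_derivative_compose[OF 1, of f f'] assms by simp
  moreover have "f' (t *\<^sub>R axis i 1) = t *\<^sub>R f' (axis i 1)" for t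
    using assms by (simp add: has_derivative_def bounded_linear.linear linear_scale)
  ultimately show ?thesis
    by (simp add: has_partial_def has_vector_derivative_def)
qed

lemma has_partial_partial:
  "f differentiable (at x) \<Longrightarrow> has_partial f i x (partial i f x)"
  by (metis differentiable_def has_derivative_imp_has_partial has_partial_eq)

text \<open>Moving the base point along the axis turns a derivative at parameter 0 into one at every
  parameter, the form needed by the fundamental theorem of calculus and by the mean value
  inequality.\<close>

lemma has_partial_line:
  assumes "\<And>x. has_partial f i x (g x)"
  shows "((\<lambda>t. f (x + t *\<^sub>R axis i 1)) has_vector_derivative g (x + s *\<^sub>R axis i 1)) (at s)"
proof -
  have "((\<lambda>t. f ((x + s *\<^sub>R axis i 1) + t *\<^sub>R axis i 1)) has_vector_derivative g (x + s *\<^sub>R axis i 1)) (at (s - s))"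
    using assms[of "x + s *\<^sub>R axis i 1"] by (simp add: has_partial_def)
  then have "(((\<lambda>t. f ((x + s *\<^sub>R axis i 1) + t *\<^sub>R axis i 1)) \<circ> (\<lambda>t. t - s)) has_vector_derivative (1 *\<^sub>R g (x + s *\<^sub>R axis i 1))) (at s)"
    by (intro vector_diff_chain_at) (auto intro!: derivative_eq_intros)
  then show ?thesis
    by (simp add: o_def algebra_simps)
qed

lemma has_partial_const: "has_partial (\<lambda>x. c) i x 0"
  by (simp add: has_partial_def)

lemma has_partial_add:
  "has_partial f i x d \<Longrightarrow> has_partial g i x e \<Longrightarrow> has_partial (\<lambda>x. f x + g x) i x (d + e)"
  unfolding has_partial_def by (rule has_vector_derivative_add)

lemma has_partial_diff:
  "has_partial f i x d \<Longrightarrow> has_partial g i x e \<Longrightarrow> has_partial (\<lambda>x. f x - g x) i x (d - e)"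
  unfolding has_partial_def by (rule has_vector_derivative_diff)

lemma has_partial_sum:
  "(\<And>j. j \<in> J \<Longrightarrow> has_partial (f j) i x (d j)) \<Longrightarrow> has_partial (\<lambda>x. \<Sum>j\<in>J. f j x) i x (\<Sum>j\<in>J. d j)"
  unfolding has_partial_def by (rule has_vector_derivative_sum)

lemma has_partial_mult:
  fixes f g :: "real^'n \<Rightarrow> 'b::real_normed_algebra"
  assumes "has_partial f i x d" "has_partial g i x e"
  shows "has_partial (\<lambda>x. f x * g x) i x (d * g x + f x * e)"
  using has_vector_derivative_mult[OF assms[unfolded has_partial_def]]
  by (simp add: has_partial_def add.commute)

lemma has_partial_linear:
  assumes "bounded_linear L" "has_partial f i x d"
  shows "has_partial (\<lambda>x. L (f x)) i x (L d)"
  using bounded_linear.has_vector_derivative[OF assms(1)] assms(2) by (simp add: has_partial_def)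

lemma has_partial_chain:
  fixes f :: "real^'n \<Rightarrow> real"
  assumes "(\<phi> has_real_derivative c) (at (f x))" "has_partial f i x d"
  shows "has_partial (\<lambda>x. \<phi> (f x)) i x (c * d)"
  using DERIV_chain2[of \<phi> c "\<lambda>t. f (x + t *\<^sub>R axis i 1)" 0 d UNIV] assms
  by (simp add: has_partial_def has_real_derivative_iff_has_vector_derivative)

lemma has_partial_power2:
  fixes f :: "real^'n \<Rightarrow> real"
  assumes "has_partial f i x d"
  shows "has_partial (\<lambda>x. (f x)\<^sup>2) i x (2 * f x * d)"
  by (rule has_partial_chain[where \<phi> = "\<lambda>t. t\<^sup>2", OF _ assms]) (auto intro!: derivative_eq_intros)

lemma has_partial_divide:
  fixes f g :: "real^'n \<Rightarrow> real"
  assumes "has_partial f i x d" "has_partial g i x e" "g x \<noteq> 0"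
  shows "has_partial (\<lambda>x. f x / g x) i x ((d * g x - f x * e) / (g x)\<^sup>2)"
proof -
  have "has_partial (\<lambda>x. inverse (g x)) i x (- (inverse (g x) ^ Suc (Suc 0)) * e)"
    by (rule has_partial_chain[OF _ assms(2)]) (rule DERIV_inverse[OF assms(3)])
  from has_partial_mult[OF assms(1) this] show ?thesis
    using assms(3) by (simp add: field_simps power2_eq_square)
qed

lemma has_partial_component: "has_partial (\<lambda>x. x $ j) i x (if i = j then 1 else 0)"
  unfolding has_partial_def by (auto intro!: derivative_eq_intros simp: axis_def)

lemma has_partial_norm_power2:
  fixes x :: "real^'n"
  shows "has_partial (\<lambda>x. (norm x)\<^sup>2) i x (2 * x $ i)"
proof -
  have "((\<lambda>x::real^'n. x \<bullet> x) has_derivative (\<lambda>h. x \<bullet> h + h \<bullet> x)) (at x)"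
    by (auto intro!: derivative_eq_intros)
  from has_derivative_imp_has_partial[OF this, of i] show ?thesis
    by (simp add: power2_norm_eq_inner inner_axis inner_axis')
qed

section \<open>Smooth functions\<close>

lemma partials_snoc: "partials (\<alpha> @ [i]) f = partials \<alpha> (partial i f)"
  by (induction \<alpha>) auto

lemma smooth_imp_differentiable: "smooth f \<Longrightarrow> f differentiable (at x)"
  unfolding smooth_def by (metis partials.simps(1))

lemma smooth_partial: "smooth f \<Longrightarrow> smooth (partial i f)"
  unfolding smooth_def by (metis partials_snoc)

text \<open>Membership in \<open>P\<close> passes along any list of directions by induction, so
  exhibiting a class stable under one derivative replaces Leibniz and chain rules for whole
  multi-indices.\<close>

lemma smooth_coinduct:
  assumes "P f" and step: "\<And>f. P f \<Longrightarrow> (\<forall>x. f differentiable (at x)) \<and> (\<forall>i. P (partial i f))"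
  shows "smooth f"
proof -
  have "P (partials \<alpha> f)" for \<alpha>
    by (induction \<alpha>) (auto simp: \<open>P f\<close> step)
  then show ?thesis
    unfolding smooth_def using step by blast
qed

lemma smooth_has_partial: "smooth f \<Longrightarrow> has_partial f i x (partial i f x)"
  by (simp add: has_partial_partial smooth_imp_differentiable)

lemma smooth_continuous: "smooth f \<Longrightarrow> continuous_on S f"
  by (meson continuous_at_imp_continuous_on differentiable_imp_continuous_within smooth_imp_differentiable)

lemma smooth_const: "smooth (\<lambda>x. c)"
proof (rule smooth_coinduct[where P = "\<lambda>f. \<exists>c. f = (\<lambda>x. c)"])
  fix f :: "real^'a \<Rightarrow> 'b" assume "\<exists>c. f = (\<lambda>x. c)"
  then obtain c where f: "f = (\<lambda>x. c)" by blast
  have "partial i f = (\<lambda>x. 0)" for i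
    unfolding f by (intro ext has_partial_eq has_partial_const)
  then show "(\<forall>x. f differentiable (at x)) \<and> (\<forall>i. \<exists>c. partial i f = (\<lambda>x. c))"
    unfolding f by (intro conjI allI differentiable_const exI)
qed (rule exI, rule refl)

lemma smooth_add:
  assumes "smooth f" "smooth g" shows "smooth (\<lambda>x. f x + g x)"
proof (rule smooth_coinduct[where P = "\<lambda>k. \<exists>f g. smooth f \<and> smooth g \<and> k = (\<lambda>x. f x + g x)"])
  fix k :: "real^'a \<Rightarrow> 'b" assume "\<exists>f g. smooth f \<and> smooth g \<and> k = (\<lambda>x. f x + g x)"
  then obtain f g where *: "smooth f" "smooth g" and k: "k = (\<lambda>x. f x + g x)" by blast
  have "partial i k = (\<lambda>x. partial i f x + partial i g x)" for i
    unfolding k using * by (intro ext has_partial_eq has_partial_add smooth_has_partial)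
  with * show "(\<forall>x. k differentiable (at x)) \<and> (\<forall>i. \<exists>f g. smooth f \<and> smooth g \<and> partial i k = (\<lambda>x. f x + g x))"
    unfolding k by (auto intro!: differentiable_add simp: smooth_imp_differentiable intro: smooth_partial)
qed (use assms in blast)

lemma smooth_linear:
  assumes L: "bounded_linear L" and "smooth f" shows "smooth (\<lambda>x. L (f x))"
proof (rule smooth_coinduct[where P = "\<lambda>k. \<exists>f. smooth f \<and> k = (\<lambda>x. L (f x))"])
  fix k assume "\<exists>f. smooth f \<and> k = (\<lambda>x. L (f x))"
  then obtain f where *: "smooth f" and k: "k = (\<lambda>x. L (f x))" by blast
  have "partial i k = (\<lambda>x. L (partial i f x))" for i
    unfolding k by (rule ext, rule has_partial_eq, rule has_partial_linear[OF L], rule smooth_has_partial, rule *)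
  moreover have "k differentiable (at x)" for x
    unfolding k using smooth_imp_differentiable[OF *, of x] bounded_linear.has_derivative[OF L]
    by (auto simp: differentiable_def)
  ultimately show "(\<forall>x. k differentiable (at x)) \<and> (\<forall>i. \<exists>f. smooth f \<and> partial i k = (\<lambda>x. L (f x)))"
    using * by (auto intro: smooth_partial)
qed (use assms in blast)

text \<open>Finite sums of products form a class that the Leibniz rule maps to itself. The factor
  classes are parameters; the instances used are smooth with smooth, smooth with flat exponentials,
  and slowly growing with Schwartz.\<close>

inductive prod_sum :: "((real^'n \<Rightarrow> 'b::real_normed_algebra) \<Rightarrow> bool) \<Rightarrow> ((real^'n \<Rightarrow> 'b) \<Rightarrow> bool) \<Rightarrow> (real^'n \<Rightarrow> 'b) \<Rightarrow> bool"
  for A B where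
  prod: "A a \<Longrightarrow> B b \<Longrightarrow> prod_sum A B (\<lambda>x. a x * b x)"
| add: "prod_sum A B f \<Longrightarrow> prod_sum A B g \<Longrightarrow> prod_sum A B (\<lambda>x. f x + g x)"

text \<open>Linearity of the derivative leaves only single products to check. The second class need
  not be closed under differentiation by itself: differentiating a flat exponential of 1 - |x|^2
  also produces a polynomial factor, which has to move into the first class.\<close>

lemma prod_sum_step:
  assumes "prod_sum A B f"
    and "\<And>a b. A a \<Longrightarrow> B b \<Longrightarrow> (\<forall>x. (\<lambda>x. a x * b x) differentiable (at x)) \<and> (\<forall>i. prod_sum A B (partial i (\<lambda>x. a x * b x)))"
  shows "(\<forall>x. f differentiable (at x)) \<and> (\<forall>i. prod_sum A B (partial i f))"
  using assms(1)
proof induction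
  case (add f g)
  then have "partial i (\<lambda>x. f x + g x) = (\<lambda>x. partial i f x + partial i g x)" for i
    by (intro ext has_partial_eq has_partial_add has_partial_partial) auto
  with add show ?case by (auto intro!: differentiable_add intro: prod_sum.add)
qed (use assms(2) in auto)

lemma prod_sum_partial:
  assumes "\<And>a i. A a \<Longrightarrow> (\<forall>x. a differentiable (at x)) \<and> A (partial i a)"
    and "\<And>a i. B a \<Longrightarrow> (\<forall>x. a differentiable (at x)) \<and> B (partial i a)"
    and "prod_sum A B f"
  shows "(\<forall>x. f differentiable (at x)) \<and> (\<forall>i. prod_sum A B (partial i f))"
proof (rule prod_sum_step[OF assms(3)], safe)
  fix a b i x assume ab: "A a" "B b"
  then show "(\<lambda>x. a x * b x) differentiable (at x)"
    using assms(1,2) by (intro differentiable_mult) auto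
  have "partial i (\<lambda>x. a x * b x) = (\<lambda>x. partial i a x * b x + a x * partial i b x)"
    using assms(1,2) ab by (intro ext has_partial_eq has_partial_mult has_partial_partial) auto
  then show "prod_sum A B (partial i (\<lambda>x. a x * b x))"
    using ab assms(1,2) by (auto intro!: prod_sum.intros)
qed

lemma smooth_mult:
  fixes f g :: "real^'n \<Rightarrow> 'b::real_normed_algebra"
  assumes "smooth f" "smooth g" shows "smooth (\<lambda>x. f x * g x)"
proof (rule smooth_coinduct[where P = "prod_sum smooth smooth"])
  show "prod_sum smooth smooth (\<lambda>x. f x * g x)" using assms by (rule prod_sum.prod)
qed (rule prod_sum_partial; auto simp: smooth_imp_differentiable smooth_partial)

lemma smooth_component: "smooth (\<lambda>x. x $ j)"
proof -
  have "smooth (partial i (\<lambda>x::real^'a. x $ j))" for i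
  proof -
    have "partial i (\<lambda>x::real^'a. x $ j) = (\<lambda>x. if i = j then 1 else 0)"
      by (intro ext has_partial_eq has_partial_component)
    then show ?thesis by (simp add: smooth_const)
  qed
  \<comment> \<open>The invariant contains the coordinate function itself next to all smooth
    functions; its derivatives are constants and hence already known to be smooth.\<close>
  then show ?thesis
    by (intro smooth_coinduct[where P = "\<lambda>f. f = (\<lambda>x::real^'a. x $ j) \<or> smooth f"])
       (auto simp: smooth_imp_differentiable smooth_partial bounded_linear_imp_differentiable bounded_linear_vec_nth)
qed

section \<open>Flat exponentials and smoothness of the standard bump\<close>

text \<open>A family of functions closed under differentiation that contains the standard bump \<open>exp (- 1 / t)\<close>.\<close>

definition flat_exp :: "nat \<Rightarrow> real \<Rightarrow> real" where
  "flat_exp k t = (if t \<le> 0 then 0 else (1 / t) ^ k * exp (- (1 / t)))"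

lemma flat_exp_tendsto_0: "(flat_exp k \<longlongrightarrow> 0) (at 0)"
proof -
  have "((\<lambda>t::real. (1 / t) ^ k * exp (- (1 / t))) \<longlongrightarrow> 0) (at_right 0)"
  proof -
    have "((\<lambda>u::real. u ^ k * exp (- u)) \<longlongrightarrow> 0) at_top"
      using tendsto_power_div_exp_0[of k] by (simp add: exp_minus divide_inverse)
    moreover have "filterlim (\<lambda>t::real. 1 / t) at_top (at_right 0)"
      using filterlim_inverse_at_top_right by (simp add: inverse_eq_divide)
    ultimately show ?thesis by (rule filterlim_compose)
  qed
  then have "(flat_exp k \<longlongrightarrow> 0) (at_right 0)"
    by (rule Lim_transform_eventually)
       (auto simp: flat_exp_def intro!: eventually_at_rightI[of 0 1])
  moreover have "(flat_exp k \<longlongrightarrow> 0) (at_left 0)"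
    by (rule Lim_transform_eventually[OF tendsto_const])
       (auto simp: flat_exp_def intro!: eventually_at_leftI[of "-1"])
  ultimately show ?thesis by (simp add: filterlim_split_at)
qed

text \<open>For t > 0 this is calculus, and for t \<le> 0 both terms on the right vanish by
  definition. One formula thus covers all t and keeps the derivative in the span of the
  family.\<close>

lemma flat_exp_deriv: "(flat_exp k has_real_derivative (- real k * flat_exp (Suc k) t + flat_exp (k + 2) t)) (at t)"
proof -
  consider "t < 0" | "t = 0" | "t > 0" by linarith
  then show ?thesis
  proof cases
    case 1
    have "((\<lambda>t. 0) has_real_derivative 0) (at t)" by simp
    then have "(flat_exp k has_real_derivative 0) (at t)"
      by (rule has_field_derivative_transform_within_open[of _ _ _ "{..<0}"])
         (use 1 in \<open>auto simp: flat_exp_def\<close>)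
    with 1 show ?thesis by (simp add: flat_exp_def)
  next
    case 2
    \<comment> \<open>At 0 the difference quotient of \<open>flat_exp k\<close> is itself a member
      of the family, with exponent \<open>Suc k\<close>, so it tends to 0.\<close>
    have "(\<lambda>h. (flat_exp k (0 + h) - flat_exp k 0) / h) = flat_exp (Suc k)"
      by (auto simp: flat_exp_def fun_eq_iff field_simps)
    then have "(flat_exp k has_real_derivative 0) (at 0)"
      using flat_exp_tendsto_0[of "Suc k"] by (simp add: DERIV_def)
    with 2 show ?thesis by (simp add: flat_exp_def)
  next
    case 3
    have "((\<lambda>t. (1 / t) ^ k * exp (- (1 / t))) has_real_derivative
       (- real k * ((1 / t) ^ Suc k * exp (- (1 / t))) + (1 / t) ^ (k + 2) * exp (- (1 / t)))) (at t)"
    proof -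
      have "(1 / t) ^ (k - Suc 0) * real k * (1/t\<^sup>2) = real k * (1/t)^Suc k"
        by (cases k) (auto simp: power2_eq_square)
      then show ?thesis using 3
        by (auto intro!: derivative_eq_intros simp: field_simps power2_eq_square)
    qed
    then have "(flat_exp k has_real_derivative
       (- real k * ((1 / t) ^ Suc k * exp (- (1 / t))) + (1 / t) ^ (k + 2) * exp (- (1 / t)))) (at t)"
      by (rule has_field_derivative_transform_within_open[of _ _ _ "{0<..}"])
         (use 3 in \<open>auto simp: flat_exp_def\<close>)
    with 3 show ?thesis by (simp add: flat_exp_def)
  qed
qed

text \<open>The chain rule yields -2 x_i times flat exponentials with exponents k + 1 and k + 2. The
  polynomial factors are absorbed into the smooth coefficients, so the sums of products are stable
  under differentiation.\<close>

lemma smooth_flat_exp_norm: "smooth (\<lambda>x::real^'n. flat_exp k (1 - (norm x)\<^sup>2))"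
proof (rule smooth_coinduct[where P = "prod_sum smooth (\<lambda>f. \<exists>k. f = (\<lambda>x::real^'n. flat_exp k (1 - (norm x)\<^sup>2)))"])
  let ?B = "\<lambda>f. \<exists>k. f = (\<lambda>x::real^'n. flat_exp k (1 - (norm x)\<^sup>2))"
  have "prod_sum smooth ?B (\<lambda>x. 1 * flat_exp k (1 - (norm x)\<^sup>2))"
    by (rule prod_sum.prod) (auto simp: smooth_const)
  then show "prod_sum smooth ?B (\<lambda>x. flat_exp k (1 - (norm x)\<^sup>2))" by simp
  fix f :: "real^'n \<Rightarrow> real" assume "prod_sum smooth ?B f"
  then show "(\<forall>x. f differentiable (at x)) \<and> (\<forall>i. prod_sum smooth ?B (partial i f))"
  proof (rule prod_sum_step)
    fix a b :: "real^'n \<Rightarrow> real" assume a: "smooth a" and "?B b"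
    then obtain k where b: "b = (\<lambda>x::real^'n. flat_exp k (1 - (norm x)\<^sup>2))" by blast
    let ?d = "\<lambda>k x. - real k * flat_exp (Suc k) (1 - (norm (x::real^'n))\<^sup>2) + flat_exp (k + 2) (1 - (norm x)\<^sup>2)"
    have hp: "has_partial b i x (?d k x * (0 - 2 * x $ i))" for i x
      unfolding b by (rule has_partial_chain[OF flat_exp_deriv]) (intro has_partial_diff has_partial_const has_partial_norm_power2)
    have "b differentiable (at x)" for x
    proof -
      have "(flat_exp k has_derivative (*) (?d k x)) (at (1 - (norm x)\<^sup>2))"
        using flat_exp_deriv[of k "1 - (norm x)\<^sup>2"] by (simp add: has_field_derivative_def)
      moreover have "((\<lambda>x::real^'n. 1 - x \<bullet> x) has_derivative (\<lambda>h. 0 - (x \<bullet> h + h \<bullet> x))) (at x)"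
        by (auto intro!: derivative_eq_intros)
      ultimately have "((\<lambda>x. flat_exp k (1 - x \<bullet> x)) has_derivative (\<lambda>h. ?d k x * (0 - (x \<bullet> h + h \<bullet> x)))) (at x)"
        using has_derivative_compose[of "\<lambda>x::real^'n. 1 - x \<bullet> x" _ x UNIV "flat_exp k"] by (simp add: power2_norm_eq_inner)
      then show ?thesis unfolding b by (auto simp: differentiable_def power2_norm_eq_inner)
    qed
    then have "(\<lambda>x. a x * b x) differentiable (at x)" for x
      using a by (intro differentiable_mult) (auto simp: smooth_imp_differentiable)
    moreover have "prod_sum smooth ?B (partial i (\<lambda>x. a x * b x))" for i
    proof -
      let ?c1 = "\<lambda>x. a x * (2 * real k * x $ i)" and ?c2 = "\<lambda>x. a x * (- 2 * x $ i)"
      have c: "smooth ?c1" "smooth ?c2"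
        by (intro smooth_mult a smooth_const smooth_component)+
      have 1: "partial i (\<lambda>x. a x * b x) = (\<lambda>x. partial i a x * b x + a x * (?d k x * (0 - 2 * x $ i)))"
        by (intro ext has_partial_eq has_partial_mult hp smooth_has_partial a)
      have 2: "\<dots> = (\<lambda>x. partial i a x * flat_exp k (1 - (norm x)\<^sup>2) +
          (?c1 x * flat_exp (Suc k) (1 - (norm x)\<^sup>2) + ?c2 x * flat_exp (k+2) (1 - (norm x)\<^sup>2)))"
        by (auto simp: b fun_eq_iff algebra_simps)
      show ?thesis unfolding 1 2
        by (intro prod_sum.add prod_sum.prod c smooth_partial a; blast)
    qed
    ultimately show "(\<forall>x. (\<lambda>x. a x * b x) differentiable (at x)) \<and> (\<forall>i. prod_sum smooth ?B (partial i (\<lambda>x. a x * b x)))"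
      by blast
  qed
qed

text \<open>Serves the dilations of the bump, the reflections x - y of test functions (c = -1) and
  the midpoints in the Weyl kernel (c = 1/2).\<close>

lemma partials_affine:
  fixes f :: "real^'n \<Rightarrow> 'b::real_normed_vector"
  assumes "smooth f"
  shows "partials \<alpha> (\<lambda>y. f (a + c *\<^sub>R y)) = (\<lambda>y. c ^ length \<alpha> *\<^sub>R partials \<alpha> f (a + c *\<^sub>R y))"
proof (induction \<alpha>)
  case (Cons i \<alpha>)
  have "has_partial (\<lambda>y. c ^ length \<alpha> *\<^sub>R partials \<alpha> f (a + c *\<^sub>R y)) i y (c ^ Suc (length \<alpha>) *\<^sub>R partials (i # \<alpha>) f (a + c *\<^sub>R y))" for y
  proof -
    let ?g = "partials \<alpha> f"
    have "((\<lambda>t. ?g ((a + c *\<^sub>R y) + t *\<^sub>R axis i 1)) has_vector_derivative partial i ?g (a + c *\<^sub>R y)) (at (c * 0))"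
      using has_partial_partial[of ?g "a + c *\<^sub>R y" i] assms by (simp add: has_partial_def smooth_def)
    then have "(((\<lambda>t. ?g ((a + c *\<^sub>R y) + t *\<^sub>R axis i 1)) \<circ> (\<lambda>t. c * t)) has_vector_derivative (c *\<^sub>R partial i ?g (a + c *\<^sub>R y))) (at 0)"
      by (intro vector_diff_chain_at) (auto intro!: derivative_eq_intros)
    then have *: "has_partial (\<lambda>y. ?g (a + c *\<^sub>R y)) i y (c *\<^sub>R partial i ?g (a + c *\<^sub>R y))"
      by (simp add: o_def has_partial_def algebra_simps)
    show ?thesis
      using has_partial_linear[OF bounded_linear_scaleR_right[of "c ^ length \<alpha>"] *]
      by (simp add: mult.commute)
  qed
  then show ?case
    by (auto simp: Cons fun_eq_iff dest: has_partial_eq)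
qed auto

lemma smooth_affine:
  assumes "smooth f" shows "smooth (\<lambda>y. f (a + c *\<^sub>R y))"
  unfolding smooth_def partials_affine[OF assms]
proof (intro allI)
  fix \<alpha> x
  have "partials \<alpha> f differentiable (at (a + c *\<^sub>R x))" using assms by (simp add: smooth_def)
  then have "(\<lambda>y. partials \<alpha> f (a + c *\<^sub>R y)) differentiable (at x)"
    by (rule differentiable_compose[of "partials \<alpha> f" "\<lambda>y. a + c *\<^sub>R y"])
       (intro differentiable_add differentiable_scaleR differentiable_const differentiable_ident)
  then show "(\<lambda>y. c ^ length \<alpha> *\<^sub>R partials \<alpha> f (a + c *\<^sub>R y)) differentiable (at x)"
    by (intro differentiable_scaleR) auto
qed

section \<open>Integration by parts\<close>

lemma
  fixes f :: "'a::euclidean_space \<Rightarrow> 'b::{banach, second_countable_topology}"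
  assumes c: "c \<noteq> 0" and f: "integrable lborel f"
  shows integrable_affine: "integrable lborel (\<lambda>x. f (t + c *\<^sub>R x))"
    and integral_affine: "integral\<^sup>L lborel f = \<bar>c\<bar> ^ DIM('a) *\<^sub>R (\<integral>x. f (t + c *\<^sub>R x) \<partial>lborel)"
proof -
  have [measurable]: "f \<in> borel_measurable borel" using f by simp
  have eq: "(lborel :: 'a measure) = density (distr lborel borel (\<lambda>x. t + c *\<^sub>R x)) (\<lambda>_. \<bar>c\<bar> ^ DIM('a))"
    using lborel_affine[OF c, of t] .
  have "integrable (density (distr lborel borel (\<lambda>x::'a. t + c *\<^sub>R x)) (\<lambda>_. ennreal (\<bar>c\<bar> ^ DIM('a)))) f"
    using f eq by (simp add: ennreal_power)
  then have "integrable (distr lborel borel (\<lambda>x::'a. t + c *\<^sub>R x)) (\<lambda>x. \<bar>c\<bar> ^ DIM('a) *\<^sub>R f x)"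
    by (subst (asm) integrable_density) auto
  then have "integrable lborel (\<lambda>x. \<bar>c\<bar> ^ DIM('a) *\<^sub>R f (t + c *\<^sub>R x))"
    by (subst (asm) integrable_distr_eq) auto
  then have "integrable lborel (\<lambda>x. inverse (\<bar>c\<bar> ^ DIM('a)) *\<^sub>R (\<bar>c\<bar> ^ DIM('a) *\<^sub>R f (t + c *\<^sub>R x)))"
    by (rule integrable_scaleR_right)
  then show "integrable lborel (\<lambda>x. f (t + c *\<^sub>R x))"
    using c by simp
  have "integral\<^sup>L lborel f = integral\<^sup>L (density (distr lborel borel (\<lambda>x::'a. t + c *\<^sub>R x)) (\<lambda>_. ennreal (\<bar>c\<bar> ^ DIM('a)))) f"
    using eq by (simp add: ennreal_power)
  also have "\<dots> = \<bar>c\<bar> ^ DIM('a) *\<^sub>R (\<integral>x. f (t + c *\<^sub>R x) \<partial>lborel)"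
    by (subst integral_density) (auto simp: integral_distr)
  finally show "integral\<^sup>L lborel f = \<bar>c\<bar> ^ DIM('a) *\<^sub>R (\<integral>x. f (t + c *\<^sub>R x) \<partial>lborel)" .
qed

lemma integral_translate:
  fixes f :: "'a::euclidean_space \<Rightarrow> 'b::{banach, second_countable_topology}"
  assumes "integrable lborel f"
  shows "(\<integral>x. f (x + t) \<partial>lborel) = integral\<^sup>L lborel f"
  using integral_affine[OF _ assms, of 1 t] by (simp add: add.commute)

lemma integrable_translate:
  fixes f :: "'a::euclidean_space \<Rightarrow> 'b::{banach, second_countable_topology}"
  assumes "integrable lborel f"
  shows "integrable lborel (\<lambda>x. f (x + t))"
  using integrable_affine[OF _ assms, of 1 t] by (simp add: add.commute)

text \<open>By translation invariance, \<open>0 = \<integral> f (x + e) - f x = \<integral>\<^sub>x \<integral>\<^sub>0\<^sup>1 g (x + t e)\<close>, where \<open>e\<close> is the unit vector in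
  direction \<open>i\<close>; after exchanging the integrals this is \<open>\<integral> g\<close>.\<close>

lemma integral_partial_eq_0:
  fixes f g :: "real^'n \<Rightarrow> 'b::euclidean_space"
  assumes f: "integrable lborel f" and g: "integrable lborel g"
    and cont: "continuous_on UNIV g" and fg: "\<And>x. has_partial f i x (g x)"
  shows "integral\<^sup>L lborel g = 0"
proof -
  let ?e = "axis i 1 :: real^'n"
  have [measurable]: "g \<in> borel_measurable borel" using g by simp
  have FTC: "(\<integral>t. indicator {0..1} t *\<^sub>R g (x + t *\<^sub>R ?e) \<partial>lborel) = f (x + ?e) - f x" for x
  proof -
    have "(\<integral>t. indicator {0..1} t *\<^sub>R g (x + t *\<^sub>R ?e) \<partial>lborel) = f (x + 1 *\<^sub>R ?e) - f (x + 0 *\<^sub>R ?e)"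
    proof (rule integral_FTC_Icc)
      show "((\<lambda>t. f (x + t *\<^sub>R ?e)) has_vector_derivative g (x + t *\<^sub>R ?e)) (at t within {0..1})" for t
        by (rule has_vector_derivative_at_within[OF has_partial_line[OF fg]])
      show "continuous_on {0..1} (\<lambda>t. g (x + t *\<^sub>R ?e))"
        by (rule continuous_on_compose2[OF cont]) (auto intro!: continuous_intros)
    qed auto
    then show ?thesis by simp
  qed
  \<comment> \<open>Fubini is justified because, for each t in [0, 1], the integral over x of the
    norm equals that of g, by translation invariance.\<close>
  have int: "integrable (lborel \<Otimes>\<^sub>M lborel) (\<lambda>(x, t). indicator {0..1} t *\<^sub>R g (x + t *\<^sub>R ?e))"
  proof -
    have "integrable (lborel \<Otimes>\<^sub>M lborel) (\<lambda>(t, x). indicator {0..1} t *\<^sub>R g (x + t *\<^sub>R ?e))"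
    proof (rule lborel_pair.Fubini_integrable)
      have eq: "(\<integral>x. norm (indicator {0..1} t *\<^sub>R g (x + t *\<^sub>R ?e)) \<partial>lborel) = indicator {0..1} t * (\<integral>x. norm (g x) \<partial>lborel)" for t
        using integral_translate[of "\<lambda>x. norm (g x)" "t *\<^sub>R ?e"] g by (simp add: indicator_def)
      show "integrable lborel (\<lambda>t. \<integral>x. norm (case (t, x) of (t, x) \<Rightarrow> indicator {0..1} t *\<^sub>R g (x + t *\<^sub>R ?e)) \<partial>lborel)"
        unfolding prod.case eq by (intro integrable_mult_left) (simp add: integrable_indicator_iff)
      show "AE t in lborel. integrable lborel (\<lambda>x. case (t, x) of (t, x) \<Rightarrow> indicator {0..1} t *\<^sub>R g (x + t *\<^sub>R ?e))"
        using integrable_translate[OF g] by auto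
    qed measurable
    from lborel_pair.integrable_product_swap[OF this] show ?thesis
      by (simp add: case_prod_unfold)
  qed
  have "(\<integral>x. f (x + ?e) - f x \<partial>lborel) = 0"
    using integral_translate[OF f] integrable_translate[OF f] f by (subst Bochner_Integration.integral_diff) auto
  then have "0 = (\<integral>x. (\<integral>t. indicator {0..1} t *\<^sub>R g (x + t *\<^sub>R ?e) \<partial>lborel) \<partial>lborel)"
    by (simp add: FTC)
  also have "\<dots> = (\<integral>t. (\<integral>x. indicator {0..1} t *\<^sub>R g (x + t *\<^sub>R ?e) \<partial>lborel) \<partial>lborel)"
    using lborel_pair.Fubini_integral[OF int] by simp
  also have "\<dots> = (\<integral>t. indicator {0..1::real} t *\<^sub>R integral\<^sup>L lborel g \<partial>lborel)"
    by (rule Bochner_Integration.integral_cong[OF refl]) (simp add: integral_translate[OF g])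
  also have "\<dots> = (\<integral>t. indicat_real {0..1::real} t \<partial>lborel) *\<^sub>R integral\<^sup>L lborel g"
    by (rule integral_scaleR_left) (simp add: integrable_indicator_iff)
  finally show ?thesis by simp
qed

lemma integrable_compact_support:
  fixes f :: "'a::euclidean_space \<Rightarrow> 'b::{banach, second_countable_topology}"
  assumes "continuous_on UNIV f" "\<And>x. norm x > R \<Longrightarrow> f x = 0"
  shows "integrable lborel f"
proof -
  have "integrable lborel (\<lambda>x. indicator (cball 0 R) x *\<^sub>R f x)"
    by (rule borel_integrable_compact) (auto intro: continuous_on_subset[OF assms(1)])
  moreover have "(\<lambda>x. indicator (cball 0 R) x *\<^sub>R f x) = f"
    using assms(2) by (force simp: indicator_def fun_eq_iff)
  ultimately show ?thesis by simp
qed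

text \<open>The set norm x > R is open, so f vanishes along a whole interval of parameters around
  0.\<close>

lemma has_partial_eq_0_outside:
  fixes f :: "real^'n \<Rightarrow> 'b::real_normed_vector"
  assumes f: "\<And>x. norm x > R \<Longrightarrow> f x = 0" and d: "has_partial f i x d" and x: "norm x > R"
  shows "d = 0"
proof -
  have "\<forall>\<^sub>F t in nhds 0. norm (x + t *\<^sub>R axis i 1) > R"
  proof -
    have "((\<lambda>t::real. norm (x + t *\<^sub>R axis i 1)) \<longlongrightarrow> norm (x + 0 *\<^sub>R axis i (1::real))) (nhds 0)"
      by (intro tendsto_intros filterlim_ident)
    then show ?thesis using x by (auto dest: order_tendstoD(1))
  qed
  then have "\<forall>\<^sub>F t in nhds 0. f (x + t *\<^sub>R axis i 1) = 0"
    by eventually_elim (rule f)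
  then have "((\<lambda>t. 0) has_vector_derivative d) (at 0)"
    using d x f by (subst (asm) has_partial_def, subst (asm) has_vector_derivative_cong_ev[where g = "\<lambda>t. 0"]) auto
  then show ?thesis
    by (metis has_vector_derivative_const vector_derivative_unique_at)
qed

lemma integral_partial_compact_support:
  fixes f g :: "real^'n \<Rightarrow> 'b::euclidean_space"
  assumes fg: "\<And>x. has_partial f i x (g x)" and f: "continuous_on UNIV f" and g: "continuous_on UNIV g"
    and supp: "\<And>x. norm x > R \<Longrightarrow> f x = 0"
  shows "integral\<^sup>L lborel g = 0"
proof (rule integral_partial_eq_0[OF _ _ g fg])
  show "integrable lborel f" using f supp by (rule integrable_compact_support)
  show "integrable lborel g" using g has_partial_eq_0_outside[OF supp fg] by (rule integrable_compact_support)
qed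

section \<open>The space \<open>L\<^sup>2\<close>\<close>

lemma L2_measurable: "u \<in> L2 \<Longrightarrow> u \<in> borel_measurable borel"
  by (simp add: L2_def)

lemma L2_integrable: "u \<in> L2 \<Longrightarrow> integrable lborel (\<lambda>x. (norm (u x))\<^sup>2)"
  by (simp add: L2_def)

lemma L2_norm_nonneg: "0 \<le> L2_norm u"
  by (simp add: L2_norm_def)

lemma L2_norm_power2: "(L2_norm u)\<^sup>2 = (LINT x|lborel. (norm (u x))\<^sup>2)"
  by (simp add: L2_norm_def)

lemma L2_norm_cong_AE:
  assumes "u \<in> borel_measurable borel" "v \<in> borel_measurable borel" "AE x in lborel. u x = v x"
  shows "L2_norm u = L2_norm v"
  unfolding L2_norm_def using assms by (auto intro!: arg_cong[where f = sqrt] integral_cong_AE)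

lemma L2_add:
  assumes "u \<in> L2" "v \<in> L2" shows "(\<lambda>x. u x + v x) \<in> L2"
proof -
  note [measurable] = L2_measurable[OF assms(1)] L2_measurable[OF assms(2)]
  have "norm ((norm (u x + v x))\<^sup>2) \<le> norm (2 * (norm (u x))\<^sup>2 + 2 * (norm (v x))\<^sup>2)" for x
  proof -
    have "(norm (u x + v x))\<^sup>2 \<le> (norm (u x) + norm (v x))\<^sup>2"
      by (intro power_mono norm_triangle_ineq) auto
    also have "\<dots> \<le> 2 * (norm (u x))\<^sup>2 + 2 * (norm (v x))\<^sup>2"
      using sum_squares_bound[of "norm (u x)" "norm (v x)"] by (simp add: power2_sum)
    finally show ?thesis by simp
  qed
  then have "integrable lborel (\<lambda>x. (norm (u x + v x))\<^sup>2)"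
    by (intro Bochner_Integration.integrable_bound[where g = "\<lambda>x. (norm (u x + v x))\<^sup>2", OF Bochner_Integration.integrable_add[OF
        integrable_mult_right[OF L2_integrable[OF assms(1)], of 2] integrable_mult_right[OF L2_integrable[OF assms(2)], of 2]]] AE_I2)
       simp_all
  then show ?thesis by (simp add: L2_def)
qed

lemma L2_scale: "u \<in> L2 \<Longrightarrow> (\<lambda>x. c * u x) \<in> L2"
  by (auto simp: L2_def norm_mult power_mult_distrib)

lemma L2_uminus: "u \<in> L2 \<Longrightarrow> (\<lambda>x. - u x) \<in> L2"
  by (auto simp: L2_def)

lemma L2_diff: "u \<in> L2 \<Longrightarrow> v \<in> L2 \<Longrightarrow> (\<lambda>x. u x - v x) \<in> L2"
  using L2_add[of u "\<lambda>x. - v x"] L2_uminus by auto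

lemma L2_cnj: "u \<in> L2 \<Longrightarrow> (\<lambda>x. cnj (u x)) \<in> L2"
  using measurable_compose[of u borel borel cnj borel]
    borel_measurable_continuous_onI[OF linear_continuous_on[OF bounded_linear_cnj]]
  by (simp add: L2_def)

lemma L2_integrable_mult:
  assumes "u \<in> L2" "v \<in> L2" shows "integrable lborel (\<lambda>x. u x * v x)"
proof (rule Bochner_Integration.integrable_bound[of _ "\<lambda>x. (norm (u x))\<^sup>2 + (norm (v x))\<^sup>2"])
  have "norm (u x * v x) \<le> (norm (u x))\<^sup>2 + (norm (v x))\<^sup>2" for x
  proof -
    have "2 * norm (u x * v x) \<le> (norm (u x))\<^sup>2 + (norm (v x))\<^sup>2"
      using sum_squares_bound[of "norm (u x)" "norm (v x)"] by (simp add: norm_mult)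
    then show ?thesis by (smt (verit) norm_ge_zero)
  qed
  then show "AE x in lborel. norm (u x * v x) \<le> norm ((norm (u x))\<^sup>2 + (norm (v x))\<^sup>2)" by simp
qed (use assms in \<open>auto intro!: Bochner_Integration.integrable_add L2_integrable borel_measurable_times simp: L2_measurable\<close>)

text \<open>The integral of (t f - g)^2 is a nonnegative polynomial of degree at most 2 in t; the
  degenerate case A = 0 has to be treated apart.\<close>

lemma integral_Cauchy_Schwarz:
  fixes f g :: "'a \<Rightarrow> real"
  assumes f: "integrable M (\<lambda>x. (f x)\<^sup>2)" and g: "integrable M (\<lambda>x. (g x)\<^sup>2)"
    and fg: "integrable M (\<lambda>x. f x * g x)"
  shows "(\<integral>x. f x * g x \<partial>M) \<le> sqrt (\<integral>x. (f x)\<^sup>2 \<partial>M) * sqrt (\<integral>x. (g x)\<^sup>2 \<partial>M)"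
proof -
  define A B C where "A = (\<integral>x. (f x)\<^sup>2 \<partial>M)" and "B = (\<integral>x. (g x)\<^sup>2 \<partial>M)" and "C = (\<integral>x. f x * g x \<partial>M)"
  have AB: "0 \<le> A" "0 \<le> B" unfolding A_def B_def by auto
  have quad: "0 \<le> t\<^sup>2 * A - 2 * t * C + B" for t
  proof -
    have "0 \<le> (\<integral>x. (t * f x - g x)\<^sup>2 \<partial>M)" by simp
    also have "\<dots> = (\<integral>x. t\<^sup>2 * (f x)\<^sup>2 - 2 * t * (f x * g x) + (g x)\<^sup>2 \<partial>M)"
      by (intro Bochner_Integration.integral_cong) (auto simp: power2_diff power_mult_distrib)
    also have "\<dots> = t\<^sup>2 * A - 2 * t * C + B"
      using f g fg by (simp add: A_def B_def C_def)
    finally show ?thesis .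
  qed
  have "C \<le> sqrt A * sqrt B"
  proof (cases "A = 0")
    case True
    have "C \<le> 0"
    proof (rule ccontr)
      assume "\<not> C \<le> 0"
      \<comment> \<open>With A = 0 the polynomial is affine in t, and this t gives it the value - B
        - 2.\<close>
      then show False using quad[of "(B + 1) / C"] True AB by simp
    qed
    then show ?thesis using True by simp
  next
    case False
    then have "0 < A" using AB by simp
    \<comment> \<open>The choice t = C / A is the minimizer of the quadratic.\<close>
    then have "C\<^sup>2 \<le> A * B"
      using quad[of "C / A"] by (simp add: field_simps power2_eq_square)
    then have "\<bar>C\<bar> \<le> sqrt (A * B)" by (metis real_sqrt_abs real_sqrt_le_mono)
    then show ?thesis by (simp add: real_sqrt_mult)
  qed
  then show ?thesis by (simp add: A_def B_def C_def)
qed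

lemma L2_Cauchy_Schwarz:
  assumes "u \<in> L2" "v \<in> L2"
  shows "(LINT x|lborel. norm (u x) * norm (v x)) \<le> L2_norm u * L2_norm v"
  unfolding L2_norm_def
  using integrable_norm[OF L2_integrable_mult[OF assms]] assms
  by (intro integral_Cauchy_Schwarz) (auto intro: L2_integrable simp: norm_mult)

lemma L2_norm_pairing_le:
  assumes "u \<in> L2" "v \<in> L2"
  shows "norm (LINT x|lborel. u x * v x) \<le> L2_norm u * L2_norm v"
proof -
  have "norm (LINT x|lborel. u x * v x) \<le> (LINT x|lborel. norm (u x * v x))"
    by (rule integral_norm_bound)
  also have "\<dots> \<le> L2_norm u * L2_norm v"
    using L2_Cauchy_Schwarz[OF assms] by (simp add: norm_mult)
  finally show ?thesis .
qed

lemma L2_norm_triangle: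
  assumes "u \<in> L2" "v \<in> L2"
  shows "L2_norm (\<lambda>x. u x + v x) \<le> L2_norm u + L2_norm v"
proof -
  have uv: "integrable lborel (\<lambda>x. norm (u x) * norm (v x))"
    using integrable_norm[OF L2_integrable_mult[OF assms]] by (simp add: norm_mult)
  have "(L2_norm (\<lambda>x. u x + v x))\<^sup>2 \<le> (LINT x|lborel. (norm (u x))\<^sup>2 + 2 * (norm (u x) * norm (v x)) + (norm (v x))\<^sup>2)"
    unfolding L2_norm_power2
  proof (rule integral_mono)
    fix x
    have "(norm (u x + v x))\<^sup>2 \<le> (norm (u x) + norm (v x))\<^sup>2"
      by (intro power_mono norm_triangle_ineq) auto
    then show "(norm (u x + v x))\<^sup>2 \<le> (norm (u x))\<^sup>2 + 2 * (norm (u x) * norm (v x)) + (norm (v x))\<^sup>2"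
      by (simp add: power2_sum)
  qed (use assms uv L2_add[OF assms] in \<open>auto intro!: Bochner_Integration.integrable_add L2_integrable\<close>)
  also have "\<dots> = (L2_norm u)\<^sup>2 + 2 * (LINT x|lborel. norm (u x) * norm (v x)) + (L2_norm v)\<^sup>2"
    using assms uv by (simp add: L2_norm_power2 L2_integrable)
  also have "\<dots> \<le> (L2_norm u + L2_norm v)\<^sup>2"
    using L2_Cauchy_Schwarz[OF assms] by (simp add: power2_sum)
  finally show ?thesis
    by (rule power2_le_imp_le) (simp add: L2_norm_nonneg)
qed

lemma L2_norm_scale: "L2_norm (\<lambda>x. c * u x) = norm c * L2_norm u"
  by (simp add: L2_norm_def norm_mult power_mult_distrib real_sqrt_mult)

lemma L2_norm_diff_commute: "L2_norm (\<lambda>x. u x - v x) = L2_norm (\<lambda>x. v x - u x)"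
  by (simp add: L2_norm_def norm_minus_commute)

lemma L2_norm_triangle_diff:
  assumes "u \<in> L2" "v \<in> L2" "w \<in> L2"
  shows "L2_norm (\<lambda>x. u x - w x) \<le> L2_norm (\<lambda>x. u x - v x) + L2_norm (\<lambda>x. v x - w x)"
  using L2_norm_triangle[OF L2_diff[OF assms(1,2)] L2_diff[OF assms(2,3)]] by simp

lemma L2_norm_le_add_diff:
  assumes "u \<in> L2" "v \<in> L2"
  shows "L2_norm u \<le> L2_norm (\<lambda>x. u x - v x) + L2_norm v"
  using L2_norm_triangle[OF L2_diff[OF assms] assms(2)] by simp

lemma L2_norm_eq_0_iff:
  assumes "u \<in> L2" shows "L2_norm u = 0 \<longleftrightarrow> (AE x in lborel. u x = 0)"
  using integral_nonneg_eq_0_iff_AE[OF L2_integrable[OF assms]] by (simp add: L2_norm_def)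

lemma L2_norm_tendsto:
  assumes "\<And>k. v k \<in> L2" "u \<in> L2" "(\<lambda>k. L2_norm (\<lambda>x. v k x - u x)) \<longlonglongrightarrow> 0"
  shows "(\<lambda>k. L2_norm (v k)) \<longlonglongrightarrow> L2_norm u"
proof -
  have *: "norm (L2_norm (v k) - L2_norm u) \<le> L2_norm (\<lambda>x. v k x - u x)" for k
    using L2_norm_le_add_diff[OF assms(1)[of k] assms(2)] L2_norm_le_add_diff[OF assms(2,1), of k]
    by (simp add: L2_norm_diff_commute[of u])
  have "(\<lambda>k. L2_norm (v k) - L2_norm u) \<longlonglongrightarrow> 0"
    by (rule Lim_null_comparison[OF always_eventually[OF allI[OF *]] assms(3)])
  then show ?thesis by (simp add: LIM_zero_iff)
qed

lemma L2_pairing_tendsto: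
  assumes "\<And>k. v k \<in> L2" "u \<in> L2" "(\<lambda>k. L2_norm (\<lambda>x. v k x - u x)) \<longlonglongrightarrow> 0" "w \<in> L2"
  shows "(\<lambda>k. LINT x|lborel. v k x * w x) \<longlonglongrightarrow> (LINT x|lborel. u x * w x)"
proof -
  have *: "norm ((LINT x|lborel. v k x * w x) - (LINT x|lborel. u x * w x)) \<le> L2_norm (\<lambda>x. v k x - u x) * L2_norm w" for k
  proof -
    have "(LINT x|lborel. v k x * w x) - (LINT x|lborel. u x * w x) = (LINT x|lborel. (v k x - u x) * w x)"
      by (subst Bochner_Integration.integral_diff[symmetric])
         (auto simp: algebra_simps intro!: L2_integrable_mult assms)
    then show ?thesis using L2_norm_pairing_le[OF L2_diff[OF assms(1,2)] assms(4)] by simp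
  qed
  have "(\<lambda>k. L2_norm (\<lambda>x. v k x - u x) * L2_norm w) \<longlonglongrightarrow> 0"
    using tendsto_mult_right[OF assms(3)] by simp
  then have "(\<lambda>k. (LINT x|lborel. v k x * w x) - (LINT x|lborel. u x * w x)) \<longlonglongrightarrow> 0"
    by (intro Lim_null_comparison[OF always_eventually[OF allI[OF *]]])
  then show ?thesis by (simp add: LIM_zero_iff)
qed

lemma L2_nn_integral:
  "u \<in> L2 \<Longrightarrow> (\<integral>\<^sup>+x. ennreal ((norm (u x))\<^sup>2) \<partial>lborel) = ennreal ((L2_norm u)\<^sup>2)"
  unfolding L2_norm_power2 by (rule nn_integral_eq_integral) (auto intro: L2_integrable)

lemma L2_I_nn_integral:
  assumes "u \<in> borel_measurable borel" "(\<integral>\<^sup>+x. ennreal ((norm (u x))\<^sup>2) \<partial>lborel) \<le> ennreal (e\<^sup>2)" "0 \<le> e"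
  shows "u \<in> L2" "L2_norm u \<le> e"
proof -
  have "integrable lborel (\<lambda>x. (norm (u x))\<^sup>2)"
    using assms by (intro integrableI_bounded) (auto simp: less_top[symmetric] top_unique)
  then show *: "u \<in> L2" using assms by (simp add: L2_def)
  have "(L2_norm u)\<^sup>2 \<le> e\<^sup>2"
    using assms(2) L2_nn_integral[OF *] by (simp add: ennreal_le_iff)
  then show "L2_norm u \<le> e" using assms(3) by (rule power2_le_imp_le)
qed

text \<open>Along a fast subsequence the increments satisfy \<open>\<Sum> 2^k \<integral> \<bar>d\<^sub>k\<bar>\<^sup>2 < \<infinity>\<close>, and \<open>2 \<bar>d\<^sub>k\<bar> \<le> 2^k \<bar>d\<^sub>k\<bar>\<^sup>2 + 2^(-k)\<close>
  makes it converge almost everywhere; Fatou's lemma identifies the limit.\<close>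

lemma L2_complete:
  fixes f :: "nat \<Rightarrow> real^'n \<Rightarrow> complex"
  assumes f: "\<And>k. f k \<in> L2"
    and Cauchy: "\<And>e. 0 < e \<Longrightarrow> \<exists>N. \<forall>m\<ge>N. \<forall>n\<ge>N. L2_norm (\<lambda>x. f m x - f n x) \<le> e"
  shows "\<exists>g\<in>L2. (\<lambda>k. L2_norm (\<lambda>x. f k x - g x)) \<longlonglongrightarrow> 0"
proof -
  note [measurable] = L2_measurable[OF f]
  have "\<exists>N. \<forall>m\<ge>N. \<forall>n\<ge>N. L2_norm (\<lambda>x. f m x - f n x) \<le> (1/2) ^ k" for k
    by (rule Cauchy) simp
  then obtain N where N: "\<And>k m n. m \<ge> N k \<Longrightarrow> n \<ge> N k \<Longrightarrow> L2_norm (\<lambda>x. f m x - f n x) \<le> (1/2) ^ k"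
    by metis
  \<comment> \<open>Adding all thresholds \<open>N j\<close> with j \<le> k makes \<open>r k\<close>
    exceed each of them without assuming that \<open>N\<close> is monotone.\<close>
  define r where "r k = k + (\<Sum>j\<le>k. N j)" for k
  have r_ge: "N k \<le> r j" if "k \<le> j" for j k
  proof -
    have "N k \<le> (\<Sum>i\<le>j. N i)" using that by (intro member_le_sum) auto
    then show ?thesis by (simp add: r_def)
  qed
  have r_id: "k \<le> r k" for k by (simp add: r_def)
  define d where "d k x = f (r (Suc k)) x - f (r k) x" for k x
  have d_L2: "d k \<in> L2" for k unfolding d_def by (intro L2_diff f)
  note [measurable] = L2_measurable[OF d_L2]
  have d_le: "(L2_norm (d k))\<^sup>2 \<le> (1/4) ^ k" for k
  proof -
    have "L2_norm (d k) \<le> (1/2) ^ k" unfolding d_def by (rule N) (auto intro: r_ge)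
    then have "(L2_norm (d k))\<^sup>2 \<le> ((1/2) ^ k)\<^sup>2" by (intro power_mono L2_norm_nonneg)
    then show ?thesis by (simp add: power_mult[symmetric] mult.commute[of k 2]) (simp add: power_mult power2_eq_square)
  qed
  have "(\<integral>\<^sup>+x. (\<Sum>k. ennreal (2 ^ k * (norm (d k x))\<^sup>2)) \<partial>lborel) = (\<Sum>k. \<integral>\<^sup>+x. ennreal (2 ^ k * (norm (d k x))\<^sup>2) \<partial>lborel)"
    by (intro nn_integral_suminf) auto
  also have "\<dots> \<le> (\<Sum>k. ennreal ((1/2) ^ k))"
  proof (rule suminf_le)
    fix k
    have "(\<integral>\<^sup>+x. ennreal (2 ^ k * (norm (d k x))\<^sup>2) \<partial>lborel) = ennreal (2 ^ k) * ennreal ((L2_norm (d k))\<^sup>2)"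
      by (simp add: ennreal_mult nn_integral_cmult L2_nn_integral[OF d_L2])
    also have "\<dots> \<le> ennreal (2 ^ k * (1/4) ^ k)"
      using d_le[of k] by (simp add: ennreal_mult[symmetric] ennreal_leI)
    also have "2 ^ k * (1/4) ^ k = (1/2 :: real) ^ k"
      by (simp add: power_mult_distrib[symmetric])
    finally show "(\<integral>\<^sup>+x. ennreal (2 ^ k * (norm (d k x))\<^sup>2) \<partial>lborel) \<le> ennreal ((1/2) ^ k)" .
  qed auto
  also have "\<dots> = ennreal (\<Sum>k. (1/2) ^ k)"
    by (intro suminf_ennreal2 summable_geometric) auto
  finally have "(\<integral>\<^sup>+x. (\<Sum>k. ennreal (2 ^ k * (norm (d k x))\<^sup>2)) \<partial>lborel) \<noteq> \<infinity>"
    by (auto simp: top_unique)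
  then have "AE x in lborel. (\<Sum>k. ennreal (2 ^ k * (norm (d k x))\<^sup>2)) \<noteq> \<infinity>"
    by (intro nn_integral_PInf_AE) auto
  then have AE_conv: "AE x in lborel. convergent (\<lambda>k. f (r k) x)"
  proof eventually_elim
    case (elim x)
    have 1: "summable (\<lambda>k. 2 ^ k * (norm (d k x))\<^sup>2)"
      using elim by (intro summable_suminf_not_top) auto
    have 2: "summable (\<lambda>k. (1/2 :: real) ^ k)" by (rule summable_geometric) auto
    have "norm (d k x) \<le> 2 ^ k * (norm (d k x))\<^sup>2 + (1/2) ^ k" for k
    proof -
      let ?a = "norm (d k x)"
      have "0 \<le> (2 ^ k * ?a - 1)\<^sup>2" by simp
      then have "2 * 2 ^ k * ?a \<le> 2 ^ k * (2 ^ k * ?a\<^sup>2) + 1"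
        by (simp add: power2_eq_square algebra_simps)
      then have "(2 * 2 ^ k * ?a) / 2 ^ k \<le> (2 ^ k * (2 ^ k * ?a\<^sup>2) + 1) / 2 ^ k"
        by (intro divide_right_mono) auto
      then have "2 * ?a \<le> 2 ^ k * ?a\<^sup>2 + (1/2) ^ k"
        by (simp add: add_divide_distrib power_one_over)
      then show ?thesis by (smt (verit) norm_ge_zero)
    qed
    then have "summable (\<lambda>k. d k x)"
      by (intro summable_comparison_test'[OF summable_add[OF 1 2]]) auto
    then have "convergent (\<lambda>n. f (r 0) x + (\<Sum>k<n. d k x))"
      by (intro convergent_add convergent_const) (simp add: summable_iff_convergent)
    moreover have "f (r 0) x + (\<Sum>k<n. d k x) = f (r n) x" for n
      unfolding d_def by (simp add: sum_lessThan_telescope[where f = "\<lambda>k. f (r k) x"])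
    ultimately show ?case by simp
  qed
  define g where "g x = lim (\<lambda>k. f (r k) x)" for x
  have [measurable]: "g \<in> borel_measurable borel"
    unfolding g_def by (intro borel_measurable_lim_metric) measurable
  have AE_lim: "AE x in lborel. (\<lambda>k. f (r k) x) \<longlonglongrightarrow> g x"
    using AE_conv by eventually_elim (simp add: g_def convergent_LIMSEQ_iff)
  have main: "(\<lambda>x. f n x - g x) \<in> L2 \<and> L2_norm (\<lambda>x. f n x - g x) \<le> (1/2) ^ m" if n: "n \<ge> N m" for n m
  proof -
    have "(\<integral>\<^sup>+x. ennreal ((norm (f n x - g x))\<^sup>2) \<partial>lborel) = (\<integral>\<^sup>+x. liminf (\<lambda>k. ennreal ((norm (f n x - f (r k) x))\<^sup>2)) \<partial>lborel)"
    proof (rule nn_integral_cong_AE)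
      show "AE x in lborel. ennreal ((norm (f n x - g x))\<^sup>2) = liminf (\<lambda>k. ennreal ((norm (f n x - f (r k) x))\<^sup>2))"
        using AE_lim
      proof eventually_elim
        case (elim x)
        have "(\<lambda>k. ennreal ((norm (f n x - f (r k) x))\<^sup>2)) \<longlonglongrightarrow> ennreal ((norm (f n x - g x))\<^sup>2)"
          by (intro tendsto_intros elim)
        from lim_imp_Liminf[OF sequentially_bot this] show ?case by (rule sym)
      qed
    qed
    also have "\<dots> \<le> liminf (\<lambda>k. \<integral>\<^sup>+x. ennreal ((norm (f n x - f (r k) x))\<^sup>2) \<partial>lborel)"
      by (rule nn_integral_liminf) measurable
    also have "\<dots> = liminf (\<lambda>k. ennreal ((L2_norm (\<lambda>x. f n x - f (r k) x))\<^sup>2))"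
      by (intro arg_cong[where f = liminf] ext L2_nn_integral L2_diff f)
    also have "\<dots> \<le> ennreal (((1/2) ^ m)\<^sup>2)"
    proof (rule Liminf_le[OF sequentially_bot])
      show "\<forall>\<^sub>F k in sequentially. ennreal ((L2_norm (\<lambda>x. f n x - f (r k) x))\<^sup>2) \<le> ennreal (((1/2) ^ m)\<^sup>2)"
        using eventually_ge_at_top[of m]
      proof eventually_elim
        case (elim k)
        have "L2_norm (\<lambda>x. f n x - f (r k) x) \<le> (1/2) ^ m"
          by (rule N[OF n r_ge[OF elim]])
        then show ?case by (intro ennreal_leI power_mono L2_norm_nonneg)
      qed
    qed
    finally have *: "(\<integral>\<^sup>+x. ennreal ((norm (f n x - g x))\<^sup>2) \<partial>lborel) \<le> ennreal (((1/2) ^ m)\<^sup>2)" .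
    show ?thesis
      using L2_I_nn_integral[OF _ *] by auto
  qed
  have "(\<lambda>x. f (N 0) x - (f (N 0) x - g x)) \<in> L2"
    by (rule L2_diff[OF f conjunct1[OF main[OF order_refl]]])
  then have "g \<in> L2" by simp
  moreover have "(\<lambda>k. L2_norm (\<lambda>x. f k x - g x)) \<longlonglongrightarrow> 0"
  proof (rule LIMSEQ_I)
    fix e :: real assume "0 < e"
    then obtain m where m: "(1/2 :: real) ^ m < e" using real_arch_pow_inv[of e "1/2"] by auto
    have "norm (L2_norm (\<lambda>x. f k x - g x) - 0) < e" if "k \<ge> N m" for k
      using main[OF that] m L2_norm_nonneg[of "\<lambda>x. f k x - g x"] by auto
    then show "\<exists>no. \<forall>n\<ge>no. norm (L2_norm (\<lambda>x. f n x - g x) - 0) < e" by blast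
  qed
  ultimately show ?thesis by blast
qed

section \<open>Orthogonal projection and density in \<open>L2\<close>\<close>

lemma L2_parallelogram:
  assumes "u \<in> L2" "v \<in> L2"
  shows "(L2_norm (\<lambda>x. u x - v x))\<^sup>2 + (L2_norm (\<lambda>x. u x + v x))\<^sup>2 = 2 * (L2_norm u)\<^sup>2 + 2 * (L2_norm v)\<^sup>2"
proof -
  have "(L2_norm (\<lambda>x. u x - v x))\<^sup>2 + (L2_norm (\<lambda>x. u x + v x))\<^sup>2 =
      (LINT x|lborel. (norm (u x - v x))\<^sup>2 + (norm (u x + v x))\<^sup>2)"
    unfolding L2_norm_power2 using L2_diff[OF assms] L2_add[OF assms]
    by (intro Bochner_Integration.integral_add[symmetric]) (auto intro: L2_integrable)
  also have "\<dots> = (LINT x|lborel. 2 * (norm (u x))\<^sup>2 + 2 * (norm (v x))\<^sup>2)"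
    by (intro Bochner_Integration.integral_cong) (auto simp: cmod_power2, simp add: power2_eq_square algebra_simps)
  also have "\<dots> = 2 * (L2_norm u)\<^sup>2 + 2 * (L2_norm v)\<^sup>2"
    unfolding L2_norm_power2 using assms by (simp add: L2_integrable)
  finally show ?thesis .
qed

lemma L2_norm_diff_scale_power2:
  assumes "r \<in> L2" "s \<in> L2"
  shows "(L2_norm (\<lambda>x. r x - c * s x))\<^sup>2 =
    (L2_norm r)\<^sup>2 - 2 * Re (c * (LINT x|lborel. cnj (r x) * s x)) + (norm c)\<^sup>2 * (L2_norm s)\<^sup>2"
proof -
  have int: "integrable lborel (\<lambda>x. cnj (r x) * s x)" by (intro L2_integrable_mult L2_cnj assms)
  define k where "k x = Re (c * (cnj (r x) * s x))" for x
  have k: "integrable lborel k"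
    unfolding k_def by (intro integrable_Re integrable_mult_right int)
  have "(L2_norm (\<lambda>x. r x - c * s x))\<^sup>2 =
      (LINT x|lborel. (norm (r x))\<^sup>2 - 2 * k x + (norm c)\<^sup>2 * (norm (s x))\<^sup>2)"
    unfolding L2_norm_power2 k_def
    by (intro Bochner_Integration.integral_cong) (auto simp: cmod_power2, simp add: power2_eq_square algebra_simps)
  also have "\<dots> = (L2_norm r)\<^sup>2 - 2 * (LINT x|lborel. k x) + (norm c)\<^sup>2 * (L2_norm s)\<^sup>2"
    unfolding L2_norm_power2 using assms k by (simp add: L2_integrable)
  also have "(LINT x|lborel. k x) = Re (LINT x|lborel. c * (cnj (r x) * s x))"
    unfolding k_def by (intro integral_Re integrable_mult_right int)
  also have "(LINT x|lborel. c * (cnj (r x) * s x)) = c * (LINT x|lborel. cnj (r x) * s x)"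
    using int by simp
  finally show ?thesis .
qed

text \<open>The projection argument for a subspace that need not be closed: a minimizing sequence
  for the distance from f converges to some g, and the residual f - g is orthogonal to
  \<open>S\<close>. In the bilinear pairing it is the conjugate of f - g that annihilates
  \<open>S\<close>, so the hypothesis forces f = g almost everywhere and the minimizing sequence
  approximates f.\<close>

lemma L2_dense_if_annihilator_trivial:
  fixes S :: "(real^'n \<Rightarrow> complex) set"
  assumes S: "S \<subseteq> L2" and zero: "(\<lambda>x. 0) \<in> S"
    and lin: "\<And>s t a b. s \<in> S \<Longrightarrow> t \<in> S \<Longrightarrow> (\<lambda>x. a * s x + b * t x) \<in> S"
    and ann: "\<And>w. w \<in> L2 \<Longrightarrow> (\<And>s. s \<in> S \<Longrightarrow> (LINT x|lborel. w x * s x) = 0) \<Longrightarrow> AE x in lborel. w x = 0"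
    and f: "f \<in> L2"
  shows "\<exists>s. (\<forall>k::nat. s k \<in> S) \<and> (\<lambda>k. L2_norm (\<lambda>x. s k x - f x)) \<longlonglongrightarrow> 0"
proof -
  define D where "D = (\<lambda>s. L2_norm (\<lambda>x. f x - s x)) ` S"
  define d where "d = Inf D"
  have D_bdd: "bdd_below D" unfolding D_def by (rule bdd_belowI2[of _ 0]) (rule L2_norm_nonneg)
  have D_ne: "D \<noteq> {}" using zero by (auto simp: D_def)
  have d_le: "d \<le> L2_norm (\<lambda>x. f x - s x)" if "s \<in> S" for s
    unfolding d_def using that by (intro cInf_lower D_bdd) (auto simp: D_def)
  have d_nonneg: "0 \<le> d"
    unfolding d_def using D_ne by (intro cInf_greatest) (auto simp: D_def L2_norm_nonneg)
  have "\<exists>s\<in>S. L2_norm (\<lambda>x. f x - s x) < d + 1 / real (Suc k)" for k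
  proof -
    have "\<exists>y\<in>D. y < d + 1 / real (Suc k)"
      unfolding d_def using D_ne D_bdd by (subst cInf_less_iff[symmetric]) auto
    then show ?thesis by (auto simp: D_def)
  qed
  then obtain s where sS: "\<And>k. s k \<in> S" and s_lt: "\<And>k. L2_norm (\<lambda>x. f x - s k x) < d + 1 / real (Suc k)"
    by metis
  have sL2: "s k \<in> L2" for k using sS S by blast
  \<comment> \<open>The midpoint of \<open>s m\<close> and \<open>s n\<close> lies in
    \<open>S\<close>, so its distance from f is at least d; the parallelogram law turns this into a
    bound on the difference of the two.\<close>
  have est: "(L2_norm (\<lambda>x. s m x - s n x))\<^sup>2 \<le> 4 * ((d + 1 / real (Suc k))\<^sup>2 - d\<^sup>2)" if "k \<le> m" "k \<le> n" for k m n
  proof -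
    let ?u = "\<lambda>x. f x - s n x" and ?v = "\<lambda>x. f x - s m x"
    have mid: "(\<lambda>x. 1/2 * s m x + 1/2 * s n x) \<in> S" by (intro lin sS)
    have "L2_norm (\<lambda>x. ?u x + ?v x) = L2_norm (\<lambda>x. 2 * (f x - (1/2 * s m x + 1/2 * s n x)))"
      by (simp add: algebra_simps)
    also have "\<dots> = 2 * L2_norm (\<lambda>x. f x - (1/2 * s m x + 1/2 * s n x))"
      by (subst L2_norm_scale) simp
    finally have "2 * d \<le> L2_norm (\<lambda>x. ?u x + ?v x)" using d_le[OF mid] by simp
    then have "(2 * d)\<^sup>2 \<le> (L2_norm (\<lambda>x. ?u x + ?v x))\<^sup>2" using d_nonneg by (intro power_mono) auto
    moreover have "L2_norm ?u \<le> d + 1 / real (Suc k)"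
      using s_lt[of n] that(2) frac_le[of 1 1 "real (Suc k)" "real (Suc n)"] by simp
    then have "(L2_norm ?u)\<^sup>2 \<le> (d + 1 / real (Suc k))\<^sup>2" by (intro power_mono L2_norm_nonneg)
    moreover have "L2_norm ?v \<le> d + 1 / real (Suc k)"
      using s_lt[of m] that(1) frac_le[of 1 1 "real (Suc k)" "real (Suc m)"] by simp
    then have "(L2_norm ?v)\<^sup>2 \<le> (d + 1 / real (Suc k))\<^sup>2" by (intro power_mono L2_norm_nonneg)
    ultimately show ?thesis
      using L2_parallelogram[OF L2_diff[OF f sL2] L2_diff[OF f sL2], of n m] by (simp add: power_mult_distrib)
  qed
  have lim0: "(\<lambda>k. 4 * ((d + 1 / real (Suc k))\<^sup>2 - d\<^sup>2)) \<longlonglongrightarrow> 0"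
  proof -
    have "(\<lambda>k. 4 * ((d + 1 / real (Suc k))\<^sup>2 - d\<^sup>2)) \<longlonglongrightarrow> 4 * ((d + 0)\<^sup>2 - d\<^sup>2)"
      by (intro tendsto_intros LIMSEQ_Suc[OF lim_1_over_n])
    then show ?thesis by simp
  qed
  have "\<exists>g\<in>L2. (\<lambda>k. L2_norm (\<lambda>x. s k x - g x)) \<longlonglongrightarrow> 0"
  proof (rule L2_complete[OF sL2])
    fix e :: real assume "0 < e"
    then have "\<forall>\<^sub>F k in sequentially. 4 * ((d + 1 / real (Suc k))\<^sup>2 - d\<^sup>2) < e\<^sup>2"
      by (intro order_tendstoD(2)[OF lim0]) auto
    then obtain N where N: "4 * ((d + 1 / real (Suc N))\<^sup>2 - d\<^sup>2) < e\<^sup>2"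
      unfolding eventually_sequentially by blast
    have "L2_norm (\<lambda>x. s m x - s n x) \<le> e" if "m \<ge> N" "n \<ge> N" for m n
    proof (rule power2_le_imp_le)
      show "(L2_norm (\<lambda>x. s m x - s n x))\<^sup>2 \<le> e\<^sup>2" using est[OF that] N by linarith
    qed (use \<open>0 < e\<close> in linarith)
    then show "\<exists>N. \<forall>m\<ge>N. \<forall>n\<ge>N. L2_norm (\<lambda>x. s m x - s n x) \<le> e" by blast
  qed
  then obtain g where g: "g \<in> L2" and lim: "(\<lambda>k. L2_norm (\<lambda>x. s k x - g x)) \<longlonglongrightarrow> 0" by blast
  let ?r = "\<lambda>x. f x - g x"
  have r: "?r \<in> L2" by (intro L2_diff f g)
  have r_le: "L2_norm ?r \<le> d"
  proof (rule LIMSEQ_le_const)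
    have "(\<lambda>k. (d + 1 / real (Suc k)) + L2_norm (\<lambda>x. s k x - g x)) \<longlonglongrightarrow> (d + 0) + 0"
      by (intro tendsto_intros LIMSEQ_Suc[OF lim_1_over_n] lim)
    then show "(\<lambda>k. (d + 1 / real (Suc k)) + L2_norm (\<lambda>x. s k x - g x)) \<longlonglongrightarrow> d" by simp
    have "L2_norm ?r \<le> (d + 1 / real (Suc k)) + L2_norm (\<lambda>x. s k x - g x)" for k
      using L2_norm_triangle_diff[OF f sL2[of k] g] s_lt[of k] by linarith
    then show "\<exists>N. \<forall>k\<ge>N. L2_norm ?r \<le> (d + 1 / real (Suc k)) + L2_norm (\<lambda>x. s k x - g x)" by blast
  qed
  have r_ge: "d \<le> L2_norm (\<lambda>x. ?r x - c * t x)" if t: "t \<in> S" for c t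
  proof (rule LIMSEQ_le_const)
    have "(\<lambda>k. L2_norm (\<lambda>x. ?r x - c * t x) + L2_norm (\<lambda>x. s k x - g x)) \<longlonglongrightarrow> L2_norm (\<lambda>x. ?r x - c * t x) + 0"
      by (intro tendsto_intros lim)
    then show "(\<lambda>k. L2_norm (\<lambda>x. ?r x - c * t x) + L2_norm (\<lambda>x. s k x - g x)) \<longlonglongrightarrow> L2_norm (\<lambda>x. ?r x - c * t x)"
      by simp
    have "d \<le> L2_norm (\<lambda>x. ?r x - c * t x) + L2_norm (\<lambda>x. s k x - g x)" for k
    proof -
      have "d \<le> L2_norm (\<lambda>x. f x - (1 * s k x + c * t x))" by (intro d_le lin sS t)
      also have "\<dots> = L2_norm (\<lambda>x. (?r x - c * t x) + (g x - s k x))" by (simp add: algebra_simps)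
      also have "\<dots> \<le> L2_norm (\<lambda>x. ?r x - c * t x) + L2_norm (\<lambda>x. g x - s k x)"
        using t S by (intro L2_norm_triangle L2_diff L2_scale f g sL2) auto
      finally show ?thesis by (simp add: L2_norm_diff_commute[of g])
    qed
    then show "\<exists>N. \<forall>k\<ge>N. d \<le> L2_norm (\<lambda>x. ?r x - c * t x) + L2_norm (\<lambda>x. s k x - g x)" by blast
  qed
  have orth: "(LINT x|lborel. cnj (?r x) * t x) = 0" if t: "t \<in> S" for t
  proof -
    have tL2: "t \<in> L2" using t S by blast
    define w where "w = (LINT x|lborel. cnj (?r x) * t x)"
    \<comment> \<open>Perturb the residual by \<open>a * cnj w * t\<close>. The term linear in a is
      -2 a |w|^2, which for small a > 0 would outweigh the quadratic term unless w = 0.\<close>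
    have ineq: "0 \<le> - 2 * a * (norm w)\<^sup>2 + a\<^sup>2 * (norm w)\<^sup>2 * (L2_norm t)\<^sup>2" for a :: real
    proof -
      have "d\<^sup>2 \<le> (L2_norm (\<lambda>x. ?r x - (of_real a * cnj w) * t x))\<^sup>2"
        using r_ge[OF t] d_nonneg by (intro power_mono) auto
      moreover have "(L2_norm ?r)\<^sup>2 \<le> d\<^sup>2" using r_le by (intro power_mono L2_norm_nonneg)
      moreover have "Re (of_real a * cnj w * w) = a * (norm w)\<^sup>2"
        by (simp add: cmod_power2) (simp add: power2_eq_square algebra_simps)
      moreover have "(norm (of_real a * cnj w))\<^sup>2 = a\<^sup>2 * (norm w)\<^sup>2"
        by (simp add: norm_mult power_mult_distrib)
      ultimately show ?thesis
        using L2_norm_diff_scale_power2[OF r tL2, of "of_real a * cnj w", folded w_def] by simp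
    qed
    have "w = 0"
    proof (rule ccontr)
      assume "w \<noteq> 0"
      then have pos: "0 < (norm w)\<^sup>2" by simp
      \<comment> \<open>The summand 1 avoids a division by zero, and a |t|^2 < 1 keeps the quadratic
        term below the linear one.\<close>
      define a where "a = 1 / ((L2_norm t)\<^sup>2 + 1)"
      have a: "0 < a" "a * (L2_norm t)\<^sup>2 < 1"
        unfolding a_def by (simp_all add: add_nonneg_pos)
      have "0 \<le> (norm w)\<^sup>2 * (a * (a * (L2_norm t)\<^sup>2 - 2))"
        using ineq[of a] by (simp add: power2_eq_square algebra_simps)
      then have "0 \<le> a * (a * (L2_norm t)\<^sup>2 - 2)" using pos by (simp add: zero_le_mult_iff)
      then show False using a by (simp add: zero_le_mult_iff)
    qed
    then show ?thesis by (simp add: w_def)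
  qed
  have "AE x in lborel. cnj (?r x) = 0"
    by (rule ann[OF L2_cnj[OF r] orth])
  then have fg: "AE x in lborel. f x = g x" by (rule AE_mp) (auto intro!: AE_I2)
  have "L2_norm (\<lambda>x. s k x - f x) = L2_norm (\<lambda>x. s k x - g x)" for k
    using fg L2_measurable[OF f] L2_measurable[OF g] L2_measurable[OF sL2[of k]]
    by (intro L2_norm_cong_AE) auto
  then show ?thesis using lim sS by (intro exI[of _ s]) simp
qed

section \<open>Schwartz functions\<close>

lemma bounded_compact_support:
  fixes f :: "'a::euclidean_space \<Rightarrow> 'b::real_normed_vector"
  assumes "continuous_on UNIV f" "\<And>x. norm x > R \<Longrightarrow> f x = 0"
  shows "bounded (range f)"
proof -
  have "compact (f ` cball 0 R)"
    by (intro compact_continuous_image continuous_on_subset[OF assms(1)]) auto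
  then have "bounded (insert 0 (f ` cball 0 R))"
    by (simp add: compact_imp_bounded)
  moreover have "range f \<subseteq> insert 0 (f ` cball 0 R)"
  proof
    fix y assume "y \<in> range f"
    then obtain x where "y = f x" by blast
    then show "y \<in> insert 0 (f ` cball 0 R)" using assms(2)[of x] by (cases "norm x > R") auto
  qed
  ultimately show ?thesis by (rule bounded_subset)
qed

lemma bounded_range_D: "bounded (range f) \<Longrightarrow> \<exists>C\<ge>0. \<forall>x. norm (f x) \<le> C"
  by (metis bounded_iff norm_ge_zero order_trans rangeI)

lemma bounded_range_I: "(\<And>x. norm (f x) \<le> C) \<Longrightarrow> bounded (range f)"
  by (metis bounded_iff rangeE)

lemma schwartz_smooth: "u \<in> schwartz \<Longrightarrow> smooth u"
  by (simp add: schwartz_def)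

lemma schwartz_partial: "u \<in> schwartz \<Longrightarrow> partial i u \<in> schwartz"
  unfolding schwartz_def by (simp add: smooth_partial partials_snoc[symmetric])

lemma schwartz_has_partial: "u \<in> schwartz \<Longrightarrow> has_partial u i x (partial i u x)"
  by (simp add: schwartz_smooth smooth_has_partial)

lemma schwartz_continuous: "u \<in> schwartz \<Longrightarrow> continuous_on S u"
  by (simp add: schwartz_smooth smooth_continuous)

text \<open>The device used for smoothness, with rapid decay of the function itself added to the
  invariant; decay of the derivatives then comes from closure under differentiation.\<close>

lemma schwartz_coinduct:
  assumes "P u"
    and step: "\<And>u. P u \<Longrightarrow> (\<forall>x. u differentiable (at x)) \<and> (\<forall>i. P (partial i u)) \<and>
      (\<forall>k. bounded (range (\<lambda>x. norm x ^ k *\<^sub>R u x)))"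
  shows "u \<in> schwartz"
proof -
  have "P (partials \<alpha> u)" for \<alpha>
    by (induction \<alpha>) (auto simp: \<open>P u\<close> step)
  moreover have "smooth u"
    by (rule smooth_coinduct[where P = P, OF \<open>P u\<close>]) (use step in blast)
  ultimately show ?thesis
    unfolding schwartz_def using step by blast
qed

text \<open>Combining the exponents 0 and k of the defining bounds gives the weight (1 + |x|)^k,
  which does not degenerate at the origin.\<close>

lemma schwartz_decay:
  assumes "u \<in> schwartz"
  shows "\<exists>C\<ge>0. \<forall>x. (1 + norm x) ^ k * norm (u x) \<le> C"
proof -
  have bd: "bounded (range (\<lambda>x. norm x ^ k *\<^sub>R partials [] u x))" for k
    using assms unfolding schwartz_def by blast
  obtain C0 where C0: "\<And>x. norm (norm x ^ 0 *\<^sub>R partials [] u x) \<le> C0" and "0 \<le> C0"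
    using bounded_range_D[OF bd[of 0]] by blast
  obtain C1 where C1: "\<And>x. norm (norm x ^ k *\<^sub>R partials [] u x) \<le> C1" and "0 \<le> C1"
    using bounded_range_D[OF bd[of k]] by blast
  have "(1 + norm x) ^ k * norm (u x) \<le> 2 ^ k * (C0 + C1)" for x
  proof -
    have "(1 + norm x) ^ k \<le> 2 ^ k * (1 + norm x ^ k)"
    proof (cases "norm x \<le> 1")
      case True
      then have "(1 + norm x) ^ k \<le> 2 ^ k" by (intro power_mono) auto
      also have "\<dots> \<le> 2 ^ k * (1 + norm x ^ k)" by simp
      finally show ?thesis .
    next
      case False
      then have "(1 + norm x) ^ k \<le> (2 * norm x) ^ k" by (intro power_mono) auto
      also have "\<dots> \<le> 2 ^ k * (1 + norm x ^ k)" by (simp add: power_mult_distrib)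
      finally show ?thesis .
    qed
    then have "(1 + norm x) ^ k * norm (u x) \<le> 2 ^ k * (1 + norm x ^ k) * norm (u x)"
      by (intro mult_right_mono) auto
    also have "\<dots> = 2 ^ k * (norm (u x) + norm x ^ k * norm (u x))" by (simp add: algebra_simps)
    also have "\<dots> \<le> 2 ^ k * (C0 + C1)"
      using C0[of x] C1[of x] by (intro mult_left_mono add_mono) auto
    finally show ?thesis .
  qed
  moreover have "0 \<le> 2 ^ k * (C0 + C1)" using \<open>0 \<le> C0\<close> \<open>0 \<le> C1\<close> by simp
  ultimately show ?thesis by blast
qed

text \<open>The multipliers of the Schwartz space, often written O_M: each derivative has polynomial
  growth with an exponent of its own. The potential V belongs to it.\<close>

definition slow_growth :: "(real^'n \<Rightarrow> complex) \<Rightarrow> bool" where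
  "slow_growth a \<longleftrightarrow> smooth a \<and> (\<forall>\<alpha>. \<exists>k C. \<forall>x. norm (partials \<alpha> a x) \<le> C * (1 + norm x) ^ k)"

lemma slow_growth_partial: "slow_growth a \<Longrightarrow> slow_growth (partial i a)"
  unfolding slow_growth_def by (simp add: smooth_partial partials_snoc[symmetric])

lemma slow_growth_const: "slow_growth (\<lambda>x. c)"
proof -
  have *: "partials \<alpha> (\<lambda>x. c) = (\<lambda>x. if \<alpha> = [] then c else 0)" for \<alpha> :: "'a list"
  proof (induction \<alpha>)
    case (Cons i \<alpha>)
    have "partial i (\<lambda>x. if \<alpha> = [] then c else 0) = (\<lambda>x. 0)"
      by (rule ext, rule has_partial_eq, rule has_partial_const)
    then show ?case unfolding partials.simps Cons by simp
  qed simp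
  have "\<exists>k C. \<forall>x. norm (partials \<alpha> (\<lambda>x. c) x) \<le> C * (1 + norm x) ^ k" for \<alpha> :: "'a list"
    by (rule exI[of _ 0], rule exI[of _ "norm c"]) (simp add: *)
  then show ?thesis
    unfolding slow_growth_def using smooth_const by blast
qed

text \<open>Needed for the Weyl quantization, where the potential is evaluated at the midpoint of x
  and y and must be a multiplier in y for fixed x.\<close>

lemma slow_growth_affine:
  assumes "slow_growth a" shows "slow_growth (\<lambda>y. a (x0 + c *\<^sub>R y))"
  unfolding slow_growth_def
proof (intro conjI allI)
  have a: "smooth a" using assms by (simp add: slow_growth_def)
  show "smooth (\<lambda>y. a (x0 + c *\<^sub>R y))" by (rule smooth_affine[OF a])
  fix \<alpha>
  obtain k C where C: "\<And>x. norm (partials \<alpha> a x) \<le> C * (1 + norm x) ^ k"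
    using assms unfolding slow_growth_def by blast
  have C0: "0 \<le> C" using order_trans[OF norm_ge_zero C[of 0]] by simp
  let ?m = "1 + norm x0 + \<bar>c\<bar>"
  have "norm (partials \<alpha> (\<lambda>y. a (x0 + c *\<^sub>R y)) y) \<le> (\<bar>c\<bar> ^ length \<alpha> * C * ?m ^ k) * (1 + norm y) ^ k" for y
  proof -
    have "norm (x0 + c *\<^sub>R y) \<le> norm x0 + \<bar>c\<bar> * norm y"
      using norm_triangle_ineq[of x0 "c *\<^sub>R y"] by simp
    moreover have "0 \<le> norm y + norm y * norm x0" by simp
    moreover have "?m * (1 + norm y) = 1 + norm x0 + \<bar>c\<bar> * norm y + \<bar>c\<bar> + (norm y + norm y * norm x0)"
      by (simp add: algebra_simps)
    ultimately have "1 + norm (x0 + c *\<^sub>R y) \<le> ?m * (1 + norm y)" by linarith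
    then have "(1 + norm (x0 + c *\<^sub>R y)) ^ k \<le> (?m * (1 + norm y)) ^ k" by (intro power_mono) auto
    then have "norm (partials \<alpha> a (x0 + c *\<^sub>R y)) \<le> C * (?m * (1 + norm y)) ^ k"
      using C[of "x0 + c *\<^sub>R y"] C0 by (meson mult_left_mono order_trans)
    then have "\<bar>c\<bar> ^ length \<alpha> * norm (partials \<alpha> a (x0 + c *\<^sub>R y)) \<le> \<bar>c\<bar> ^ length \<alpha> * (C * (?m * (1 + norm y)) ^ k)"
      by (intro mult_left_mono) auto
    then show ?thesis
      by (simp add: partials_affine[OF a] power_mult_distrib power_abs mult.assoc)
  qed
  then show "\<exists>k C. \<forall>y. norm (partials \<alpha> (\<lambda>y. a (x0 + c *\<^sub>R y)) y) \<le> C * (1 + norm y) ^ k" by blast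
qed

text \<open>Growth of degree m in the first factor is paid for by m further powers of decay in the
  second, and the Leibniz rule keeps sums of such products within the class.\<close>

lemma schwartz_prod_sum:
  assumes "prod_sum slow_growth (\<lambda>u. u \<in> schwartz) f" shows "f \<in> schwartz"
proof (rule schwartz_coinduct[where P = "prod_sum slow_growth (\<lambda>u. u \<in> schwartz)", OF assms])
  fix f assume f: "prod_sum slow_growth (\<lambda>u. u \<in> schwartz) (f :: real^'a \<Rightarrow> complex)"
  have "(\<forall>x. f differentiable (at x)) \<and> (\<forall>i. prod_sum slow_growth (\<lambda>u. u \<in> schwartz) (partial i f))"
    by (rule prod_sum_partial[OF _ _ f])
       (auto simp: slow_growth_partial schwartz_partial intro: smooth_imp_differentiable schwartz_smooth, simp add: slow_growth_def smooth_imp_differentiable)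
  moreover have "bounded (range (\<lambda>x. norm x ^ k *\<^sub>R f x))" for k
    using f
  proof induction
    case (prod a b)
    obtain m C where C: "\<And>x. norm (partials [] a x) \<le> C * (1 + norm x) ^ m"
      using prod(1) unfolding slow_growth_def by blast
    obtain D where D: "\<And>x. (1 + norm x) ^ (k + m) * norm (b x) \<le> D"
      using schwartz_decay[OF prod(2)] by blast
    have C0: "0 \<le> C" using order_trans[OF norm_ge_zero C[of 0]] by simp
    show ?case
    proof (rule bounded_range_I)
      fix x
      have "norm (norm x ^ k *\<^sub>R (a x * b x)) = norm x ^ k * norm (a x) * norm (b x)"
        by (simp add: norm_mult)
      also have "\<dots> \<le> (1 + norm x) ^ k * (C * (1 + norm x) ^ m) * norm (b x)"
        using C[of x] C0 by (intro mult_right_mono mult_mono power_mono) auto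
      also have "\<dots> = C * ((1 + norm x) ^ (k + m) * norm (b x))" by (simp add: power_add mult_ac)
      also have "\<dots> \<le> C * D" using D C0 by (intro mult_left_mono)
      finally show "norm (norm x ^ k *\<^sub>R (a x * b x)) \<le> C * D" .
    qed
  next
    case (add f g)
    obtain C where C: "\<And>x. norm (norm x ^ k *\<^sub>R f x) \<le> C"
      using bounded_range_D[OF add.IH(1)] by blast
    obtain D where D: "\<And>x. norm (norm x ^ k *\<^sub>R g x) \<le> D"
      using bounded_range_D[OF add.IH(2)] by blast
    have "norm (norm x ^ k *\<^sub>R (f x + g x)) \<le> C + D" for x
      unfolding scaleR_add_right by (rule norm_triangle_mono[OF C D])
    then show ?case by (rule bounded_range_I)
  qed
  ultimately show "(\<forall>x. f differentiable (at x)) \<and> (\<forall>i. prod_sum slow_growth (\<lambda>u. u \<in> schwartz) (partial i f)) \<and>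
      (\<forall>k. bounded (range (\<lambda>x. norm x ^ k *\<^sub>R f x)))" by blast
qed

lemma schwartz_mult: "slow_growth a \<Longrightarrow> u \<in> schwartz \<Longrightarrow> (\<lambda>x. a x * u x) \<in> schwartz"
  by (rule schwartz_prod_sum) (rule prod_sum.prod)

lemma schwartz_scale: "u \<in> schwartz \<Longrightarrow> (\<lambda>x. c * u x) \<in> schwartz"
  by (rule schwartz_mult[OF slow_growth_const])

lemma schwartz_add:
  assumes "u \<in> schwartz" "v \<in> schwartz" shows "(\<lambda>x. u x + v x) \<in> schwartz"
proof -
  have "prod_sum slow_growth (\<lambda>u. u \<in> schwartz) (\<lambda>x. 1 * u x + 1 * v x)"
    using assms by (intro prod_sum.add prod_sum.prod slow_growth_const)
  then show ?thesis using schwartz_prod_sum by simp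
qed

lemma schwartz_zero: "(\<lambda>x. 0) \<in> schwartz"
  by (rule schwartz_coinduct[where P = "\<lambda>u. u = (\<lambda>x. 0)"])
     (auto simp: has_partial_eq[OF has_partial_const])

lemma schwartz_sum:
  assumes "finite J" "\<And>j. j \<in> J \<Longrightarrow> u j \<in> schwartz" shows "(\<lambda>x. \<Sum>j\<in>J. u j x) \<in> schwartz"
  using assms
proof induction
  case empty
  show ?case by (simp add: schwartz_zero)
next
  case (insert j J)
  then show ?case using schwartz_add[of "u j" "\<lambda>x. \<Sum>j\<in>J. u j x"] by simp
qed

section \<open>Test functions, with support described by a radius\<close>

lemma test_function_iff: "\<phi> \<in> test_function \<longleftrightarrow> smooth \<phi> \<and> (\<exists>R. \<forall>x. norm x > R \<longrightarrow> \<phi> x = 0)"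
proof -
  have "compact (closure {x. \<phi> x \<noteq> 0}) \<longleftrightarrow> bounded {x. \<phi> x \<noteq> 0}"
    using bounded_closure bounded_subset[OF _ closure_subset] by (auto simp: compact_eq_bounded_closed)
  also have "\<dots> \<longleftrightarrow> (\<exists>R. \<forall>x. norm x > R \<longrightarrow> \<phi> x = 0)"
    unfolding bounded_iff by (auto simp: not_less[symmetric])
  finally show ?thesis by (simp add: test_function_def)
qed

lemma test_function_smooth: "\<phi> \<in> test_function \<Longrightarrow> smooth \<phi>"
  by (simp add: test_function_def)

lemma test_function_partial:
  assumes "\<phi> \<in> test_function" shows "partial i \<phi> \<in> test_function"
proof -
  obtain R where R: "\<And>x. norm x > R \<Longrightarrow> \<phi> x = 0" using assms by (auto simp: test_function_iff)
  have "partial i \<phi> x = 0" if "norm x > R" for x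
    by (rule has_partial_eq_0_outside[OF R smooth_has_partial[OF test_function_smooth[OF assms]] that])
  then show ?thesis using assms by (auto simp: test_function_iff smooth_partial)
qed

lemma test_function_schwartz:
  assumes "\<phi> \<in> test_function" shows "\<phi> \<in> schwartz"
proof (rule schwartz_coinduct[where P = "\<lambda>\<phi>. \<phi> \<in> test_function", OF assms], intro conjI allI)
  fix \<phi> :: "real^'a \<Rightarrow> complex" and k i x assume \<phi>: "\<phi> \<in> test_function"
  then obtain R where R: "\<And>x. norm x > R \<Longrightarrow> \<phi> x = 0" by (auto simp: test_function_iff)
  show "bounded (range (\<lambda>x. norm x ^ k *\<^sub>R \<phi> x))"
    using R smooth_continuous[OF test_function_smooth[OF \<phi>]]
    by (intro bounded_compact_support[where R = R]) (auto intro!: continuous_intros)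
qed (auto simp: test_function_smooth smooth_imp_differentiable test_function_partial)

section \<open>Integrability of rapidly decreasing functions\<close>

text \<open>Lebesgue measure on a Euclidean space is the image of the product measure indexed by the
  basis, so products of one-variable functions integrate factor by factor.\<close>

lemma
  fixes f :: "'a::euclidean_space \<Rightarrow> real \<Rightarrow> 'b::{real_normed_field, banach, second_countable_topology}"
  assumes f: "\<And>b. b \<in> Basis \<Longrightarrow> integrable lborel (f b)"
  shows integrable_lborel_prod: "integrable lborel (\<lambda>x::'a. \<Prod>b\<in>Basis. f b (x \<bullet> b))"
    and integral_lborel_prod: "(\<integral>x. (\<Prod>b\<in>Basis. f b (x \<bullet> b)) \<partial>lborel) = (\<Prod>b\<in>Basis. \<integral>t. f b t \<partial>lborel)"
proof -
  interpret product_sigma_finite "\<lambda>_::'a. lborel :: real measure" ..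
  have [measurable]: "f b \<in> borel_measurable borel" if "b \<in> Basis" for b using f[OF that] by simp
  have m: "(\<lambda>x::'a. \<Prod>b\<in>Basis. f b (x \<bullet> b)) \<in> borel_measurable borel" by measurable
  have eq: "(\<Prod>b\<in>Basis. f b ((\<Sum>c\<in>Basis. y c *\<^sub>R c) \<bullet> b)) = (\<Prod>b\<in>Basis. f b (y b))" for y :: "'a \<Rightarrow> real"
    by (intro prod.cong refl) simp
  have "integrable (\<Pi>\<^sub>M b\<in>Basis. lborel) (\<lambda>y. \<Prod>b\<in>Basis. f b (y b))"
    by (rule product_integrable_prod) (auto intro: f)
  then show "integrable lborel (\<lambda>x::'a. \<Prod>b\<in>Basis. f b (x \<bullet> b))"
    by (subst lborel_eq, subst integrable_distr_eq) (auto simp: m eq)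
  have "(\<integral>x. (\<Prod>b\<in>Basis. f b (x \<bullet> b)) \<partial>lborel) = (\<integral>y. (\<Prod>b\<in>Basis. f b (y b)) \<partial>(\<Pi>\<^sub>M b\<in>(Basis::'a set). lborel))"
    by (subst lborel_eq, subst integral_distr) (auto simp: m eq)
  also have "\<dots> = (\<Prod>b\<in>Basis. \<integral>t. f b t \<partial>lborel)"
    by (rule product_integral_prod) (auto intro: f)
  finally show "(\<integral>x. (\<Prod>b\<in>Basis. f b (x \<bullet> b)) \<partial>lborel) = (\<Prod>b\<in>Basis. \<integral>t. f b t \<partial>lborel)" .
qed

text \<open>Each of the \<open>DIM('a)\<close> factors 1 + (x \<bullet> b)^2 is at most 1 + |x|^2,
  so the function is dominated by a product of integrable one-variable functions.\<close>

lemma integrable_inverse_power_norm: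
  "integrable lborel (\<lambda>x::'a::euclidean_space. inverse ((1 + (norm x)\<^sup>2) ^ DIM('a)))"
proof (rule Bochner_Integration.integrable_bound)
  have "integrable lborel (\<lambda>x::real. inverse (1 + x\<^sup>2))"
    using integrable_inverse_1_plus_square by (simp add: set_integrable_def)
  then show "integrable lborel (\<lambda>x::'a. \<Prod>b\<in>Basis. inverse (1 + (x \<bullet> b)\<^sup>2))"
    by (rule integrable_lborel_prod)
  show "AE x::'a in lborel. norm (inverse ((1 + (norm x)\<^sup>2) ^ DIM('a))) \<le> norm (\<Prod>b\<in>Basis. inverse (1 + (x \<bullet> b)\<^sup>2))"
  proof (rule AE_I2)
    fix x :: 'a
    have pos: "0 < 1 + (x \<bullet> b)\<^sup>2" for b by (intro add_pos_nonneg) auto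
    have "(\<Prod>b\<in>Basis. 1 + (x \<bullet> b)\<^sup>2) \<le> (\<Prod>b\<in>(Basis::'a set). 1 + (norm x)\<^sup>2)"
    proof (rule prod_mono)
      fix b :: 'a assume "b \<in> Basis"
      then have "\<bar>x \<bullet> b\<bar> \<le> norm x" by (rule Basis_le_norm)
      then have "(x \<bullet> b)\<^sup>2 \<le> (norm x)\<^sup>2" by (metis abs_ge_zero power2_abs power_mono)
      then show "0 \<le> 1 + (x \<bullet> b)\<^sup>2 \<and> 1 + (x \<bullet> b)\<^sup>2 \<le> 1 + (norm x)\<^sup>2" using pos[of b] by auto
    qed
    then have "inverse ((1 + (norm x)\<^sup>2) ^ DIM('a)) \<le> inverse (\<Prod>b\<in>Basis. 1 + (x \<bullet> b)\<^sup>2)"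
      using pos by (intro le_imp_inverse_le prod_pos) (auto simp: prod_constant)
    also have "\<dots> = (\<Prod>b\<in>Basis. inverse (1 + (x \<bullet> b)\<^sup>2))" by (rule prod_inversef[symmetric, unfolded o_def])
    finally have 1: "inverse ((1 + (norm x)\<^sup>2) ^ DIM('a)) \<le> (\<Prod>b\<in>Basis. inverse (1 + (x \<bullet> b)\<^sup>2))" .
    have "0 \<le> inverse ((1 + (norm x)\<^sup>2) ^ DIM('a))" by simp
    then show "norm (inverse ((1 + (norm x)\<^sup>2) ^ DIM('a))) \<le> norm (\<Prod>b\<in>Basis. inverse (1 + (x \<bullet> b)\<^sup>2))"
      using 1 unfolding real_norm_def by linarith
  qed
qed measurable

lemma integrable_decay:
  fixes f :: "'a::euclidean_space \<Rightarrow> 'b::{banach, second_countable_topology}"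
  assumes [measurable]: "f \<in> borel_measurable borel"
    and C: "\<And>x. (1 + (norm x)\<^sup>2) ^ DIM('a) * norm (f x) \<le> C"
  shows "integrable lborel f"
proof (rule Bochner_Integration.integrable_bound)
  show "integrable lborel (\<lambda>x::'a. C * inverse ((1 + (norm x)\<^sup>2) ^ DIM('a)))"
    by (intro integrable_mult_right integrable_inverse_power_norm)
  have "norm (f x) \<le> norm (C * inverse ((1 + (norm x)\<^sup>2) ^ DIM('a)))" for x
  proof -
    have pos: "0 < (1 + (norm x)\<^sup>2) ^ DIM('a)" by (intro zero_less_power add_pos_nonneg) auto
    then have "norm (f x) \<le> C * inverse ((1 + (norm x)\<^sup>2) ^ DIM('a))"
      using C[of x] by (simp add: field_simps)
    then show ?thesis by simp
  qed
  then show "AE x in lborel. norm (f x) \<le> norm (C * inverse ((1 + (norm x)\<^sup>2) ^ DIM('a)))" by (rule AE_I2)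
qed simp

lemma schwartz_measurable: "u \<in> schwartz \<Longrightarrow> u \<in> borel_measurable borel"
  by (simp add: borel_measurable_continuous_onI schwartz_continuous)

lemma schwartz_decay_norm_power2:
  assumes "u \<in> schwartz"
  shows "\<exists>C\<ge>0. \<forall>x. (1 + (norm x)\<^sup>2) ^ k * norm (u x) \<le> C"
proof -
  obtain C where C: "0 \<le> C" "\<And>x. (1 + norm x) ^ (2 * k) * norm (u x) \<le> C"
    using schwartz_decay[OF assms] by blast
  have "(1 + (norm x)\<^sup>2) ^ k * norm (u x) \<le> C" for x
  proof -
    have "1 + (norm x)\<^sup>2 \<le> (1 + norm x)\<^sup>2" by (simp add: power2_sum)
    then have "(1 + (norm x)\<^sup>2) ^ k \<le> ((1 + norm x)\<^sup>2) ^ k" by (intro power_mono) auto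
    then have "(1 + (norm x)\<^sup>2) ^ k * norm (u x) \<le> (1 + norm x) ^ (2 * k) * norm (u x)"
      by (intro mult_right_mono) (auto simp: power_mult)
    also have "\<dots> \<le> C" by (rule C)
    finally show ?thesis .
  qed
  then show ?thesis using C(1) by blast
qed

lemma schwartz_integrable:
  assumes "u \<in> schwartz" shows "integrable lborel u"
proof -
  obtain C where "\<And>x. (1 + (norm x)\<^sup>2) ^ DIM(real^'a) * norm (u x) \<le> C"
    using schwartz_decay_norm_power2[OF assms] by blast
  then show ?thesis by (rule integrable_decay[OF schwartz_measurable[OF assms]])
qed

lemma schwartz_bounded: "u \<in> schwartz \<Longrightarrow> \<exists>C\<ge>0. \<forall>x. norm (u x) \<le> C"
  using schwartz_decay[of u 0] by simp

lemma schwartz_L2: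
  assumes "u \<in> schwartz" shows "u \<in> L2"
proof -
  obtain C where C: "\<And>x. norm (u x) \<le> C" using schwartz_bounded[OF assms] by blast
  have "integrable lborel (\<lambda>x. (norm (u x))\<^sup>2)"
  proof (rule Bochner_Integration.integrable_bound)
    show "integrable lborel (\<lambda>x. C * norm (u x))"
      by (intro integrable_mult_right integrable_norm schwartz_integrable assms)
    have "norm ((norm (u x))\<^sup>2) \<le> norm (C * norm (u x))" for x
    proof -
      have "(norm (u x))\<^sup>2 \<le> C * norm (u x)"
        unfolding power2_eq_square using C by (intro mult_right_mono) auto
      then show ?thesis by simp
    qed
    then show "AE x in lborel. norm ((norm (u x))\<^sup>2) \<le> norm (C * norm (u x))" by (rule AE_I2)
  qed (use schwartz_measurable[OF assms] in simp)
  then show ?thesis using schwartz_measurable[OF assms] by (simp add: L2_def)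
qed

section \<open>Fourier inversion\<close>

text \<open>A product of one-dimensional normal densities instead of an exponential of the norm, so
  that the mass and the Fourier transform reduce to the normal law on the line and its
  characteristic function.\<close>

definition gauss :: "'a::euclidean_space \<Rightarrow> real" where
  "gauss x = (\<Prod>b\<in>Basis. std_normal_density (x \<bullet> b))"

lemma gauss_measurable [measurable]: "gauss \<in> borel_measurable borel"
  unfolding gauss_def[abs_def] by measurable

lemma gauss_nonneg: "0 \<le> gauss x"
  unfolding gauss_def by (intro prod_nonneg) (simp add: normal_density_nonneg)

lemma gauss_eq: "gauss (x::'a::euclidean_space) = (1 / sqrt (2 * pi)) ^ DIM('a) * exp (- (norm x)\<^sup>2 / 2)"
proof -
  have "gauss x = (\<Prod>b\<in>Basis. 1 / sqrt (2 * pi) * exp (- (x \<bullet> b)\<^sup>2 / 2))"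
    unfolding gauss_def std_normal_density_def ..
  also have "\<dots> = (1 / sqrt (2 * pi)) ^ DIM('a) * exp (\<Sum>b\<in>Basis. - (x \<bullet> b)\<^sup>2 / 2)"
    unfolding prod.distrib prod_constant exp_sum[OF finite_Basis] ..
  also have "(\<Sum>b\<in>Basis. - (x \<bullet> b)\<^sup>2 / 2) = - (norm x)\<^sup>2 / 2"
    by (simp add: norm_eq_sqrt_inner euclidean_inner[of x x] power2_eq_square sum_nonneg sum_negf sum_divide_distrib[symmetric])
  finally show ?thesis .
qed

lemma gauss_le: "gauss (x::'a::euclidean_space) \<le> gauss (0::'a)"
  unfolding gauss_eq by (intro mult_left_mono) auto

lemma integrable_gauss: "integrable lborel gauss"
  unfolding gauss_def[abs_def] by (rule integrable_lborel_prod) (simp add: integrable_normal_density)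

lemma integral_gauss: "(\<integral>x. gauss x \<partial>lborel) = 1"
  unfolding gauss_def by (subst integral_lborel_prod) (simp_all add: integrable_normal_density integral_normal_density)

text \<open>The integral factorizes into characteristic functions of the standard normal law. The
  power of sqrt (2 pi) only undoes the normalization: the right-hand side is exp (- |w|^2 /
  2).\<close>

lemma gauss_fourier:
  fixes w :: "'a::euclidean_space"
  shows "(\<integral>\<xi>. iexp (w \<bullet> \<xi>) * gauss \<xi> \<partial>lborel) = of_real (sqrt (2 * pi) ^ DIM('a) * gauss w)"
proof -
  let ?f = "\<lambda>(b::'a) t. iexp ((w \<bullet> b) * t) * of_real (std_normal_density t) :: complex"
  have int: "integrable lborel (?f b)" for b
    by (rule Bochner_Integration.integrable_bound[of _ std_normal_density])
       (auto simp: norm_mult integrable_normal_density normal_density_nonneg)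
  have "iexp (w \<bullet> \<xi>) * gauss \<xi> = (\<Prod>b\<in>Basis. ?f b (\<xi> \<bullet> b))" for \<xi>
  proof -
    have "iexp (w \<bullet> \<xi>) = (\<Prod>b\<in>Basis. iexp ((w \<bullet> b) * (\<xi> \<bullet> b)))"
      by (subst euclidean_inner) (simp add: exp_sum sum_distrib_left)
    then show ?thesis by (simp add: gauss_def prod.distrib)
  qed
  then have "(\<integral>\<xi>. iexp (w \<bullet> \<xi>) * gauss \<xi> \<partial>lborel) = (\<Prod>b\<in>Basis. \<integral>t. ?f b t \<partial>lborel)"
    using integral_lborel_prod[of ?f] int by simp
  also have "\<dots> = (\<Prod>b\<in>Basis. of_real (exp (- (w \<bullet> b)\<^sup>2 / 2)))"
  proof (intro prod.cong refl)
    fix b :: 'a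
    have "char std_normal_distribution (w \<bullet> b) = (\<integral>t. std_normal_density t *\<^sub>R iexp ((w \<bullet> b) * t) \<partial>lborel)"
      unfolding char_def by (rule integral_density) (auto simp: normal_density_nonneg)
    then show "(\<integral>t. ?f b t \<partial>lborel) = of_real (exp (- (w \<bullet> b)\<^sup>2 / 2))"
      by (simp add: char_std_normal_distribution scaleR_conv_of_real mult.commute)
  qed
  also have "(\<Prod>b\<in>Basis. of_real (exp (- (w \<bullet> b)\<^sup>2 / 2))) = (of_real (sqrt (2 * pi) ^ DIM('a) * gauss w) :: complex)"
  proof -
    have "sqrt (2 * pi) ^ DIM('a) * gauss w = (\<Prod>b\<in>(Basis::'a set). sqrt (2 * pi) * std_normal_density (w \<bullet> b))"
      by (simp add: gauss_def prod.distrib)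
    also have "\<dots> = (\<Prod>b\<in>(Basis::'a set). exp (- (w \<bullet> b)\<^sup>2 / 2))"
      by (intro prod.cong refl) (simp add: std_normal_density_def)
    finally show ?thesis by simp
  qed
  finally show ?thesis .
qed

section \<open>The Fourier transform with the phase of the Weyl kernel\<close>

definition wave :: "real^'n \<Rightarrow> real^'n \<Rightarrow> complex" where
  "wave v \<xi> = exp (2 * of_real pi * \<i> * of_real (v \<bullet> \<xi>))"

text \<open>\<open>fourier g x \<xi> = exp (2 \<pi> i x \<xi>)\<close> times the Fourier transform of \<open>g\<close> at \<open>\<xi>\<close>.\<close>

definition fourier :: "(real^'n \<Rightarrow> complex) \<Rightarrow> real^'n \<Rightarrow> real^'n \<Rightarrow> complex" where
  "fourier g x \<xi> = (LINT y|lborel. wave (x - y) \<xi> * g y)"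

lemma wave_iexp: "wave v \<xi> = iexp ((2 * pi) *\<^sub>R v \<bullet> \<xi>)"
  by (simp add: wave_def mult_ac)

lemma norm_wave [simp]: "norm (wave v \<xi>) = 1"
  unfolding wave_iexp by simp

lemma wave_measurable [measurable]: "(\<lambda>(v, \<xi>). wave v \<xi>) \<in> borel_measurable (borel \<Otimes>\<^sub>M borel)"
  unfolding wave_def by measurable

lemma wave_continuous: "continuous_on UNIV (\<lambda>y. wave (x - y) \<xi>)"
  unfolding wave_def by (intro continuous_intros)

lemma has_partial_wave:
  "has_partial (\<lambda>y. wave (x - y) \<xi>) i y (- (2 * of_real pi * \<i> * of_real (\<xi> $ i)) * wave (x - y) \<xi>)"
proof -
  let ?a = "2 * of_real pi * \<i> :: complex"
  have "((\<lambda>t. exp (?a * of_real ((x - y) \<bullet> \<xi> - t * \<xi> $ i))) has_vector_derivative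
      (?a * of_real (0 - 1 * \<xi> $ i)) * exp (?a * of_real ((x - y) \<bullet> \<xi> - 0 * \<xi> $ i))) (at 0)"
  proof -
    have 1: "((\<lambda>t. ?a * of_real ((x - y) \<bullet> \<xi> - t * \<xi> $ i)) has_vector_derivative (?a * of_real (0 - 1 * \<xi> $ i))) (at 0)"
      by (auto intro!: derivative_eq_intros has_vector_derivative_mult_right has_vector_derivative_of_real)
    from field_vector_diff_chain_at[OF 1 DERIV_exp] show ?thesis by (simp add: o_def)
  qed
  then show ?thesis
    by (simp add: has_partial_def wave_def inner_diff_left inner_add_left inner_axis' algebra_simps)
qed

lemma fourier_integrable:
  assumes "g \<in> schwartz" shows "integrable lborel (\<lambda>y. wave (x - y) \<xi> * g y)"
proof (rule Bochner_Integration.integrable_bound[OF schwartz_integrable[OF assms]])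
  note [measurable] = schwartz_measurable[OF assms]
  show "(\<lambda>y. wave (x - y) \<xi> * g y) \<in> borel_measurable lborel" by measurable
qed (simp add: norm_mult)

text \<open>Integrate the derivative in y of \<open>wave (x - y) \<xi> * g y\<close>;
  differentiating the wave brings down - 2 pi i times the i-th component of \<xi>.\<close>

lemma fourier_partial:
  assumes g: "g \<in> schwartz"
  shows "fourier (partial i g) x \<xi> = 2 * of_real pi * \<i> * of_real (\<xi> $ i) * fourier g x \<xi>"
proof -
  let ?c = "2 * of_real pi * \<i> * of_real (\<xi> $ i) :: complex"
  note g' = schwartz_partial[OF g, of i]
  have "(LINT y|lborel. - ?c * (wave (x - y) \<xi> * g y) + wave (x - y) \<xi> * partial i g y) = 0"
  proof (rule integral_partial_eq_0)
    show "integrable lborel (\<lambda>y. wave (x - y) \<xi> * g y)" by (rule fourier_integrable[OF g])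
    show "integrable lborel (\<lambda>y. - ?c * (wave (x - y) \<xi> * g y) + wave (x - y) \<xi> * partial i g y)"
      by (intro Bochner_Integration.integrable_add integrable_mult_right fourier_integrable g g')
    show "continuous_on UNIV (\<lambda>y. - ?c * (wave (x - y) \<xi> * g y) + wave (x - y) \<xi> * partial i g y)"
      by (intro continuous_intros wave_continuous schwartz_continuous g g')
    show "has_partial (\<lambda>y. wave (x - y) \<xi> * g y) i y (- ?c * (wave (x - y) \<xi> * g y) + wave (x - y) \<xi> * partial i g y)" for y
      using has_partial_mult[OF has_partial_wave schwartz_has_partial[OF g]] by (simp add: mult.assoc)
  qed
  then have "- ?c * (LINT y|lborel. wave (x - y) \<xi> * g y) + (LINT y|lborel. wave (x - y) \<xi> * partial i g y) = 0"
    by (subst (asm) Bochner_Integration.integral_add)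
       (auto intro!: integrable_mult_right fourier_integrable g g' simp del: mult_minus_left)
  then show ?thesis by (simp add: fourier_def)
qed

definition laplacian :: "(real^'n \<Rightarrow> complex) \<Rightarrow> real^'n \<Rightarrow> complex" where
  "laplacian f x = (\<Sum>i\<in>UNIV. partial i (partial i f) x)"

lemma schwartz_laplacian: "u \<in> schwartz \<Longrightarrow> laplacian u \<in> schwartz"
  unfolding laplacian_def[abs_def] by (intro schwartz_sum schwartz_partial) auto

lemma fourier_add:
  assumes "f \<in> schwartz" "g \<in> schwartz"
  shows "fourier (\<lambda>y. f y + g y) x \<xi> = fourier f x \<xi> + fourier g x \<xi>"
  unfolding fourier_def distrib_left
  by (intro Bochner_Integration.integral_add fourier_integrable assms)

lemma fourier_scale:
  assumes "f \<in> schwartz"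
  shows "fourier (\<lambda>y. c * f y) x \<xi> = c * fourier f x \<xi>"
proof -
  have "(LINT y|lborel. wave (x - y) \<xi> * (c * f y)) = (LINT y|lborel. c * (wave (x - y) \<xi> * f y))"
    by (simp add: mult_ac)
  also have "\<dots> = c * (LINT y|lborel. wave (x - y) \<xi> * f y)"
    using fourier_integrable[OF assms] by simp
  finally show ?thesis by (simp add: fourier_def)
qed

lemma fourier_sum:
  assumes "\<And>j. j \<in> J \<Longrightarrow> f j \<in> schwartz"
  shows "fourier (\<lambda>y. \<Sum>j\<in>J. f j y) x \<xi> = (\<Sum>j\<in>J. fourier (f j) x \<xi>)"
  unfolding fourier_def sum_distrib_left
  by (intro Bochner_Integration.integral_sum fourier_integrable assms)

lemma fourier_laplacian:
  assumes g: "g \<in> schwartz"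
  shows "fourier (laplacian g) x \<xi> = - (of_real (4 * pi\<^sup>2 * (norm \<xi>)\<^sup>2)) * fourier g x \<xi>"
proof -
  have "fourier (laplacian g) x \<xi> = (\<Sum>i\<in>UNIV. fourier (partial i (partial i g)) x \<xi>)"
    unfolding laplacian_def[abs_def] by (intro fourier_sum schwartz_partial g)
  also have "\<dots> = (\<Sum>i\<in>UNIV. - of_real (4 * pi\<^sup>2 * (\<xi> $ i)\<^sup>2) * fourier g x \<xi>)"
    by (intro sum.cong refl) (simp add: fourier_partial schwartz_partial g power2_eq_square mult_ac)
  also have "\<dots> = - of_real (4 * pi\<^sup>2 * (\<Sum>i\<in>UNIV. (\<xi> $ i)\<^sup>2)) * fourier g x \<xi>"
    by (simp add: sum_distrib_left sum_distrib_right sum_negf)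
  also have "(\<Sum>i\<in>UNIV. (\<xi> $ i)\<^sup>2) = (norm \<xi>)\<^sup>2"
    by (simp add: norm_eq_sqrt_inner inner_vec_def power2_eq_square sum_nonneg)
  finally show ?thesis .
qed

lemma fourier_measurable:
  assumes "g \<in> schwartz" shows "fourier g x \<in> borel_measurable borel"
proof -
  note [measurable] = schwartz_measurable[OF assms]
  have "(\<lambda>\<xi>. LINT y|lborel. wave (x - y) \<xi> * g y) \<in> borel_measurable lborel"
    by (rule lborel.borel_measurable_lebesgue_integral) measurable
  then show ?thesis by (simp add: fourier_def[abs_def])
qed

lemma norm_fourier_le: "g \<in> schwartz \<Longrightarrow> norm (fourier g x \<xi>) \<le> (LINT y|lborel. norm (g y))"
  unfolding fourier_def using integral_norm_bound[of lborel "\<lambda>y. wave (x - y) \<xi> * g y"] by (simp add: norm_mult)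

text \<open>Induction on k through g minus its Laplacian, which is again Schwartz. Its transform is
  that of g times 1 + 4 pi^2 |\<xi>|^2, and this factor is at least 1 + |\<xi>|^2, so each step
  gains one power.\<close>

lemma fourier_decay:
  assumes "g \<in> schwartz"
  shows "\<exists>C. \<forall>\<xi>. (1 + (norm \<xi>)\<^sup>2) ^ k * norm (fourier g x \<xi>) \<le> C"
  using assms
proof (induction k arbitrary: g)
  case 0
  then show ?case using norm_fourier_le by auto
next
  case (Suc k)
  let ?g = "\<lambda>y. g y + (-1) * laplacian g y"
  have g': "?g \<in> schwartz" by (intro schwartz_add schwartz_scale schwartz_laplacian Suc.prems)
  then obtain C where C: "\<And>\<xi>. (1 + (norm \<xi>)\<^sup>2) ^ k * norm (fourier ?g x \<xi>) \<le> C"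
    using Suc.IH by blast
  have "(1 + (norm \<xi>)\<^sup>2) ^ Suc k * norm (fourier g x \<xi>) \<le> C" for \<xi>
  proof -
    have "fourier ?g x \<xi> = of_real (1 + 4 * pi\<^sup>2 * (norm \<xi>)\<^sup>2) * fourier g x \<xi>"
      by (subst fourier_add fourier_scale | intro schwartz_scale schwartz_laplacian Suc.prems)+
         (simp add: fourier_laplacian Suc.prems algebra_simps)
    then have eq: "norm (fourier ?g x \<xi>) = (1 + 4 * pi\<^sup>2 * (norm \<xi>)\<^sup>2) * norm (fourier g x \<xi>)"
      by (simp only: norm_mult norm_of_real) (simp add: add_nonneg_nonneg)
    have "1 \<le> 4 * pi\<^sup>2"
    proof -
      have "1 \<le> pi" using pi_gt3 by linarith
      then have "1 \<le> pi\<^sup>2" by (simp add: one_le_power)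
      then show ?thesis by linarith
    qed
    then have "1 * (norm \<xi>)\<^sup>2 \<le> 4 * pi\<^sup>2 * (norm \<xi>)\<^sup>2" by (intro mult_right_mono) auto
    then have "(1 + (norm \<xi>)\<^sup>2) * norm (fourier g x \<xi>) \<le> norm (fourier ?g x \<xi>)"
      unfolding eq by (intro mult_right_mono) auto
    then have "(1 + (norm \<xi>)\<^sup>2) ^ k * ((1 + (norm \<xi>)\<^sup>2) * norm (fourier g x \<xi>)) \<le> (1 + (norm \<xi>)\<^sup>2) ^ k * norm (fourier ?g x \<xi>)"
      by (intro mult_left_mono) auto
    also have "\<dots> \<le> C" by (rule C)
    finally show ?thesis by (simp add: mult_ac)
  qed
  then show ?case by blast
qed

lemma integrable_fourier:
  assumes "g \<in> schwartz" shows "integrable lborel (fourier g x)"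
  using fourier_decay[OF assms] integrable_decay[OF fourier_measurable[OF assms]] by blast

lemma integral_gauss_wave:
  fixes v :: "real^'n"
  assumes e: "0 < e"
  shows "(\<integral>\<xi>. of_real (gauss (e *\<^sub>R \<xi>)) * wave v \<xi> \<partial>lborel) =
    of_real ((sqrt (2 * pi) / e) ^ CARD('n) * gauss ((2 * pi / e) *\<^sub>R v))"
proof -
  have int: "integrable lborel (\<lambda>\<xi>::real^'n. of_real (gauss (e *\<^sub>R \<xi>)) * wave v \<xi>)"
  proof (rule Bochner_Integration.integrable_bound)
    show "integrable lborel (\<lambda>\<xi>::real^'n. gauss (e *\<^sub>R \<xi>))"
      using integrable_affine[OF _ integrable_gauss, of e 0] e by simp
  qed (auto simp: norm_mult)
  have eq: "of_real (gauss (e *\<^sub>R (0 + (1/e) *\<^sub>R \<zeta>))) * wave v (0 + (1/e) *\<^sub>R \<zeta>) = iexp (((2 * pi / e) *\<^sub>R v) \<bullet> \<zeta>) * gauss \<zeta>" for \<zeta>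
    using e by (simp add: wave_iexp mult.commute)
  have "(\<integral>\<xi>. of_real (gauss (e *\<^sub>R \<xi>)) * wave v \<xi> \<partial>lborel) =
      \<bar>1/e\<bar> ^ DIM(real^'n) *\<^sub>R (\<integral>\<zeta>. of_real (gauss (e *\<^sub>R (0 + (1/e) *\<^sub>R \<zeta>))) * wave v (0 + (1/e) *\<^sub>R \<zeta>) \<partial>lborel)"
    using e by (intro integral_affine int) auto
  also have "\<dots> = (1/e) ^ DIM(real^'n) *\<^sub>R of_real (sqrt (2 * pi) ^ DIM(real^'n) * gauss ((2 * pi / e) *\<^sub>R v))"
    unfolding eq gauss_fourier using e by simp
  also have "\<dots> = of_real ((sqrt (2 * pi) / e) ^ CARD('n) * gauss ((2 * pi / e) *\<^sub>R v))"
    by (simp add: scaleR_conv_of_real power_divide)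
  finally show ?thesis .
qed

text \<open>The Gaussian factor makes the double integral absolutely convergent, so Fubini applies
  and the inner integral is again Gaussian. What remains is an average of g around x at scale e / (2
  pi).\<close>

lemma integral_gauss_fourier:
  fixes g :: "real^'n \<Rightarrow> complex"
  assumes g: "g \<in> schwartz" and e: "0 < e"
  shows "(\<integral>\<xi>. of_real (gauss (e *\<^sub>R \<xi>)) * fourier g x \<xi> \<partial>lborel) =
    of_real (gauss (0::real^'n)) * (\<integral>v. g (x + (- (e / (2 * pi))) *\<^sub>R v) * gauss v \<partial>lborel)"
proof -
  note [measurable] = schwartz_measurable[OF g]
  let ?n = "CARD('n)"
  have int: "integrable (lborel \<Otimes>\<^sub>M lborel) (\<lambda>(\<xi>, y). of_real (gauss (e *\<^sub>R \<xi>)) * (wave (x - y) \<xi> * g y))"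
  proof (rule lborel_pair.Fubini_integrable)
    have eq: "(\<integral>y. norm (of_real (gauss (e *\<^sub>R \<xi>)) * (wave (x - y) \<xi> * g y)) \<partial>lborel) = gauss (e *\<^sub>R \<xi>) * (\<integral>y. norm (g y) \<partial>lborel)" for \<xi>
      by (simp add: norm_mult gauss_nonneg)
    show "integrable lborel (\<lambda>\<xi>. \<integral>y. norm (case (\<xi>, y) of (\<xi>, y) \<Rightarrow> of_real (gauss (e *\<^sub>R \<xi>)) * (wave (x - y) \<xi> * g y)) \<partial>lborel)"
      unfolding prod.case eq using integrable_affine[OF _ integrable_gauss, of e 0] e by (intro integrable_mult_left) simp
    show "AE \<xi> in lborel. integrable lborel (\<lambda>y. case (\<xi>, y) of (\<xi>, y) \<Rightarrow> of_real (gauss (e *\<^sub>R \<xi>)) * (wave (x - y) \<xi> * g y))"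
      unfolding prod.case by (intro AE_I2 integrable_mult_right fourier_integrable g)
  qed measurable
  have "(\<integral>\<xi>. of_real (gauss (e *\<^sub>R \<xi>)) * fourier g x \<xi> \<partial>lborel) =
      (\<integral>\<xi>. (\<integral>y. of_real (gauss (e *\<^sub>R \<xi>)) * (wave (x - y) \<xi> * g y) \<partial>lborel) \<partial>lborel)"
    unfolding fourier_def using fourier_integrable[OF g] by simp
  also have "\<dots> = (\<integral>y. (\<integral>\<xi>. of_real (gauss (e *\<^sub>R \<xi>)) * (wave (x - y) \<xi> * g y) \<partial>lborel) \<partial>lborel)"
    using lborel_pair.Fubini_integral[OF int] by simp
  also have "\<dots> = (\<integral>y. g y * of_real ((sqrt (2 * pi) / e) ^ ?n * gauss ((2 * pi / e) *\<^sub>R (x - y))) \<partial>lborel)"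
  proof (rule Bochner_Integration.integral_cong[OF refl])
    fix y
    have "(\<integral>\<xi>. of_real (gauss (e *\<^sub>R \<xi>)) * (wave (x - y) \<xi> * g y) \<partial>lborel) = (\<integral>\<xi>. (of_real (gauss (e *\<^sub>R \<xi>)) * wave (x - y) \<xi>) * g y \<partial>lborel)"
      by (simp add: mult.assoc)
    also have "\<dots> = (\<integral>\<xi>. of_real (gauss (e *\<^sub>R \<xi>)) * wave (x - y) \<xi> \<partial>lborel) * g y"
    proof -
      have "integrable lborel (\<lambda>\<xi>::real^'n. gauss (e *\<^sub>R \<xi>))"
        using integrable_affine[OF _ integrable_gauss, of e 0] e by simp
      then have "integrable lborel (\<lambda>\<xi>. of_real (gauss (e *\<^sub>R \<xi>)) * wave (x - y) \<xi>)"
        by (rule Bochner_Integration.integrable_bound) (auto simp: norm_mult)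
      then show ?thesis by simp
    qed
    finally show "(\<integral>\<xi>. of_real (gauss (e *\<^sub>R \<xi>)) * (wave (x - y) \<xi> * g y) \<partial>lborel) =
        g y * of_real ((sqrt (2 * pi) / e) ^ ?n * gauss ((2 * pi / e) *\<^sub>R (x - y)))"
      unfolding integral_gauss_wave[OF e] by (simp add: mult.commute)
  qed
  \<comment> \<open>Substitution y = x - (e / (2 pi)) v.\<close>
  also have "\<dots> = \<bar>- (e / (2 * pi))\<bar> ^ DIM(real^'n) *\<^sub>R (\<integral>v. g (x + (- (e / (2 * pi))) *\<^sub>R v) *
      of_real ((sqrt (2 * pi) / e) ^ ?n * gauss ((2 * pi / e) *\<^sub>R (x - (x + (- (e / (2 * pi))) *\<^sub>R v)))) \<partial>lborel)"
  proof (rule integral_affine)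
    show "integrable lborel (\<lambda>y. g y * of_real ((sqrt (2 * pi) / e) ^ ?n * gauss ((2 * pi / e) *\<^sub>R (x - y))))"
    proof (rule Bochner_Integration.integrable_bound)
      show "integrable lborel (\<lambda>y. ((sqrt (2 * pi) / e) ^ ?n * gauss (0::real^'n)) * norm (g y))"
        by (intro integrable_mult_right integrable_norm schwartz_integrable g)
      have "norm (g y * of_real ((sqrt (2 * pi) / e) ^ ?n * gauss ((2 * pi / e) *\<^sub>R (x - y)))) \<le>
          norm (((sqrt (2 * pi) / e) ^ ?n * gauss (0::real^'n)) * norm (g y))" for y
        using e mult_right_mono[OF mult_left_mono[OF gauss_le[of "(2 * pi / e) *\<^sub>R (x - y)"], of "(sqrt (2 * pi) / e) ^ ?n"], of "norm (g y)"]
        by (simp add: norm_mult norm_power norm_divide abs_mult gauss_nonneg mult.commute)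
      then show "AE y in lborel. norm (g y * of_real ((sqrt (2 * pi) / e) ^ ?n * gauss ((2 * pi / e) *\<^sub>R (x - y)))) \<le>
          norm (((sqrt (2 * pi) / e) ^ ?n * gauss (0::real^'n)) * norm (g y))" by (rule AE_I2)
    qed measurable
  qed (use e in simp)
  also have "\<dots> = (e / (2 * pi)) ^ ?n *\<^sub>R (\<integral>v. of_real ((sqrt (2 * pi) / e) ^ ?n) * (g (x + (- (e / (2 * pi))) *\<^sub>R v) * gauss v) \<partial>lborel)"
    using e by (simp add: mult_ac)
  also have "\<dots> = of_real ((e / (2 * pi)) ^ ?n * (sqrt (2 * pi) / e) ^ ?n) * (\<integral>v. g (x + (- (e / (2 * pi))) *\<^sub>R v) * gauss v \<partial>lborel)"
    by (simp add: scaleR_conv_of_real)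
  \<comment> \<open>The Jacobian and the Gaussian normalization multiply to (2 pi)^(-n/2), the value
    of \<open>gauss\<close> at 0.\<close>
  also have "(e / (2 * pi)) ^ ?n * (sqrt (2 * pi) / e) ^ ?n = gauss (0::real^'n)"
  proof -
    have "e / (2 * pi) * (sqrt (2 * pi) / e) = sqrt (2 * pi) / (2 * pi)" using e by simp
    also have "\<dots> = 1 / sqrt (2 * pi)" using sqrt_divide_self_eq[of "2 * pi"] by (simp add: inverse_eq_divide)
    finally show ?thesis unfolding power_mult_distrib[symmetric] by (simp add: gauss_eq)
  qed
  finally show ?thesis .
qed

text \<open>Let e tend to 0 in the regularized identity. Dominated convergence gives the integral of
  the transform on one side and g x on the other, both multiplied by the value of
  \<open>gauss\<close> at 0, which is nonzero and cancels.\<close>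

lemma fourier_inversion:
  fixes g :: "real^'n \<Rightarrow> complex"
  assumes g: "g \<in> schwartz"
  shows "(\<integral>\<xi>. fourier g x \<xi> \<partial>lborel) = g x"
proof -
  note [measurable] = schwartz_measurable[OF g] fourier_measurable[OF g]
  define e where "e k = 1 / real (Suc k)" for k
  have e: "0 < e k" for k by (simp add: e_def)
  have e0: "e \<longlonglongrightarrow> 0" unfolding e_def by (rule LIMSEQ_Suc[OF lim_1_over_n])
  have cg: "(\<lambda>k. gauss (e k *\<^sub>R \<xi>)) \<longlonglongrightarrow> gauss (0 :: real^'n)" for \<xi> :: "real^'n"
  proof -
    have "isCont (gauss :: real^'n \<Rightarrow> real) (0 *\<^sub>R \<xi>)" unfolding gauss_eq[abs_def] by (intro continuous_intros) auto
    from isCont_tendsto_compose[OF this tendsto_scaleR[OF e0 tendsto_const]] show ?thesis by simp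
  qed
  have 1: "(\<lambda>k. \<integral>\<xi>. of_real (gauss (e k *\<^sub>R \<xi>)) * fourier g x \<xi> \<partial>lborel) \<longlonglongrightarrow> (\<integral>\<xi>. of_real (gauss (0::real^'n)) * fourier g x \<xi> \<partial>lborel)"
  proof (rule integral_dominated_convergence)
    show "integrable lborel (\<lambda>\<xi>. gauss (0::real^'n) * norm (fourier g x \<xi>))"
      by (intro integrable_mult_right integrable_norm integrable_fourier g)
    show "AE \<xi> in lborel. (\<lambda>k. of_real (gauss (e k *\<^sub>R \<xi>)) * fourier g x \<xi>) \<longlonglongrightarrow> of_real (gauss (0::real^'n)) * fourier g x \<xi>"
      by (intro AE_I2 tendsto_intros cg)
    show "AE \<xi> in lborel. norm (of_real (gauss (e k *\<^sub>R \<xi>)) * fourier g x \<xi>) \<le> gauss (0::real^'n) * norm (fourier g x \<xi>)" for k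
      by (intro AE_I2) (simp add: norm_mult gauss_nonneg gauss_le mult_right_mono)
  qed measurable
  obtain B where B: "\<And>x. norm (g x) \<le> B" using schwartz_bounded[OF g] by blast
  have 2: "(\<lambda>k. \<integral>v. g (x + (- (e k / (2 * pi))) *\<^sub>R v) * gauss v \<partial>lborel) \<longlonglongrightarrow> (\<integral>v. g x * gauss (v::real^'n) \<partial>lborel)"
  proof (rule integral_dominated_convergence)
    show "integrable lborel (\<lambda>v::real^'n. B * gauss v)" by (intro integrable_mult_right integrable_gauss)
    have "(\<lambda>k. g (x + (- (e k / (2 * pi))) *\<^sub>R v)) \<longlonglongrightarrow> g x" for v
    proof -
      have "(\<lambda>k. x + (- (e k / (2 * pi))) *\<^sub>R v) \<longlonglongrightarrow> x + (- (0 / (2 * pi))) *\<^sub>R v"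
        by (intro tendsto_intros e0) auto
      then have "(\<lambda>k. x + (- (e k / (2 * pi))) *\<^sub>R v) \<longlonglongrightarrow> x" by simp
      moreover have "isCont g x" using schwartz_continuous[OF g, of UNIV] by (simp add: continuous_on_eq_continuous_at)
      ultimately show ?thesis by (rule isCont_tendsto_compose[rotated])
    qed
    then show "AE v in lborel. (\<lambda>k. g (x + (- (e k / (2 * pi))) *\<^sub>R v) * of_real (gauss v)) \<longlonglongrightarrow> g x * of_real (gauss v)"
      by (intro AE_I2 tendsto_intros)
    show "AE v in lborel. norm (g (x + (- (e k / (2 * pi))) *\<^sub>R v) * of_real (gauss v)) \<le> B * gauss v" for k
      by (intro AE_I2) (simp add: norm_mult gauss_nonneg B mult_right_mono)
  qed measurable
  have *: "(\<integral>v. g x * gauss (v::real^'n) \<partial>lborel) = g x"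
  proof -
    have "(\<integral>v. g x * gauss (v::real^'n) \<partial>lborel) = g x * of_real (\<integral>v. gauss (v::real^'n) \<partial>lborel)"
      using integrable_gauss by simp
    then show ?thesis by (simp add: integral_gauss)
  qed
  have "(\<lambda>k. \<integral>\<xi>. of_real (gauss (e k *\<^sub>R \<xi>)) * fourier g x \<xi> \<partial>lborel) \<longlonglongrightarrow> of_real (gauss (0::real^'n)) * g x"
    unfolding integral_gauss_fourier[OF g e] by (rule tendsto_mult_left[OF 2[unfolded *]])
  from LIMSEQ_unique[OF this 1]
  have "of_real (gauss (0::real^'n)) * g x = of_real (gauss (0::real^'n)) * (\<integral>\<xi>. fourier g x \<xi> \<partial>lborel)"
    using integrable_fourier[OF g] by simp
  moreover have "gauss (0::real^'n) \<noteq> 0" by (simp add: gauss_eq)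
  ultimately show ?thesis by simp
qed

section \<open>The Schroedinger operator as a Weyl quantization\<close>

definition schroedinger :: "real \<Rightarrow> (real^'n \<Rightarrow> complex) \<Rightarrow> (real^'n \<Rightarrow> complex) \<Rightarrow> real^'n \<Rightarrow> complex" where
  "schroedinger \<eta> V u x = - of_real (\<eta>\<^sup>2) * laplacian u x + V x * u x"

lemma schwartz_schroedinger:
  assumes "slow_growth V" "u \<in> schwartz" shows "schroedinger \<eta> V u \<in> schwartz"
  unfolding schroedinger_def[abs_def]
  by (intro schwartz_add schwartz_scale schwartz_mult schwartz_laplacian assms)

text \<open>For fixed x the inner integral is the transform, with phase based at x, of the Schwartz
  function of y given by - \<eta>^2 times the Laplacian of u plus V((x + y)/2) u(y), where \<eta> =
  h / (2 pi). Integrating over \<xi> is then Fourier inversion at y = x, where the midpoint is x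
  itself.\<close>

lemma weyl_schroedinger:
  fixes u V :: "real^'n \<Rightarrow> complex"
  assumes V: "slow_growth V" and u: "u \<in> schwartz"
  shows "weyl h (\<lambda>x \<xi>. of_real ((norm \<xi>)\<^sup>2) + V x) u = schroedinger (h / (2 * pi)) V u"
proof
  fix x
  let ?c = "- of_real ((h / (2 * pi))\<^sup>2) :: complex"
  let ?W = "\<lambda>y. V ((1/2) *\<^sub>R x + (1/2) *\<^sub>R y)"
  have mid: "midpoint x y = (1/2) *\<^sub>R x + (1/2) *\<^sub>R y" for y
    by (simp add: midpoint_def scaleR_add_right)
  have W: "(\<lambda>y. ?W y * u y) \<in> schwartz" by (intro schwartz_mult slow_growth_affine V u)
  have L: "(\<lambda>y. ?c * laplacian u y) \<in> schwartz" by (intro schwartz_scale schwartz_laplacian u)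
  have inner: "(LINT y|lborel. exp (2 * of_real pi * \<i> * of_real ((x - y) \<bullet> \<xi>)) *
      (of_real ((norm (h *\<^sub>R \<xi>))\<^sup>2) + V (midpoint x y)) * u y) = fourier (\<lambda>y. ?c * laplacian u y + ?W y * u y) x \<xi>" for \<xi>
  proof -
    have "(LINT y|lborel. exp (2 * of_real pi * \<i> * of_real ((x - y) \<bullet> \<xi>)) *
        (of_real ((norm (h *\<^sub>R \<xi>))\<^sup>2) + V (midpoint x y)) * u y) =
        (LINT y|lborel. of_real (h\<^sup>2 * (norm \<xi>)\<^sup>2) * (wave (x - y) \<xi> * u y) + wave (x - y) \<xi> * (?W y * u y))"
      by (intro Bochner_Integration.integral_cong refl) (simp add: wave_def mid power_mult_distrib algebra_simps)
    also have "\<dots> = of_real (h\<^sup>2 * (norm \<xi>)\<^sup>2) * fourier u x \<xi> + fourier (\<lambda>y. ?W y * u y) x \<xi>"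
      unfolding fourier_def using fourier_integrable[OF u] fourier_integrable[OF W]
      by (subst Bochner_Integration.integral_add) auto
    also have "of_real (h\<^sup>2 * (norm \<xi>)\<^sup>2) * fourier u x \<xi> = fourier (\<lambda>y. ?c * laplacian u y) x \<xi>"
      unfolding fourier_scale[OF schwartz_laplacian[OF u]] fourier_laplacian[OF u]
      by (simp add: power_divide power_mult_distrib)
    finally show ?thesis unfolding fourier_add[OF L W] .
  qed
  have "weyl h (\<lambda>x \<xi>. of_real ((norm \<xi>)\<^sup>2) + V x) u x = (LINT \<xi>|lborel. fourier (\<lambda>y. ?c * laplacian u y + ?W y * u y) x \<xi>)"
    unfolding weyl_def inner ..
  also have "\<dots> = ?c * laplacian u x + ?W x * u x"
    by (rule fourier_inversion[OF schwartz_add[OF L W]])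
  also have "?W x = V x" by (simp add: scaleR_add_left[symmetric])
  finally show "weyl h (\<lambda>x \<xi>. of_real ((norm \<xi>)\<^sup>2) + V x) u x = schroedinger (h / (2 * pi)) V u x"
    by (simp add: schroedinger_def)
qed

section \<open>Mollification\<close>

lemma L2_compact_support:
  fixes f :: "real^'n \<Rightarrow> complex"
  assumes "continuous_on UNIV f" "\<And>x. norm x > R \<Longrightarrow> f x = 0"
  shows "f \<in> L2"
proof -
  have "integrable lborel (\<lambda>x. (norm (f x))\<^sup>2)"
    by (rule integrable_compact_support[where R = R]) (auto intro!: continuous_intros assms simp: assms(2))
  then show ?thesis
    using borel_measurable_continuous_onI[OF assms(1)] by (simp add: L2_def)
qed

lemma L2_indicator:
  assumes "B \<in> sets borel" "bounded B"
  shows "(\<lambda>x. of_real (c * indicator B x)) \<in> L2"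
proof -
  have fin: "emeasure lborel B < \<infinity>" using emeasure_bounded_finite[OF assms(2)] by simp
  have "integrable lborel (\<lambda>x. c\<^sup>2 * indicat_real B x)"
    using assms(1) fin by (intro integrable_mult_right) (simp add: integrable_indicator_iff)
  moreover have "(norm (complex_of_real (c * indicator B x)))\<^sup>2 = c\<^sup>2 * indicat_real B x" for x
    by (simp add: indicator_def)
  ultimately show ?thesis using assms(1) by (simp add: L2_def)
qed

lemma test_function_bounds:
  assumes "\<psi> \<in> test_function"
  obtains R C where "0 \<le> R" "0 \<le> C" "\<And>x. norm x > R \<Longrightarrow> \<psi> x = 0" "\<And>x. norm (\<psi> x) \<le> C"
proof -
  obtain R where R: "\<And>x. norm x > R \<Longrightarrow> \<psi> x = 0" using assms by (auto simp: test_function_iff)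
  obtain C where C: "0 \<le> C" "\<And>x. norm (\<psi> x) \<le> C"
    using bounded_range_D[OF bounded_compact_support[OF smooth_continuous[OF test_function_smooth[OF assms]] R]] by blast
  show thesis by (rule that[of "max R 0" C]) (use R C in auto)
qed

lemma test_function_continuous: "\<psi> \<in> test_function \<Longrightarrow> continuous_on S \<psi>"
  by (simp add: smooth_continuous test_function_smooth)

lemma test_function_L2: "\<psi> \<in> test_function \<Longrightarrow> \<psi> \<in> L2"
  by (simp add: schwartz_L2 test_function_schwartz)

lemma partials_reflect:
  "smooth \<psi> \<Longrightarrow> partials \<alpha> (\<lambda>y. \<psi> (x - y)) y = (-1) ^ length \<alpha> *\<^sub>R partials \<alpha> \<psi> (x - y)"
  using partials_affine[of \<psi> \<alpha> x "-1"] by simp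

lemma test_function_reflect:
  assumes "\<psi> \<in> test_function" shows "(\<lambda>y. \<psi> (x - y)) \<in> test_function"
proof -
  obtain R where R: "\<And>x. norm x > R \<Longrightarrow> \<psi> x = 0" using assms by (auto simp: test_function_iff)
  have "\<psi> (x - y) = 0" if "norm y > R + norm x" for y
    by (rule R) (use that norm_triangle_ineq2[of y x] in \<open>simp add: norm_minus_commute\<close>)
  then show ?thesis
    using smooth_affine[OF test_function_smooth[OF assms], of x "-1"] by (auto simp: test_function_iff)
qed

text \<open>Each of the two derivatives contributes a sign -1, and the signs cancel.\<close>

lemma laplacian_reflect:
  assumes "smooth \<psi>" shows "laplacian (\<lambda>y. \<psi> (x - y)) y = laplacian \<psi> (x - y)"
  using partials_reflect[OF assms, of "[i, i]" x y for i] by (simp add: laplacian_def)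

definition conv :: "(real^'n \<Rightarrow> complex) \<Rightarrow> (real^'n \<Rightarrow> complex) \<Rightarrow> real^'n \<Rightarrow> complex" where
  "conv \<psi> u x = (LINT y|lborel. \<psi> (x - y) * u y)"

lemma conv_integrable:
  "\<psi> \<in> test_function \<Longrightarrow> u \<in> L2 \<Longrightarrow> integrable lborel (\<lambda>y. \<psi> (x - y) * u y)"
  by (rule L2_integrable_mult[OF test_function_L2[OF test_function_reflect]])

text \<open>The kernels are bounded by a multiple of the indicator of one ball, so the dominating
  function is a product of two elements of \<open>L2\<close>. Both continuity and differentiability
  of convolutions rest on it.\<close>

lemma L2_dominated:
  fixes K :: "nat \<Rightarrow> real^'n \<Rightarrow> complex"
  assumes u: "u \<in> L2" and [measurable]: "\<And>k. K k \<in> borel_measurable borel" "L \<in> borel_measurable borel"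
    and lim: "\<And>y. (\<lambda>k. K k y) \<longlonglongrightarrow> L y"
    and bound: "\<And>k y. norm (K k y) \<le> C * indicator (cball x R) y"
  shows "(\<lambda>k. LINT y|lborel. K k y * u y) \<longlonglongrightarrow> (LINT y|lborel. L y * u y)"
proof (rule integral_dominated_convergence)
  note [measurable] = L2_measurable[OF u]
  show "(\<lambda>y. L y * u y) \<in> borel_measurable lborel" "\<And>k. (\<lambda>y. K k y * u y) \<in> borel_measurable lborel"
    by measurable
  show "integrable lborel (\<lambda>y. norm (complex_of_real (C * indicator (cball x R) y) * u y))"
    by (intro integrable_norm L2_integrable_mult L2_indicator u) auto
  show "AE y in lborel. (\<lambda>k. K k y * u y) \<longlonglongrightarrow> L y * u y"
    by (intro AE_I2 tendsto_mult lim tendsto_const)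
  have "norm (K k y * u y) \<le> norm (complex_of_real (C * indicator (cball x R) y) * u y)" for k y
  proof -
    have "norm (K k y) \<le> \<bar>C * indicator (cball x R) y\<bar>" using bound[of k y] by linarith
    then show ?thesis unfolding norm_mult norm_of_real by (intro mult_right_mono) auto
  qed
  then show "AE y in lborel. norm (K k y * u y) \<le> norm (complex_of_real (C * indicator (cball x R) y) * u y)" for k
    by (intro AE_I2)
qed

lemma reflect_measurable: "\<psi> \<in> test_function \<Longrightarrow> (\<lambda>y. \<psi> (x - y)) \<in> borel_measurable borel"
  by (intro borel_measurable_continuous_onI test_function_continuous test_function_reflect)

lemma conv_continuous:
  assumes \<psi>: "\<psi> \<in> test_function" and u: "u \<in> L2"
  shows "continuous_on UNIV (conv \<psi> u)"
proof (rule continuous_at_imp_continuous_on, rule ballI, rule continuous_at_sequentiallyI)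
  fix x and X :: "nat \<Rightarrow> real^'a" assume X: "X \<longlonglongrightarrow> x"
  obtain R C where \<psi>R: "0 \<le> R" "0 \<le> C" "\<And>x. norm x > R \<Longrightarrow> \<psi> x = 0" "\<And>x. norm (\<psi> x) \<le> C"
    using test_function_bounds[OF \<psi>] by blast
  obtain B where B: "\<And>k. norm (X k) \<le> B"
    using convergent_imp_bounded[OF X] unfolding bounded_iff by blast
  show "(\<lambda>k. conv \<psi> u (X k)) \<longlonglongrightarrow> conv \<psi> u x"
    unfolding conv_def
  proof (rule L2_dominated[OF u, where C = C and x = 0 and R = "B + R"])
    show "(\<lambda>k. \<psi> (X k - y)) \<longlonglongrightarrow> \<psi> (x - y)" for y
    proof -
      have "isCont \<psi> (x - y)"
        using test_function_continuous[OF \<psi>, of UNIV] by (simp add: continuous_on_eq_continuous_at)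
      moreover have "(\<lambda>k. X k - y) \<longlonglongrightarrow> x - y" by (intro tendsto_intros X)
      ultimately show ?thesis by (rule isCont_tendsto_compose)
    qed
    show "norm (\<psi> (X k - y)) \<le> C * indicator (cball 0 (B + R)) y" for k y
    proof (cases "norm y \<le> B + R")
      case False
      then have "norm (X k - y) > R"
        using B[of k] norm_triangle_ineq2[of y "X k"] by (simp add: norm_minus_commute)
      then show ?thesis using \<psi>R by simp
    qed (use \<psi>R in simp)
  qed (use \<psi> in \<open>auto intro: reflect_measurable\<close>)
qed

text \<open>The mean value inequality along a line bounds difference quotients uniformly, which
  supplies the dominating kernel for differentiation under the integral.\<close>

lemma has_partial_lipschitz:
  assumes f: "\<And>x. has_partial f i x (g x)" and g: "\<And>x. norm (g x) \<le> C"
  shows "norm (f (x + t *\<^sub>R axis i 1) - f x) \<le> C * \<bar>t\<bar>"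
proof -
  have C: "0 \<le> C" using order_trans[OF norm_ge_zero g] .
  have "norm (f (x + t *\<^sub>R axis i 1) - f (x + 0 *\<^sub>R axis i 1)) \<le> C * norm (t - 0)"
  proof (rule differentiable_bound[of UNIV _ "\<lambda>s h. h *\<^sub>R g (x + s *\<^sub>R axis i 1)"])
    show "((\<lambda>t. f (x + t *\<^sub>R axis i 1)) has_derivative (\<lambda>h. h *\<^sub>R g (x + s *\<^sub>R axis i 1))) (at s within UNIV)" for s
      using has_partial_line[OF f] by (simp add: has_vector_derivative_def)
    show "onorm (\<lambda>h. h *\<^sub>R g (x + s *\<^sub>R axis i 1)) \<le> C" for s
    proof (rule onorm_bound[OF C])
      fix h :: real
      show "norm (h *\<^sub>R g (x + s *\<^sub>R axis i 1)) \<le> C * norm h"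
        using mult_right_mono[OF g[of "x + s *\<^sub>R axis i 1"], of "\<bar>h\<bar>"] by (simp add: mult.commute)
    qed
  qed auto
  then show ?thesis by simp
qed

text \<open>A sequential criterion, matching the sequential form of dominated convergence.\<close>

lemma has_partial_sequentially:
  assumes "\<And>T. (\<And>k. T k \<noteq> 0) \<Longrightarrow> T \<longlonglongrightarrow> 0 \<Longrightarrow> (\<lambda>k. (f (x + T k *\<^sub>R axis i 1) - f x) /\<^sub>R T k) \<longlonglongrightarrow> d"
  shows "has_partial f i x d"
proof -
  let ?g = "\<lambda>t. f (x + t *\<^sub>R axis i 1)"
  have "((\<lambda>h. norm (?g (0 + h) - ?g 0 - h *\<^sub>R d) / norm h) \<longlongrightarrow> 0) (at 0)"
    unfolding tendsto_at_iff_sequentially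
  proof (intro allI impI)
    fix T :: "nat \<Rightarrow> real" assume T: "\<forall>k. T k \<in> UNIV - {0}" and T0: "T \<longlonglongrightarrow> 0"
    then have nz: "T k \<noteq> 0" for k by auto
    have "(\<lambda>k. norm ((f (x + T k *\<^sub>R axis i 1) - f x) /\<^sub>R T k - d)) \<longlonglongrightarrow> 0"
      using assms[OF nz T0] by (simp add: tendsto_norm_zero_iff LIM_zero_iff)
    moreover have "norm ((f (x + T k *\<^sub>R axis i 1) - f x) /\<^sub>R T k - d) = norm (?g (0 + T k) - ?g 0 - T k *\<^sub>R d) / norm (T k)" for k
    proof -
      have "(f (x + T k *\<^sub>R axis i 1) - f x) /\<^sub>R T k - d = (?g (0 + T k) - ?g 0 - T k *\<^sub>R d) /\<^sub>R T k"
        using nz[of k] by (simp add: scaleR_diff_right)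
      then show ?thesis by (simp add: divide_inverse mult.commute)
    qed
    ultimately show "((\<lambda>h. norm (?g (0 + h) - ?g 0 - h *\<^sub>R d) / norm h) \<circ> T) \<longlonglongrightarrow> 0" by (simp add: o_def)
  qed
  then show ?thesis
    unfolding has_partial_def has_vector_derivative_def has_derivative_at
    using bounded_linear_scaleR_left by blast
qed

text \<open>The derivative falls on the smooth kernel, so u need only be square integrable. The
  difference quotients converge pointwise and are dominated by the mean value bound on one ball
  containing the supports for all shifts \<open>T k\<close>, which are bounded.\<close>

lemma has_partial_conv:
  assumes \<psi>: "\<psi> \<in> test_function" and u: "u \<in> L2"
  shows "has_partial (conv \<psi> u) i x (conv (partial i \<psi>) u x)"
proof (rule has_partial_sequentially)
  fix T :: "nat \<Rightarrow> real" assume nz: "\<And>k. T k \<noteq> 0" and T: "T \<longlonglongrightarrow> 0"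
  let ?e = "axis i 1 :: real^'a"
  have hp: "has_partial \<psi> i z (partial i \<psi> z)" for z
    by (rule smooth_has_partial[OF test_function_smooth[OF \<psi>]])
  obtain R C0 where R: "\<And>x. norm x > R \<Longrightarrow> \<psi> x = 0" by (rule test_function_bounds[OF \<psi>]) blast
  obtain R' C where C: "0 \<le> C" "\<And>x. norm (partial i \<psi> x) \<le> C"
    by (rule test_function_bounds[OF test_function_partial[OF \<psi>, of i]]) blast
  obtain B where B: "\<And>k. norm (T k) \<le> B"
    using convergent_imp_bounded[OF T] unfolding bounded_iff by blast
  have B0: "0 \<le> B" by (rule order_trans[OF norm_ge_zero B])
  have l: "(\<lambda>k. LINT y|lborel. (\<psi> (x + T k *\<^sub>R ?e - y) - \<psi> (x - y)) /\<^sub>R T k * u y) \<longlonglongrightarrow> (LINT y|lborel. partial i \<psi> (x - y) * u y)"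
  proof (rule L2_dominated[OF u, where C = C and x = 0 and R = "norm x + B + R"])
    show "(\<lambda>y. (\<psi> (x + T k *\<^sub>R ?e - y) - \<psi> (x - y)) /\<^sub>R T k) \<in> borel_measurable borel" for k
      by (intro borel_measurable_scaleR borel_measurable_diff borel_measurable_const reflect_measurable \<psi>)
    show "(\<lambda>y. partial i \<psi> (x - y)) \<in> borel_measurable borel"
      by (intro reflect_measurable test_function_partial \<psi>)
    show "(\<lambda>k. (\<psi> (x + T k *\<^sub>R ?e - y) - \<psi> (x - y)) /\<^sub>R T k) \<longlonglongrightarrow> partial i \<psi> (x - y)" for y
    proof -
      let ?g = "\<lambda>t. \<psi> ((x - y) + t *\<^sub>R ?e)" and ?d = "partial i \<psi> (x - y)"
      have "((\<lambda>h. norm (?g (0 + h) - ?g 0 - h *\<^sub>R ?d) / norm h) \<longlongrightarrow> 0) (at 0)"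
        using hp[of "x - y"] unfolding has_partial_def has_vector_derivative_def has_derivative_at by blast
      then have lim: "(\<lambda>k. norm (?g (0 + T k) - ?g 0 - T k *\<^sub>R ?d) / norm (T k)) \<longlonglongrightarrow> 0"
        using nz T unfolding tendsto_at_iff_sequentially o_def by auto
      have "norm (?g (0 + T k) - ?g 0 - T k *\<^sub>R ?d) / norm (T k) = norm ((\<psi> (x + T k *\<^sub>R ?e - y) - \<psi> (x - y)) /\<^sub>R T k - ?d)" for k
      proof -
        have "(\<psi> (x + T k *\<^sub>R ?e - y) - \<psi> (x - y)) /\<^sub>R T k - ?d = (?g (0 + T k) - ?g 0 - T k *\<^sub>R ?d) /\<^sub>R T k"
          using nz[of k] by (simp add: scaleR_diff_right add_diff_eq diff_add_eq)
        then show ?thesis by (simp add: divide_inverse mult.commute)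
      qed
      with lim have "(\<lambda>k. norm ((\<psi> (x + T k *\<^sub>R ?e - y) - \<psi> (x - y)) /\<^sub>R T k - ?d)) \<longlonglongrightarrow> 0" by simp
      then have "(\<lambda>k. (\<psi> (x + T k *\<^sub>R ?e - y) - \<psi> (x - y)) /\<^sub>R T k - ?d) \<longlonglongrightarrow> 0" by (simp only: tendsto_norm_zero_iff)
      then show ?thesis by (simp only: LIM_zero_iff)
    qed
    show "norm ((\<psi> (x + T k *\<^sub>R ?e - y) - \<psi> (x - y)) /\<^sub>R T k) \<le> C * indicator (cball 0 (norm x + B + R)) y" for k y
    proof (cases "norm y \<le> norm x + B + R")
      case True
      have "norm (\<psi> ((x - y) + T k *\<^sub>R ?e) - \<psi> (x - y)) \<le> C * \<bar>T k\<bar>"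
        by (rule has_partial_lipschitz[OF hp C(2)])
      then have "norm (\<psi> (x + T k *\<^sub>R ?e - y) - \<psi> (x - y)) / \<bar>T k\<bar> \<le> C"
        using nz[of k] by (simp add: field_simps)
      then show ?thesis using True by (simp add: divide_inverse mult.commute)
    next
      case False
      have "norm (x + T k *\<^sub>R ?e) \<le> norm x + B"
        using norm_triangle_ineq[of x "T k *\<^sub>R ?e"] B[of k] by (simp add: norm_axis_1)
      then have "norm (x + T k *\<^sub>R ?e - y) > R" "norm (x - y) > R"
        using False B0 norm_triangle_ineq2[of y "x + T k *\<^sub>R ?e"] norm_triangle_ineq2[of y x]
        by (simp_all add: norm_minus_commute)
      then show ?thesis using R False by simp
    qed
  qed
  have q: "(LINT y|lborel. (\<psi> (x + T k *\<^sub>R ?e - y) - \<psi> (x - y)) /\<^sub>R T k * u y) = (conv \<psi> u (x + T k *\<^sub>R ?e) - conv \<psi> u x) /\<^sub>R T k" for k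
  proof -
    have "(LINT y|lborel. (\<psi> (x + T k *\<^sub>R ?e - y) - \<psi> (x - y)) /\<^sub>R T k * u y) =
        (LINT y|lborel. (\<psi> (x + T k *\<^sub>R ?e - y) * u y - \<psi> (x - y) * u y) /\<^sub>R T k)"
      by (simp add: left_diff_distrib)
    also have "\<dots> = (conv \<psi> u (x + T k *\<^sub>R ?e) - conv \<psi> u x) /\<^sub>R T k"
      unfolding conv_def using conv_integrable[OF \<psi> u] by simp
    finally show ?thesis .
  qed
  show "(\<lambda>k. (conv \<psi> u (x + T k *\<^sub>R ?e) - conv \<psi> u x) /\<^sub>R T k) \<longlonglongrightarrow> conv (partial i \<psi>) u x"
    using l unfolding q conv_def[of "partial i \<psi>" u x, symmetric] .
qed

section \<open>Mollifiers and their action on \<open>L2\<close>\<close>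

definition bump :: "real^'n \<Rightarrow> real" where
  "bump x = flat_exp 0 (1 - (norm x)\<^sup>2)"

definition mollifier :: "real \<Rightarrow> real^'n \<Rightarrow> real" where
  "mollifier e x = bump ((1 / e) *\<^sub>R x) / (e ^ CARD('n) * integral\<^sup>L lborel (bump :: real^'n \<Rightarrow> real))"

lemma smooth_bump: "smooth bump"
  unfolding bump_def[abs_def] by (rule smooth_flat_exp_norm)

lemma bump_nonneg: "0 \<le> bump x" and bump_le_1: "bump x \<le> 1"
  by (simp_all add: bump_def flat_exp_def)

lemma bump_eq_0: "1 \<le> norm x \<Longrightarrow> bump x = 0"
  using power_mono[of 1 "norm x" 2] by (simp add: bump_def flat_exp_def)

text \<open>For |x| \<le> 1/2 one has 1 - |x|^2 \<ge> 3/4, whence the exponent 4/3. The bound makes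
  the integral of the bump positive and later keeps the cutoff away from 0 on a given box.\<close>

lemma bump_ge:
  assumes "norm x \<le> 1/2" shows "exp (- (4/3)) \<le> bump x"
proof -
  have "(norm x)\<^sup>2 \<le> (1/2)\<^sup>2" using assms by (intro power_mono) auto
  then have *: "3/4 \<le> 1 - (norm x)\<^sup>2" by (simp add: power2_eq_square)
  then have "1 / (1 - (norm x)\<^sup>2) \<le> 4/3" by (simp add: field_simps)
  then show ?thesis using * by (simp add: bump_def flat_exp_def)
qed

lemma bump_continuous: "continuous_on S bump"
  by (rule smooth_continuous[OF smooth_bump])

lemma integrable_bump: "integrable lborel bump"
  by (rule integrable_compact_support[of bump 1]) (auto simp: bump_continuous bump_eq_0)

text \<open>A vanishing integral would force the bump to be 0 almost everywhere, but it is bounded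
  below on a nonempty open ball.\<close>

lemma integral_bump_pos: "0 < integral\<^sup>L lborel (bump :: real^'n \<Rightarrow> real)"
proof -
  have nn: "0 \<le> integral\<^sup>L lborel (bump :: real^'n \<Rightarrow> real)" by (simp add: bump_nonneg)
  have "integral\<^sup>L lborel (bump :: real^'n \<Rightarrow> real) \<noteq> 0"
  proof
    assume "integral\<^sup>L lborel (bump :: real^'n \<Rightarrow> real) = 0"
    then have "AE x::real^'n in lborel. bump x = 0"
      using integral_nonneg_eq_0_iff_AE[OF integrable_bump] bump_nonneg by blast
    then have "AE x::real^'n in lborel. x \<notin> ball 0 (1/2)"
    proof (rule AE_mp, intro AE_I2 impI)
      fix x :: "real^'n" assume "bump x = 0"
      then show "x \<notin> ball 0 (1/2)"
        using bump_ge[of x] exp_gt_zero[of "- (4/3)"] by (auto simp del: exp_gt_zero)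
    qed
    then have "ball (0::real^'n) (1/2) \<in> null_sets lborel"
      by (subst AE_iff_null_sets) auto
    then have "negligible (ball (0::real^'n) (1/2))"
      by (simp add: negligible_iff_null_sets null_sets_completionI)
    then show False using open_not_negligible[of "ball (0::real^'n) (1/2)"] by auto
  qed
  with nn show ?thesis by simp
qed

lemma mollifier_nonneg: "0 < e \<Longrightarrow> 0 \<le> mollifier e x"
  unfolding mollifier_def using integral_bump_pos by (intro divide_nonneg_nonneg bump_nonneg mult_nonneg_nonneg) (auto intro: less_imp_le)

lemma mollifier_eq_0: "0 < e \<Longrightarrow> e \<le> norm x \<Longrightarrow> mollifier e x = 0"
  unfolding mollifier_def by (subst bump_eq_0) auto

lemma test_function_mollifier:
  assumes "0 < e" shows "(\<lambda>x. complex_of_real (mollifier e x)) \<in> test_function"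
proof -
  have "smooth (\<lambda>x::real^'a. bump (0 + (1 / e) *\<^sub>R x))" by (rule smooth_affine[OF smooth_bump])
  then have "smooth (\<lambda>x::real^'a. complex_of_real (bump ((1 / e) *\<^sub>R x) * (1 / (e ^ CARD('a) * integral\<^sup>L lborel (bump :: real^'a \<Rightarrow> real)))))"
    by (intro smooth_linear[OF bounded_linear_of_real] smooth_mult smooth_const) simp
  moreover have "\<exists>R. \<forall>x::real^'a. norm x > R \<longrightarrow> complex_of_real (mollifier e x) = 0"
    by (intro exI[of _ e]) (simp add: mollifier_eq_0[OF assms])
  ultimately show ?thesis by (simp add: test_function_iff mollifier_def)
qed

lemma mollifier_measurable:
  assumes "0 < e" shows "mollifier e \<in> borel_measurable borel"
proof -
  have [measurable]: "(\<lambda>x. complex_of_real (mollifier e x)) \<in> borel_measurable borel"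
    by (rule borel_measurable_continuous_onI[OF test_function_continuous[OF test_function_mollifier[OF assms]]])
  have "(\<lambda>x. Re (complex_of_real (mollifier e x))) \<in> borel_measurable borel" by measurable
  then show ?thesis by simp
qed

lemma
  assumes e: "0 < e"
  shows integrable_mollifier: "integrable lborel (mollifier e :: real^'n \<Rightarrow> real)"
    and integral_mollifier: "integral\<^sup>L lborel (mollifier e :: real^'n \<Rightarrow> real) = 1"
proof -
  have int: "integrable lborel (\<lambda>x::real^'n. bump (0 + (1/e) *\<^sub>R x))"
    using e by (intro integrable_affine integrable_bump) auto
  then show "integrable lborel (mollifier e :: real^'n \<Rightarrow> real)"
    unfolding mollifier_def[abs_def] by simp
  have "integral\<^sup>L lborel (bump :: real^'n \<Rightarrow> real) = \<bar>1/e\<bar> ^ DIM(real^'n) *\<^sub>R (\<integral>x. bump (0 + (1/e) *\<^sub>R (x::real^'n)) \<partial>lborel)"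
    using e by (intro integral_affine integrable_bump) auto
  then have "(\<integral>x. bump ((1/e) *\<^sub>R (x::real^'n)) \<partial>lborel) = e ^ CARD('n) * integral\<^sup>L lborel (bump :: real^'n \<Rightarrow> real)"
    using e by (simp add: power_divide)
  then show "integral\<^sup>L lborel (mollifier e :: real^'n \<Rightarrow> real) = 1"
    unfolding mollifier_def[abs_def] using e integral_bump_pos[where 'n = 'n] by simp
qed

lemma integral_mollifier_reflect:
  fixes x :: "real^'n"
  assumes "0 < e"
  shows "integrable lborel (\<lambda>y. mollifier e (x - y))" "(\<integral>y. mollifier e (x - y) \<partial>lborel) = 1"
  using integrable_affine[OF _ integrable_mollifier[OF assms], of "-1" x]
    integral_affine[OF _ integrable_mollifier[OF assms, where 'n = 'n], of "-1" x] integral_mollifier[OF assms, where 'n = 'n]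
  by simp_all

lemma integral_mollifier_shift:
  fixes y :: "real^'n"
  assumes "0 < e"
  shows "integrable lborel (\<lambda>x. mollifier e (x - y))" "(\<integral>x. mollifier e (x - y) \<partial>lborel) = 1"
  using integrable_translate[OF integrable_mollifier[OF assms], of "- y"]
    integral_translate[OF integrable_mollifier[OF assms, where 'n = 'n], of "- y"] integral_mollifier[OF assms, where 'n = 'n]
  by simp_all

text \<open>The mollification of |u|. It dominates the mollification of u pointwise and, up to the
  oscillation of V, the commutator of V with mollification, while its \<open>L2\<close> norm does
  not exceed that of u.\<close>

definition mollify_abs :: "real \<Rightarrow> (real^'n \<Rightarrow> complex) \<Rightarrow> real^'n \<Rightarrow> real" where
  "mollify_abs e u x = (LINT y|lborel. mollifier e (x - y) * norm (u y))"

abbreviation mollify :: "real \<Rightarrow> (real^'n \<Rightarrow> complex) \<Rightarrow> real^'n \<Rightarrow> complex" where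
  "mollify e u \<equiv> conv (\<lambda>x. complex_of_real (mollifier e x)) u"

lemma mollify_abs_integrable:
  assumes e: "0 < e" and u: "u \<in> L2"
  shows "integrable lborel (\<lambda>y. mollifier e (x - y) * norm (u y))"
  using integrable_norm[OF conv_integrable[OF test_function_mollifier[OF e] u], of x]
  by (simp add: norm_mult mollifier_nonneg[OF e])

lemma mollify_abs_nonneg: "0 < e \<Longrightarrow> 0 \<le> mollify_abs e u x"
  unfolding mollify_abs_def by (intro Bochner_Integration.integral_nonneg mult_nonneg_nonneg mollifier_nonneg) auto

lemma norm_mollify_le:
  assumes e: "0 < e"
  shows "norm (mollify e u x) \<le> mollify_abs e u x"
  unfolding conv_def mollify_abs_def
  using integral_norm_bound[of lborel "\<lambda>y. complex_of_real (mollifier e (x - y)) * u y"]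
  by (simp add: norm_mult mollifier_nonneg[OF e])

text \<open>Young's inequality for a kernel of mass 1: split the kernel into two square roots, apply
  Cauchy-Schwarz in y, and exchange the integrals; the mass of the kernel in x is again 1.\<close>

lemma mollify_abs_L2:
  fixes u :: "real^'n \<Rightarrow> complex"
  assumes e: "0 < e" and u: "u \<in> L2"
  shows "integrable lborel (\<lambda>x. (mollify_abs e u x)\<^sup>2)" "(\<integral>x. (mollify_abs e u x)\<^sup>2 \<partial>lborel) \<le> (L2_norm u)\<^sup>2"
proof -
  note [measurable] = L2_measurable[OF u] mollifier_measurable[OF e]
  let ?U = "mollify_abs e u"
  have U_meas: "?U \<in> borel_measurable borel"
  proof -
    have "(\<lambda>x. LINT y|lborel. mollifier e (x - y) * norm (u y)) \<in> borel_measurable lborel"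
      by (rule lborel.borel_measurable_lebesgue_integral) measurable
    then show ?thesis by (simp add: mollify_abs_def[abs_def])
  qed
  have le: "ennreal ((?U x)\<^sup>2) \<le> (\<integral>\<^sup>+y. ennreal (mollifier e (x - y) * (norm (u y))\<^sup>2) \<partial>lborel)" for x
  proof -
    obtain R C where C: "\<And>x::real^'n. norm (complex_of_real (mollifier e x)) \<le> C"
      by (rule test_function_bounds[OF test_function_mollifier[OF e]]) blast
    let ?f = "\<lambda>y. sqrt (mollifier e (x - y))" and ?g = "\<lambda>y. sqrt (mollifier e (x - y)) * norm (u y)"
    have f2: "(?f y)\<^sup>2 = mollifier e (x - y)" for y by (simp add: mollifier_nonneg[OF e])
    have g2: "(?g y)\<^sup>2 = mollifier e (x - y) * (norm (u y))\<^sup>2" for y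
      by (simp add: power_mult_distrib mollifier_nonneg[OF e])
    have fg: "?f y * ?g y = mollifier e (x - y) * norm (u y)" for y
      using mollifier_nonneg[OF e, of "x - y"] by (simp flip: mult.assoc)
    have intg: "integrable lborel (\<lambda>y. mollifier e (x - y) * (norm (u y))\<^sup>2)"
    proof (rule Bochner_Integration.integrable_bound)
      show "integrable lborel (\<lambda>y. C * (norm (u y))\<^sup>2)" by (intro integrable_mult_right L2_integrable u)
      have "norm (mollifier e (x - y) * (norm (u y))\<^sup>2) \<le> norm (C * (norm (u y))\<^sup>2)" for y
      proof -
        have "\<bar>mollifier e (x - y)\<bar> \<le> \<bar>C\<bar>" using C[of "x - y"] by simp
        then show ?thesis by (simp add: abs_mult mult_right_mono)
      qed
      then show "AE y in lborel. norm (mollifier e (x - y) * (norm (u y))\<^sup>2) \<le> norm (C * (norm (u y))\<^sup>2)" by (rule AE_I2)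
    qed measurable
    have "(\<integral>y. ?f y * ?g y \<partial>lborel) \<le> sqrt (\<integral>y. (?f y)\<^sup>2 \<partial>lborel) * sqrt (\<integral>y. (?g y)\<^sup>2 \<partial>lborel)"
      unfolding f2 g2 fg
      using integral_Cauchy_Schwarz[of lborel ?f ?g, unfolded f2 g2 fg]
        integral_mollifier_reflect(1)[OF e] intg mollify_abs_integrable[OF e u] by blast
    then have "?U x \<le> sqrt (\<integral>y. mollifier e (x - y) * (norm (u y))\<^sup>2 \<partial>lborel)"
      unfolding f2 g2 fg integral_mollifier_reflect(2)[OF e] by (simp add: mollify_abs_def)
    then have "(?U x)\<^sup>2 \<le> (sqrt (\<integral>y. mollifier e (x - y) * (norm (u y))\<^sup>2 \<partial>lborel))\<^sup>2"
      by (intro power_mono mollify_abs_nonneg e)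
    also have "\<dots> = (\<integral>y. mollifier e (x - y) * (norm (u y))\<^sup>2 \<partial>lborel)"
      by (simp add: mollifier_nonneg[OF e])
    finally have "ennreal ((?U x)\<^sup>2) \<le> ennreal (\<integral>y. mollifier e (x - y) * (norm (u y))\<^sup>2 \<partial>lborel)" by (rule ennreal_leI)
    also have "\<dots> = (\<integral>\<^sup>+y. ennreal (mollifier e (x - y) * (norm (u y))\<^sup>2) \<partial>lborel)"
      using intg by (intro nn_integral_eq_integral[symmetric]) (auto simp: mollifier_nonneg[OF e])
    finally show ?thesis .
  qed
  have "(\<integral>\<^sup>+x. ennreal ((norm (complex_of_real (?U x)))\<^sup>2) \<partial>lborel) \<le> (\<integral>\<^sup>+x. (\<integral>\<^sup>+y. ennreal (mollifier e (x - y) * (norm (u y))\<^sup>2) \<partial>lborel) \<partial>lborel)"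
    using le by (intro nn_integral_mono) simp
  also have "\<dots> = (\<integral>\<^sup>+y. (\<integral>\<^sup>+x. ennreal (mollifier e (x - y) * (norm (u y))\<^sup>2) \<partial>lborel) \<partial>lborel)"
    by (rule lborel_pair.Fubini'[symmetric]) measurable
  also have "\<dots> = (\<integral>\<^sup>+y. ennreal ((norm (u y))\<^sup>2) \<partial>lborel)"
  proof (rule nn_integral_cong)
    fix y
    have "(\<integral>\<^sup>+x. ennreal (mollifier e (x - y) * (norm (u y))\<^sup>2) \<partial>lborel) = (\<integral>\<^sup>+x. ennreal (mollifier e (x - y)) \<partial>lborel) * ennreal ((norm (u y))\<^sup>2)"
      by (simp add: ennreal_mult mollifier_nonneg[OF e] nn_integral_multc)
    also have "(\<integral>\<^sup>+x. ennreal (mollifier e (x - y)) \<partial>lborel) = 1"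
      using integral_mollifier_shift[OF e, of y] by (subst nn_integral_eq_integral) (auto simp: mollifier_nonneg[OF e])
    finally show "(\<integral>\<^sup>+x. ennreal (mollifier e (x - y) * (norm (u y))\<^sup>2) \<partial>lborel) = ennreal ((norm (u y))\<^sup>2)" by simp
  qed
  also have "\<dots> = ennreal ((L2_norm u)\<^sup>2)" by (rule L2_nn_integral[OF u])
  finally have *: "(\<integral>\<^sup>+x. ennreal ((norm (complex_of_real (?U x)))\<^sup>2) \<partial>lborel) \<le> ennreal ((L2_norm u)\<^sup>2)" .
  have "(\<lambda>x. complex_of_real (?U x)) \<in> borel_measurable borel" using U_meas by measurable
  note L = L2_I_nn_integral[OF this * L2_norm_nonneg]
  show "integrable lborel (\<lambda>x. (?U x)\<^sup>2)" using L2_integrable[OF L(1)] by simp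
  have "(L2_norm (\<lambda>x. complex_of_real (?U x)))\<^sup>2 \<le> (L2_norm u)\<^sup>2"
    by (rule power_mono[OF L(2) L2_norm_nonneg])
  then show "(\<integral>x. (?U x)\<^sup>2 \<partial>lborel) \<le> (L2_norm u)\<^sup>2"
    unfolding L2_norm_power2[of "\<lambda>x. complex_of_real (?U x)"] by simp
qed

section \<open>The fundamental lemma of the calculus of variations\<close>

text \<open>Since \<open>ennreal\<close> sends negative numbers to 0, the two densities are the
  positive and the negative part of f. The measures they define are finite and equal on boxes, and
  boxes form an intersection-stable generator of the Borel sets, so the measures and hence the
  densities coincide. A number whose positive and negative parts agree is 0.\<close>

lemma AE_zero_if_box_integrals_zero:
  fixes f :: "'a::euclidean_space \<Rightarrow> real"
  assumes [measurable]: "f \<in> borel_measurable borel"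
    and int: "\<And>a b. integrable lborel (\<lambda>x. indicator (box a b) x * f x)"
    and zero: "\<And>a b. (\<integral>x. indicator (box a b) x * f x \<partial>lborel) = 0"
  shows "AE x in lborel. f x = 0"
proof -
  let ?P = "density lborel (\<lambda>x. ennreal (f x))" and ?N = "density lborel (\<lambda>x. ennreal (- f x))"
  have P: "emeasure ?P (box a b) = (\<integral>\<^sup>+x. ennreal (indicator (box a b) x * f x) \<partial>lborel)"
    and N: "emeasure ?N (box a b) = (\<integral>\<^sup>+x. ennreal (- (indicator (box a b) x * f x)) \<partial>lborel)" for a b
    by (auto simp: emeasure_density intro!: nn_integral_cong split: split_indicator)
  have fin: "(\<integral>\<^sup>+x. ennreal (indicator (box a b) x * f x) \<partial>lborel) \<noteq> \<infinity>"
    "(\<integral>\<^sup>+x. ennreal (- (indicator (box a b) x * f x)) \<partial>lborel) \<noteq> \<infinity>" for a b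
    using int[of a b] by (auto simp: real_integrable_def)
  have eq: "emeasure ?P (box a b) = emeasure ?N (box a b)" for a b
  proof -
    have "enn2real (\<integral>\<^sup>+x. ennreal (indicator (box a b) x * f x) \<partial>lborel) = enn2real (\<integral>\<^sup>+x. ennreal (- (indicator (box a b) x * f x)) \<partial>lborel)"
      using real_lebesgue_integral_def[OF int[of a b]] zero[of a b] by simp
    moreover have "(\<integral>\<^sup>+x. ennreal (indicator (box a b) x * f x) \<partial>lborel) < top"
      "(\<integral>\<^sup>+x. ennreal (- (indicator (box a b) x * f x)) \<partial>lborel) < top"
      using fin[of a b] by (auto simp: less_top)
    ultimately show ?thesis unfolding P N using ennreal_enn2real by metis
  qed
  have "?P = ?N"
  proof (rule measure_eqI_generator_eq)
    let ?E = "range (\<lambda>(a, b). box a b::'a set)"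
    show "Int_stable ?E" by (auto simp: Int_stable_def box_Int_box)
    show "?E \<subseteq> Pow UNIV" "sets ?P = sigma_sets UNIV ?E" "sets ?N = sigma_sets UNIV ?E"
      by (simp_all add: borel_eq_box)
    let ?A = "\<lambda>n::nat. box (- (real n *\<^sub>R One)) (real n *\<^sub>R One) :: 'a set"
    show "range ?A \<subseteq> ?E" "(\<Union>i. ?A i) = UNIV" unfolding UN_box_eq_UNIV by auto
    show "emeasure ?P (?A i) \<noteq> \<infinity>" for i using fin by (simp add: P)
    show "emeasure ?P X = emeasure ?N X" if "X \<in> ?E" for X using that eq by auto
  qed
  then have "AE x in lborel. ennreal (f x) = ennreal (- f x)"
    by (intro sigma_finite_measure.density_unique[OF lborel.sigma_finite_measure_axioms]) auto
  then show ?thesis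
  proof (rule AE_mp, intro AE_I2 impI)
    fix x assume "ennreal (f x) = ennreal (- f x)"
    then show "f x = 0" by (cases "0 \<le> f x") (auto simp: ennreal_neg ennreal_eq_0_iff)
  qed
qed

lemma L2_AE_zero_if_box_integrals_zero:
  fixes u :: "real^'n \<Rightarrow> complex"
  assumes u: "u \<in> L2" and zero: "\<And>a b. (LINT x|lborel. of_real (1 * indicator (box a b) x) * u x) = 0"
  shows "AE x in lborel. u x = 0"
proof -
  note [measurable] = L2_measurable[OF u]
  have int: "integrable lborel (\<lambda>x. of_real (1 * indicator (box a b) x) * u x)" for a b
    by (intro L2_integrable_mult L2_indicator u) auto
  have "AE x in lborel. Re (u x) = 0"
  proof (rule AE_zero_if_box_integrals_zero)
    fix a b
    show "integrable lborel (\<lambda>x. indicator (box a b) x * Re (u x))" using integrable_Re[OF int[of a b]] by simp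
    show "(\<integral>x. indicator (box a b) x * Re (u x) \<partial>lborel) = 0" using integral_Re[OF int[of a b]] zero[of a b] by simp
  qed measurable
  moreover have "AE x in lborel. Im (u x) = 0"
  proof (rule AE_zero_if_box_integrals_zero)
    fix a b
    show "integrable lborel (\<lambda>x. indicator (box a b) x * Im (u x))" using integrable_Im[OF int[of a b]] by simp
    show "(\<integral>x. indicator (box a b) x * Im (u x) \<partial>lborel) = 0" using integral_Im[OF int[of a b]] zero[of a b] by simp
  qed measurable
  ultimately show ?thesis by eventually_elim (simp add: complex_eq_iff)
qed

text \<open>Fubini moves the mollifier onto the indicator of the box. The smoothed indicator
  \<open>w k\<close> lies between 0 and 1, is supported in a fixed ball since
  \<open>e k \<le> 1\<close>, and at each point off the boundary eventually equals the indicator;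
  the boundary is a null set.\<close>

lemma box_integral_mollify_tendsto:
  fixes u :: "real^'n \<Rightarrow> complex"
  assumes u: "u \<in> L2" and e: "\<And>k. 0 < e k" "\<And>k. e k \<le> 1" "e \<longlonglongrightarrow> 0"
  shows "(\<lambda>k. LINT x|lborel. of_real (1 * indicator (box a b) x) * mollify (e k) u x) \<longlonglongrightarrow>
    (LINT x|lborel. of_real (1 * indicator (box a b) x) * u x)"
proof -
  let ?B = "box a b"
  note [measurable] = L2_measurable[OF u] mollifier_measurable[OF e(1)]
  define w where "w k y = (LINT x|lborel. indicator ?B x * mollifier (e k) (x - y))" for k y
  have w_int: "integrable lborel (\<lambda>x. indicator ?B x * mollifier (e k) (x - y))" for k y
    by (rule Bochner_Integration.integrable_bound[OF integral_mollifier_shift(1)[OF e(1), of k y]])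
       (auto simp: indicator_def)
  have [measurable]: "w k \<in> borel_measurable borel" for k
  proof -
    have "w k \<in> borel_measurable lborel"
      unfolding w_def[abs_def] by (rule lborel.borel_measurable_lebesgue_integral) measurable
    then show ?thesis by simp
  qed
  have w_nonneg: "0 \<le> w k y" for k y
    unfolding w_def by (intro Bochner_Integration.integral_nonneg mult_nonneg_nonneg mollifier_nonneg e) auto
  have w_le: "w k y \<le> 1" for k y
  proof -
    have "w k y \<le> (LINT x|lborel. mollifier (e k) (x - y))"
      unfolding w_def by (intro integral_mono w_int integral_mollifier_shift e) (auto simp: indicator_def mollifier_nonneg[OF e(1)])
    then show ?thesis by (simp add: integral_mollifier_shift[OF e(1)])
  qed
  obtain R where R: "\<And>x. x \<in> ?B \<Longrightarrow> norm x \<le> R"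
    using bounded_box[of a b] unfolding bounded_iff by blast
  have w_far: "w k y = 0" if "norm y > R + 1" for k y
  proof -
    have "indicator ?B x * mollifier (e k) (x - y) = 0" for x
    proof (cases "x \<in> ?B")
      case True
      have "norm (x - y) \<ge> e k"
        using R[OF True] that norm_triangle_ineq2[of y x] e(2)[of k] by (simp add: norm_minus_commute)
      then show ?thesis by (simp add: mollifier_eq_0[OF e(1)])
    qed simp
    then show ?thesis by (simp only: w_def Bochner_Integration.integral_zero)
  qed
  have swap: "(LINT x|lborel. of_real (1 * indicator ?B x) * mollify (e k) u x) = (LINT y|lborel. of_real (w k y) * u y)" for k
  proof -
    \<comment> \<open>Integrating the norm in y gives the indicator times
      \<open>mollify_abs\<close>, which is in \<open>L2\<close> and so integrable over the bounded
      box.\<close>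
    have int: "integrable (lborel \<Otimes>\<^sub>M lborel) (\<lambda>(x, y). complex_of_real (indicator ?B x * mollifier (e k) (x - y)) * u y)"
    proof (rule lborel_pair.Fubini_integrable)
      have eq: "(\<integral>y. norm (complex_of_real (indicator ?B x * mollifier (e k) (x - y)) * u y) \<partial>lborel) = indicator ?B x * mollify_abs (e k) u x" for x
        by (simp add: mollify_abs_def norm_mult mollifier_nonneg[OF e(1)] mult.assoc)
      have "integrable lborel (\<lambda>x. of_real (1 * indicator ?B x) * complex_of_real (mollify_abs (e k) u x))"
      proof (intro L2_integrable_mult L2_indicator)
        have "mollify_abs (e k) u \<in> borel_measurable lborel"
          unfolding mollify_abs_def[abs_def] by (rule lborel.borel_measurable_lebesgue_integral) measurable
        then show "(\<lambda>x. complex_of_real (mollify_abs (e k) u x)) \<in> L2"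
          using mollify_abs_L2(1)[OF e(1) u, of k] by (simp add: L2_def)
      qed auto
      from integrable_Re[OF this]
      show "integrable lborel (\<lambda>x. \<integral>y. norm (case (x, y) of (x, y) \<Rightarrow> complex_of_real (indicator ?B x * mollifier (e k) (x - y)) * u y) \<partial>lborel)"
        unfolding prod.case eq by simp
      show "AE x in lborel. integrable lborel (\<lambda>y. case (x, y) of (x, y) \<Rightarrow> complex_of_real (indicator ?B x * mollifier (e k) (x - y)) * u y)"
        using conv_integrable[OF test_function_mollifier[OF e(1)] u]
        by (intro AE_I2) (simp add: mult.assoc)
    qed measurable
    have "(LINT x|lborel. of_real (1 * indicator ?B x) * mollify (e k) u x) =
        (LINT x|lborel. (LINT y|lborel. complex_of_real (indicator ?B x * mollifier (e k) (x - y)) * u y))"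
      unfolding conv_def using conv_integrable[OF test_function_mollifier[OF e(1)] u]
      by (simp add: mult.assoc)
    also have "\<dots> = (LINT y|lborel. (LINT x|lborel. complex_of_real (indicator ?B x * mollifier (e k) (x - y)) * u y))"
      using lborel_pair.Fubini_integral[OF int] by simp
    also have "\<dots> = (LINT y|lborel. of_real (w k y) * u y)"
    proof (rule Bochner_Integration.integral_cong[OF refl])
      fix y
      have "integrable lborel (\<lambda>x. complex_of_real (indicator ?B x * mollifier (e k) (x - y)))"
        using w_int[of k y] by (rule integrable_of_real)
      then have "(LINT x|lborel. complex_of_real (indicator ?B x * mollifier (e k) (x - y)) * u y) =
          (LINT x|lborel. complex_of_real (indicator ?B x * mollifier (e k) (x - y))) * u y"
        by (intro Bochner_Integration.integral_mult_left)
      then show "(LINT x|lborel. complex_of_real (indicator ?B x * mollifier (e k) (x - y)) * u y) = of_real (w k y) * u y"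
        by (simp only: w_def integral_complex_of_real)
    qed
    finally show ?thesis .
  qed
  have w_lim: "(\<lambda>k. w k y) \<longlonglongrightarrow> indicator ?B y" if y: "y \<notin> cbox a b - ?B" for y
  proof (cases "y \<in> ?B")
    case True
    then obtain r where r: "0 < r" "ball y r \<subseteq> ?B" using open_box open_contains_ball by blast
    have "\<forall>\<^sub>F k in sequentially. e k < r" using order_tendstoD(2)[OF e(3) r(1)] .
    then have "\<forall>\<^sub>F k in sequentially. w k y = 1"
    proof eventually_elim
      case (elim k)
      have "indicator ?B x * mollifier (e k) (x - y) = mollifier (e k) (x - y)" for x
      proof (cases "x \<in> ?B")
        case False
        then have "dist y x \<ge> r" using r(2) by (auto simp: subset_iff not_less[symmetric])
        then have "mollifier (e k) (x - y) = 0"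
          using elim by (intro mollifier_eq_0 e) (simp add: dist_norm norm_minus_commute)
        then show ?thesis by simp
      qed simp
      then show ?case by (simp only: w_def integral_mollifier_shift(2)[OF e(1)])
    qed
    then show ?thesis using True by (simp add: tendsto_eventually)
  next
    case False
    with y have "y \<in> - cbox a b" by auto
    then obtain r where r: "0 < r" "ball y r \<subseteq> - cbox a b"
      using open_contains_ball[of "- cbox a b"] closed_cbox[of a b] by (auto simp: open_Compl)
    have "\<forall>\<^sub>F k in sequentially. e k < r" using order_tendstoD(2)[OF e(3) r(1)] .
    then have "\<forall>\<^sub>F k in sequentially. w k y = 0"
    proof eventually_elim
      case (elim k)
      have "indicator ?B x * mollifier (e k) (x - y) = 0" for x
      proof (cases "x \<in> ?B")
        case True
        then have "dist y x \<ge> r" using r(2) box_subset_cbox[of a b] by (auto simp: subset_iff not_less[symmetric])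
        then have "mollifier (e k) (x - y) = 0"
          using elim by (intro mollifier_eq_0 e) (simp add: dist_norm norm_minus_commute)
        then show ?thesis by simp
      qed simp
      then show ?case by (simp only: w_def Bochner_Integration.integral_zero)
    qed
    then show ?thesis using False by (simp add: tendsto_eventually)
  qed
  have "(\<lambda>k. LINT y|lborel. of_real (w k y) * u y) \<longlonglongrightarrow> (LINT y|lborel. of_real (1 * indicator ?B y) * u y)"
  proof (rule integral_dominated_convergence)
    show "integrable lborel (\<lambda>y. norm (complex_of_real (1 * indicator (cball 0 (R + 1)) y) * u y))"
      by (intro integrable_norm L2_integrable_mult L2_indicator u) auto
    have "AE y in lborel. y \<notin> cbox a b - ?B" by (rule AE_not_in[OF null_sets_cbox_Diff_box])
    then show "AE y in lborel. (\<lambda>k. of_real (w k y) * u y) \<longlonglongrightarrow> of_real (1 * indicator ?B y) * u y"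
    proof (rule AE_mp, intro AE_I2 impI)
      fix y assume "y \<notin> cbox a b - ?B"
      from tendsto_of_real[OF w_lim[OF this]]
      show "(\<lambda>k. of_real (w k y) * u y) \<longlonglongrightarrow> of_real (1 * indicator ?B y) * u y"
        by (intro tendsto_mult tendsto_const) simp
    qed
    have "norm (of_real (w k y) * u y) \<le> norm (complex_of_real (1 * indicator (cball 0 (R + 1)) y) * u y)" for k y
      using w_nonneg[of k y] w_le[of k y] w_far[of y k]
      by (cases "norm y > R + 1") (auto simp: norm_mult mult_left_le_one_le)
    then show "AE y in lborel. norm (of_real (w k y) * u y) \<le> norm (complex_of_real (1 * indicator (cball 0 (R + 1)) y) * u y)" for k
      by (intro AE_I2)
  qed measurable
  then show ?thesis unfolding swap .
qed

text \<open>Reflected mollifiers are test functions, so every mollification of u vanishes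
  identically, and in the limit so does every box integral of u.\<close>

lemma L2_AE_zero_if_test_integrals_zero:
  fixes u :: "real^'n \<Rightarrow> complex"
  assumes u: "u \<in> L2" and zero: "\<And>\<phi>. \<phi> \<in> test_function \<Longrightarrow> (LINT x|lborel. u x * \<phi> x) = 0"
  shows "AE x in lborel. u x = 0"
proof (rule L2_AE_zero_if_box_integrals_zero[OF u])
  fix a b :: "real^'n"
  define e where "e k = 1 / real (Suc k)" for k
  have e: "0 < e k" "e k \<le> 1" for k by (simp_all add: e_def)
  have e0: "e \<longlonglongrightarrow> 0" unfolding e_def by (rule LIMSEQ_Suc[OF lim_1_over_n])
  have "mollify (e k) u x = 0" for k x
    unfolding conv_def using zero[OF test_function_reflect[OF test_function_mollifier[OF e(1)]], of k x]
    by (simp add: mult.commute)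
  with box_integral_mollify_tendsto[OF u e e0, of a b]
  have "(\<lambda>k. 0) \<longlonglongrightarrow> (LINT x|lborel. of_real (1 * indicator (box a b) x) * u x)" by simp
  then show "(LINT x|lborel. of_real (1 * indicator (box a b) x) * u x) = 0"
    by (simp add: LIMSEQ_const_iff)
qed

section \<open>Square integrable weak solutions of \<open>P u + u = 0\<close> vanish\<close>

lemma schroedinger_reflect:
  assumes "smooth \<psi>"
  shows "schroedinger \<eta> V (\<lambda>y. \<psi> (x - y)) y = - of_real (\<eta>\<^sup>2) * laplacian \<psi> (x - y) + V y * \<psi> (x - y)"
  by (simp add: schroedinger_def laplacian_reflect[OF assms])

lemma conv_laplacian:
  assumes "\<psi> \<in> test_function" "u \<in> L2"
  shows "integrable lborel (\<lambda>y. laplacian \<psi> (x - y) * u y)"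
    "(LINT y|lborel. laplacian \<psi> (x - y) * u y) = (\<Sum>i\<in>UNIV. conv (partial i (partial i \<psi>)) u x)"
  unfolding laplacian_def sum_distrib_right conv_def
  by (intro Bochner_Integration.integrable_sum Bochner_Integration.integral_sum conv_integrable test_function_partial assms)+

text \<open>Testing the weak equation with a reflected mollifier shows that v =
  \<open>mollify e u\<close> satisfies \<eta>^2 times its Laplacian = (V + 1) v + r on the ball of
  radius R. Here r is the commutator of V with mollification, bounded by \<omega>
  \<open>mollify_abs e u\<close>. Multiply by \<theta>^2 times the conjugate of v and integrate:
  with Re V \<ge> 0, the only losses are the commutator and a term with the gradient of
  \<theta>.\<close>

lemma mollified_energy:
  fixes u V :: "real^'n \<Rightarrow> complex" and \<theta> :: "real^'n \<Rightarrow> real"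
  assumes u: "u \<in> L2" and V: "continuous_on UNIV V" and V_nonneg: "\<And>x. 0 \<le> Re (V x)"
    and weak: "\<And>\<phi>. \<phi> \<in> test_function \<Longrightarrow> (LINT x|lborel. u x * (schroedinger \<eta> V \<phi> x + \<phi> x)) = 0"
    and \<theta>': "\<And>i x. has_partial \<theta> i x (\<theta>' i x)" and cont: "continuous_on UNIV \<theta>" "\<And>i. continuous_on UNIV (\<theta>' i)"
    and supp: "\<And>x. norm x > R \<Longrightarrow> \<theta> x = 0" and \<theta>_le: "\<And>x. \<bar>\<theta> x\<bar> \<le> 1" and G: "\<And>i x. \<bar>\<theta>' i x\<bar> \<le> G"
    and e: "0 < e" and \<omega>: "0 \<le> \<omega>" "\<And>x y. norm x \<le> R \<Longrightarrow> norm (x - y) \<le> e \<Longrightarrow> norm (V y - V x) \<le> \<omega>"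
  shows "integrable lborel (\<lambda>x. (\<theta> x)\<^sup>2 * (norm (mollify e u x))\<^sup>2)"
    "(\<integral>x. (\<theta> x)\<^sup>2 * (norm (mollify e u x))\<^sup>2 \<partial>lborel) \<le> (\<omega> + real CARD('n) * \<eta>\<^sup>2 * G\<^sup>2) * (L2_norm u)\<^sup>2"
proof -
  let ?\<rho> = "\<lambda>x::real^'n. complex_of_real (mollifier e x)"
  have \<rho>: "?\<rho> \<in> test_function" by (rule test_function_mollifier[OF e])
  define v where "v = mollify e u"
  define v1 where "v1 i = conv (partial i ?\<rho>) u" for i
  define v2 where "v2 i = conv (partial i (partial i ?\<rho>)) u" for i
  define U where "U = mollify_abs e u"
  have v_cont: "continuous_on UNIV v" "continuous_on UNIV (v1 i)" "continuous_on UNIV (v2 i)" for i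
    unfolding v_def v1_def v2_def by (intro conv_continuous \<rho> test_function_partial u)+
  have v_partial: "has_partial v i x (v1 i x)" "has_partial (v1 i) i x (v2 i x)" for i x
    unfolding v_def v1_def v2_def by (intro has_partial_conv \<rho> test_function_partial u)+
  have vU: "norm (v x) \<le> U x" for x unfolding v_def U_def by (rule norm_mollify_le[OF e])
  have U_nonneg: "0 \<le> U x" for x by (rule order_trans[OF norm_ge_zero vU])

  have eq: "\<exists>r. of_real (\<eta>\<^sup>2) * (\<Sum>i\<in>UNIV. v2 i x) = (V x + 1) * v x + r \<and> norm r \<le> \<omega> * U x" if x: "norm x \<le> R" for x
  proof -
    let ?a = "\<lambda>y. laplacian ?\<rho> (x - y) * u y" and ?b = "\<lambda>y. V y * (?\<rho> (x - y) * u y)" and ?c = "\<lambda>y. ?\<rho> (x - y) * u y"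
    have a: "integrable lborel ?a" by (rule conv_laplacian[OF \<rho> u])
    have c: "integrable lborel ?c" by (rule conv_integrable[OF \<rho> u])
    have b: "integrable lborel ?b"
    proof -
      have t: "(\<lambda>y. ?\<rho> (x - y)) \<in> test_function" by (rule test_function_reflect[OF \<rho>])
      then obtain R' where R': "\<And>y. norm y > R' \<Longrightarrow> ?\<rho> (x - y) = 0" by (auto simp: test_function_iff)
      have "(\<lambda>y. V y * ?\<rho> (x - y)) \<in> L2"
        by (rule L2_compact_support[where R = R']) (auto intro!: continuous_intros V test_function_continuous[OF t] simp: R')
      from L2_integrable_mult[OF this u] show ?thesis by (simp add: mult.assoc)
    qed
    have "0 = (LINT y|lborel. u y * (schroedinger \<eta> V (\<lambda>y. ?\<rho> (x - y)) y + ?\<rho> (x - y)))"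
      using weak[OF test_function_reflect[OF \<rho>]] by simp
    also have "\<dots> = (LINT y|lborel. (- of_real (\<eta>\<^sup>2)) * ?a y + ?b y + ?c y)"
      by (intro Bochner_Integration.integral_cong refl)
         (simp add: schroedinger_reflect[OF test_function_smooth[OF \<rho>]] algebra_simps)
    also have "\<dots> = (- of_real (\<eta>\<^sup>2)) * (LINT y|lborel. ?a y) + (LINT y|lborel. ?b y) + v x"
      unfolding v_def conv_def
      using a b c integrable_mult_right[OF a, of "- of_real (\<eta>\<^sup>2)"]
      by (simp del: mult_minus_left)
    finally have 1: "of_real (\<eta>\<^sup>2) * (\<Sum>i\<in>UNIV. v2 i x) = (LINT y|lborel. ?b y) + v x"
      unfolding conv_laplacian(2)[OF \<rho> u] v2_def by (simp add: algebra_simps)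
    let ?r = "LINT y|lborel. (V y - V x) * ?c y"
    have "?r = (LINT y|lborel. ?b y - V x * ?c y)" by (simp add: left_diff_distrib)
    also have "\<dots> = (LINT y|lborel. ?b y) - V x * v x"
      unfolding v_def conv_def using b c by simp
    finally have 2: "?r = (LINT y|lborel. ?b y) - V x * v x" .
    have "norm ?r \<le> (LINT y|lborel. norm ((V y - V x) * ?c y))" by (rule integral_norm_bound)
    also have "\<dots> \<le> (LINT y|lborel. \<omega> * (mollifier e (x - y) * norm (u y)))"
    proof (rule integral_mono)
      have "integrable lborel (\<lambda>y. ?b y - V x * ?c y)" using b c by simp
      then have "integrable lborel (\<lambda>y. (V y - V x) * ?c y)" by (simp add: left_diff_distrib)
      then show "integrable lborel (\<lambda>y. norm ((V y - V x) * ?c y))" by (rule integrable_norm)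
      show "integrable lborel (\<lambda>y. \<omega> * (mollifier e (x - y) * norm (u y)))"
        by (intro integrable_mult_right mollify_abs_integrable e u)
      fix y
      show "norm ((V y - V x) * ?c y) \<le> \<omega> * (mollifier e (x - y) * norm (u y))"
      proof (cases "norm (x - y) \<le> e")
        case True
        have "norm (V y - V x) * (mollifier e (x - y) * norm (u y)) \<le> \<omega> * (mollifier e (x - y) * norm (u y))"
          by (intro mult_right_mono \<omega>(2)[OF x True] mult_nonneg_nonneg mollifier_nonneg e) auto
        then show ?thesis by (simp add: norm_mult mollifier_nonneg[OF e])
      next
        case False
        then show ?thesis using mollifier_eq_0[OF e, of "x - y"] by simp
      qed
    qed
    also have "\<dots> = \<omega> * U x"
      unfolding U_def mollify_abs_def using mollify_abs_integrable[OF e u, of x] by simp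
    finally have 3: "norm ?r \<le> \<omega> * U x" .
    show ?thesis by (rule exI[of _ ?r]) (use 1 2 3 in \<open>simp add: algebra_simps\<close>)
  qed

  \<comment> \<open>\<open>D i\<close> is the i-th derivative of \<open>?F i\<close>, so it has
    compact support and integral 0.\<close>
  define D where "D i x = of_real (2 * \<theta> x * \<theta>' i x) * (cnj (v x) * v1 i x) +
      of_real ((\<theta> x)\<^sup>2) * (cnj (v1 i x) * v1 i x + cnj (v x) * v2 i x)" for i x
  let ?F = "\<lambda>i x. of_real ((\<theta> x)\<^sup>2) * (cnj (v x) * v1 i x)"
  have F_partial: "has_partial (?F i) i x (D i x)" for i x
    unfolding D_def
    by (intro has_partial_mult has_partial_linear[OF bounded_linear_of_real] has_partial_power2 \<theta>'
        has_partial_linear[OF bounded_linear_cnj] v_partial)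
  have F_cont: "continuous_on UNIV (?F i)" for i
    by (intro continuous_intros cont v_cont)
  have D_cont: "continuous_on UNIV (D i)" for i
    unfolding D_def by (intro continuous_intros cont v_cont)
  have F0: "?F i x = 0" if "norm x > R" for i x using supp[OF that] by simp
  have D0: "D i x = 0" if "norm x > R" for i x
    by (rule has_partial_eq_0_outside[of R, OF F0 F_partial that])
  have D_int: "integrable lborel (D i)" for i
    by (rule integrable_compact_support[OF D_cont D0])
  have D_zero: "integral\<^sup>L lborel (D i) = 0" for i
    by (rule integral_partial_compact_support[OF F_partial F_cont D_cont F0])
  have sum_int: "integrable lborel (\<lambda>x. \<Sum>i\<in>UNIV. Re (D i x))"
    by (intro Bochner_Integration.integrable_sum integrable_Re D_int)
  have sum_zero: "(\<integral>x. (\<Sum>i\<in>UNIV. Re (D i x)) \<partial>lborel) = 0"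
    by (subst Bochner_Integration.integral_sum) (auto intro: integrable_Re D_int simp: integral_Re D_int D_zero)

  have pointwise: "(\<theta> x)\<^sup>2 * (norm (v x))\<^sup>2 \<le> \<eta>\<^sup>2 * (\<Sum>i\<in>UNIV. Re (D i x)) + (\<omega> + real CARD('n) * \<eta>\<^sup>2 * G\<^sup>2) * (U x)\<^sup>2" for x
  proof (cases "norm x \<le> R")
    case False
    then have "(\<Sum>i\<in>UNIV. Re (D i x)) = 0" using D0 by simp
    then show ?thesis using supp[of x] False \<omega>(1) by simp
  next
    case True
    then obtain r where r: "of_real (\<eta>\<^sup>2) * (\<Sum>i\<in>UNIV. v2 i x) = (V x + 1) * v x + r" and r_le: "norm r \<le> \<omega> * U x"
      using eq by blast
    have "(\<theta> x)\<^sup>2 * Re (cnj (v x) * v2 i x) - G\<^sup>2 * (U x)\<^sup>2 \<le> Re (D i x)" for i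
    proof -
      \<comment> \<open>Completing the square absorbs the cross term containing \<theta> times its
        derivative; only the squared derivative of \<theta> times |v|^2 is lost.\<close>
      have "0 \<le> (norm (of_real (\<theta> x) * v1 i x + of_real (\<theta>' i x) * v x))\<^sup>2" by simp
      also have "\<dots> = Re (D i x) - (\<theta> x)\<^sup>2 * Re (cnj (v x) * v2 i x) + (\<theta>' i x)\<^sup>2 * (norm (v x))\<^sup>2"
        unfolding D_def by (simp add: cmod_power2) (simp add: power2_eq_square algebra_simps)
      also have "(\<theta>' i x)\<^sup>2 * (norm (v x))\<^sup>2 \<le> G\<^sup>2 * (U x)\<^sup>2"
        using G[of i x] vU[of x] by (intro mult_mono) (auto simp: abs_le_square_iff[symmetric] intro!: power_mono)
      finally show ?thesis by simp
    qed
    then have "(\<Sum>i\<in>UNIV. (\<theta> x)\<^sup>2 * Re (cnj (v x) * v2 i x) - G\<^sup>2 * (U x)\<^sup>2) \<le> (\<Sum>i\<in>UNIV. Re (D i x))"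
      by (intro sum_mono)
    then have "(\<theta> x)\<^sup>2 * Re (cnj (v x) * (\<Sum>i\<in>UNIV. v2 i x)) - real CARD('n) * G\<^sup>2 * (U x)\<^sup>2 \<le> (\<Sum>i\<in>UNIV. Re (D i x))"
      by (simp add: sum_subtractf sum_distrib_left del: cnj.sel complex.sel times_complex.sel)
    then have 1: "\<eta>\<^sup>2 * ((\<theta> x)\<^sup>2 * Re (cnj (v x) * (\<Sum>i\<in>UNIV. v2 i x)) - real CARD('n) * G\<^sup>2 * (U x)\<^sup>2) \<le> \<eta>\<^sup>2 * (\<Sum>i\<in>UNIV. Re (D i x))"
      by (intro mult_left_mono) auto
    have "\<eta>\<^sup>2 * Re (cnj (v x) * (\<Sum>i\<in>UNIV. v2 i x)) = Re (cnj (v x) * (of_real (\<eta>\<^sup>2) * (\<Sum>i\<in>UNIV. v2 i x)))"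
      by (simp add: algebra_simps)
    also have "\<dots> = (Re (V x) + 1) * (norm (v x))\<^sup>2 + Re (cnj (v x) * r)"
      unfolding r by (simp add: cmod_power2) (simp add: power2_eq_square algebra_simps)
    finally have 2: "\<eta>\<^sup>2 * Re (cnj (v x) * (\<Sum>i\<in>UNIV. v2 i x)) = (Re (V x) + 1) * (norm (v x))\<^sup>2 + Re (cnj (v x) * r)" .
    have "- Re (cnj (v x) * r) \<le> norm (cnj (v x) * r)" using abs_Re_le_cmod[of "cnj (v x) * r"] by linarith
    also have "\<dots> \<le> U x * (\<omega> * U x)"
      unfolding norm_mult complex_mod_cnj using vU[of x] r_le U_nonneg[of x] by (intro mult_mono) auto
    finally have 3: "- (\<omega> * (U x)\<^sup>2) \<le> Re (cnj (v x) * r)" by (simp add: power2_eq_square mult_ac)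
    have "0 \<le> Re (V x) * (norm (v x))\<^sup>2" by (intro mult_nonneg_nonneg V_nonneg) auto
    then have 4: "(norm (v x))\<^sup>2 - \<omega> * (U x)\<^sup>2 \<le> \<eta>\<^sup>2 * Re (cnj (v x) * (\<Sum>i\<in>UNIV. v2 i x))"
      unfolding 2 using 3 by (simp add: distrib_right)
    have "(\<theta> x)\<^sup>2 \<le> 1" using \<theta>_le[of x] by (simp add: abs_square_le_1)
    then have 5: "(\<theta> x)\<^sup>2 * (\<omega> * (U x)\<^sup>2) \<le> 1 * (\<omega> * (U x)\<^sup>2)" using \<omega>(1) by (intro mult_right_mono) auto
    have "(\<theta> x)\<^sup>2 * ((norm (v x))\<^sup>2 - \<omega> * (U x)\<^sup>2) \<le> (\<theta> x)\<^sup>2 * (\<eta>\<^sup>2 * Re (cnj (v x) * (\<Sum>i\<in>UNIV. v2 i x)))"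
      using 4 by (intro mult_left_mono) auto
    with 1 5 show ?thesis by (simp add: algebra_simps)
  qed
  have lhs_int: "integrable lborel (\<lambda>x. (\<theta> x)\<^sup>2 * (norm (v x))\<^sup>2)"
    by (rule integrable_compact_support[where R = R]) (auto intro!: continuous_intros cont v_cont simp: supp)
  then show "integrable lborel (\<lambda>x. (\<theta> x)\<^sup>2 * (norm (mollify e u x))\<^sup>2)" by (simp add: v_def)
  have U_int: "integrable lborel (\<lambda>x. (U x)\<^sup>2)" and U_le: "(\<integral>x. (U x)\<^sup>2 \<partial>lborel) \<le> (L2_norm u)\<^sup>2"
    unfolding U_def by (rule mollify_abs_L2[OF e u])+
  have "(\<integral>x. (\<theta> x)\<^sup>2 * (norm (v x))\<^sup>2 \<partial>lborel) \<le> (\<integral>x. \<eta>\<^sup>2 * (\<Sum>i\<in>UNIV. Re (D i x)) + (\<omega> + real CARD('n) * \<eta>\<^sup>2 * G\<^sup>2) * (U x)\<^sup>2 \<partial>lborel)"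
    by (intro integral_mono lhs_int pointwise Bochner_Integration.integrable_add integrable_mult_right sum_int U_int)
  also have "\<dots> = \<eta>\<^sup>2 * (\<integral>x. (\<Sum>i\<in>UNIV. Re (D i x)) \<partial>lborel) + (\<omega> + real CARD('n) * \<eta>\<^sup>2 * G\<^sup>2) * (\<integral>x. (U x)\<^sup>2 \<partial>lborel)"
    by (subst Bochner_Integration.integral_add) (auto intro!: integrable_mult_right sum_int U_int)
  also have "\<dots> \<le> (\<omega> + real CARD('n) * \<eta>\<^sup>2 * G\<^sup>2) * (L2_norm u)\<^sup>2"
    unfolding sum_zero using U_le \<omega>(1) by (simp add: mult_left_mono)
  finally show "(\<integral>x. (\<theta> x)\<^sup>2 * (norm (mollify e u x))\<^sup>2 \<partial>lborel) \<le> (\<omega> + real CARD('n) * \<eta>\<^sup>2 * G\<^sup>2) * (L2_norm u)\<^sup>2"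
    by (simp add: v_def)
qed

lemma bump_partial_bounded: "\<exists>C\<ge>0. \<forall>i x. \<bar>partial i (bump :: real^'n \<Rightarrow> real) x\<bar> \<le> C"
proof -
  have "\<exists>C\<ge>0. \<forall>x. norm (partial i (bump :: real^'n \<Rightarrow> real) x) \<le> C" for i
  proof (intro bounded_range_D bounded_compact_support[where R = 1])
    show "continuous_on UNIV (partial i (bump :: real^'n \<Rightarrow> real))"
      by (intro smooth_continuous smooth_partial smooth_bump)
    show "partial i (bump :: real^'n \<Rightarrow> real) x = 0" if "1 < norm x" for x
      by (rule has_partial_eq_0_outside[OF _ smooth_has_partial[OF smooth_bump] that]) (simp add: bump_eq_0)
  qed
  then obtain C where C: "\<And>i. 0 \<le> C i" "\<And>i x. norm (partial i (bump :: real^'n \<Rightarrow> real) x) \<le> C i"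
    by metis
  have "C i \<le> (\<Sum>i\<in>UNIV. C i)" for i using C(1) by (intro member_le_sum) auto
  then have "\<bar>partial i (bump :: real^'n \<Rightarrow> real) x\<bar> \<le> (\<Sum>i\<in>UNIV. C i)" for i x
    using C(2)[of i x] by (metis order_trans real_norm_def)
  moreover have "0 \<le> (\<Sum>i\<in>UNIV. C i)" using C(1) by (intro sum_nonneg) auto
  ultimately show ?thesis by blast
qed

text \<open>The parameters are fixed in the order \<kappa>, R, e. The cutoff is a bump dilated by R,
  so its gradient is of order 1 / R. On the ball thus fixed V is uniformly continuous, so the
  commutator becomes small with e. Only box integrals are passed to the limit, first in e and then
  in \<kappa>.\<close>

lemma weak_null_solution_zero:
  fixes u V :: "real^'n \<Rightarrow> complex"
  assumes u: "u \<in> L2" and V: "continuous_on UNIV V" and V_nonneg: "\<And>x. 0 \<le> Re (V x)"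
    and weak: "\<And>\<phi>. \<phi> \<in> test_function \<Longrightarrow> (LINT x|lborel. u x * (schroedinger \<eta> V \<phi> x + \<phi> x)) = 0"
  shows "AE x in lborel. u x = 0"
proof (rule L2_AE_zero_if_box_integrals_zero[OF u])
  fix a b :: "real^'n"
  define B where "B = box a b"
  let ?I = "\<lambda>x. complex_of_real (1 * indicator B x)"
  have I: "?I \<in> L2" unfolding B_def by (intro L2_indicator) auto
  define ek where "ek k = 1 / real (Suc k)" for k
  have ek: "0 < ek k" "ek k \<le> 1" for k by (simp_all add: ek_def)
  have ek0: "ek \<longlonglongrightarrow> 0" unfolding ek_def by (rule LIMSEQ_Suc[OF lim_1_over_n])
  note lim = box_integral_mollify_tendsto[OF u ek ek0, of a b, folded B_def]
  obtain r where r: "\<And>x. x \<in> B \<Longrightarrow> norm x \<le> r" "1 \<le> r"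
  proof -
    obtain r where "\<And>x. x \<in> B \<Longrightarrow> norm x \<le> r" unfolding B_def using bounded_box[of a b] unfolding bounded_iff by blast
    then show thesis by (intro that[of "max r 1"]) (auto intro: max.coboundedI1)
  qed
  obtain C where C: "0 \<le> C" "\<And>i x. \<bar>partial i (bump :: real^'n \<Rightarrow> real) x\<bar> \<le> C"
    using bump_partial_bounded by blast
  define c :: real where "c = exp (- (4/3))"
  have c: "0 < c" by (simp add: c_def)
  let ?n = "real CARD('n)"
  have bound: "norm (LINT x|lborel. ?I x * u x) \<le> L2_norm ?I * sqrt (\<kappa> * ((L2_norm u)\<^sup>2 / c\<^sup>2))" if \<kappa>: "0 < \<kappa>" for \<kappa>
  proof (rule LIMSEQ_le_const2[OF tendsto_norm[OF lim]])
    \<comment> \<open>R \<ge> 2 r puts the box where the bump is at least c. The second entry,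
      together with R \<ge> 1, makes the cutoff gradient contribute at most \<kappa> / 2.\<close>
    define R where "R = max (2 * r) (2 * (?n * \<eta>\<^sup>2 * C\<^sup>2) / \<kappa>)"
    have R: "2 * r \<le> R" "2 * (?n * \<eta>\<^sup>2 * C\<^sup>2) / \<kappa> \<le> R" "1 \<le> R" using r(2) by (auto simp: R_def)
    have small: "?n * \<eta>\<^sup>2 * (C / R)\<^sup>2 \<le> \<kappa> / 2"
    proof -
      have "2 * (?n * \<eta>\<^sup>2 * C\<^sup>2) \<le> R * \<kappa>" using R(2) \<kappa> by (simp add: pos_divide_le_eq)
      also have "\<dots> \<le> R\<^sup>2 * \<kappa>" using R(3) \<kappa> by (intro mult_right_mono) (auto simp: power2_eq_square)
      finally show ?thesis using R(3) by (simp add: power_divide field_simps)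
    qed
    \<comment> \<open>Radius R + 1 is enough, because the mollifier reaches at most
      \<open>ek k \<le> 1\<close> beyond the cutoff ball.\<close>
    have "uniformly_continuous_on (cball 0 (R + 1)) V"
      by (intro compact_uniformly_continuous continuous_on_subset[OF V]) auto
    then obtain d where d: "0 < d" "\<And>x y. x \<in> cball 0 (R + 1) \<Longrightarrow> y \<in> cball 0 (R + 1) \<Longrightarrow> dist y x < d \<Longrightarrow> dist (V y) (V x) < \<kappa> / 2"
      unfolding uniformly_continuous_on_def using \<kappa> by (metis half_gt_zero)
    define \<theta> where "\<theta> x = bump (0 + (1 / R) *\<^sub>R x)" for x :: "real^'n"
    have \<theta>_smooth: "smooth \<theta>" unfolding \<theta>_def[abs_def] by (rule smooth_affine[OF smooth_bump])
    have \<theta>1: "partial i \<theta> x = (1 / R) * partial i bump (0 + (1 / R) *\<^sub>R x)" for i x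
      using partials_affine[OF smooth_bump, of "[i]" 0 "1 / R"] unfolding \<theta>_def[abs_def] by simp
    have "\<forall>\<^sub>F k in sequentially. ek k < d" by (rule order_tendstoD(2)[OF ek0 d(1)])
    then have "\<forall>\<^sub>F k in sequentially. norm (LINT x|lborel. ?I x * mollify (ek k) u x) \<le> L2_norm ?I * sqrt (\<kappa> * ((L2_norm u)\<^sup>2 / c\<^sup>2))"
    proof eventually_elim
      case (elim k)
      let ?v = "mollify (ek k) u"
      have mod: "norm (V y - V x) \<le> \<kappa> / 2" if "norm x \<le> R" "norm (x - y) \<le> ek k" for x y
      proof -
        have "norm y \<le> R + 1" using that ek(2)[of k] norm_triangle_ineq2[of y x] by (simp add: norm_minus_commute)
        then have "dist (V y) (V x) < \<kappa> / 2"
          using that elim by (intro d(2)) (auto simp: dist_norm norm_minus_commute)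
        then show ?thesis by (simp add: dist_norm)
      qed
      have E: "integrable lborel (\<lambda>x. (\<theta> x)\<^sup>2 * (norm (?v x))\<^sup>2)"
        "(\<integral>x. (\<theta> x)\<^sup>2 * (norm (?v x))\<^sup>2 \<partial>lborel) \<le> (\<kappa> / 2 + ?n * \<eta>\<^sup>2 * (C / R)\<^sup>2) * (L2_norm u)\<^sup>2"
      proof -
        have 1: "has_partial \<theta> i x (partial i \<theta> x)" for i x by (rule smooth_has_partial[OF \<theta>_smooth])
        have 2: "continuous_on UNIV \<theta>" "continuous_on UNIV (partial i \<theta>)" for i
          by (intro smooth_continuous smooth_partial \<theta>_smooth)+
        have 3: "\<theta> x = 0" if "norm x > R" for x
          unfolding \<theta>_def using that R(3) by (intro bump_eq_0) simp
        have 4: "\<bar>\<theta> x\<bar> \<le> 1" for x unfolding \<theta>_def using bump_nonneg[of "0 + (1 / R) *\<^sub>R x"] bump_le_1[of "0 + (1 / R) *\<^sub>R x"] by linarith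
        have 5: "\<bar>partial i \<theta> x\<bar> \<le> C / R" for i x
          unfolding \<theta>1 using C(2)[of i "0 + (1 / R) *\<^sub>R x"] R(3) by (simp add: abs_mult divide_right_mono)
        have 6: "0 \<le> \<kappa> / 2" using \<kappa> by simp
        note M = mollified_energy[OF u V V_nonneg weak 1 2 3 4 5 ek(1) 6 mod]
        show "integrable lborel (\<lambda>x. (\<theta> x)\<^sup>2 * (norm (?v x))\<^sup>2)" by (rule M(1))
        show "(\<integral>x. (\<theta> x)\<^sup>2 * (norm (?v x))\<^sup>2 \<partial>lborel) \<le> (\<kappa> / 2 + ?n * \<eta>\<^sup>2 * (C / R)\<^sup>2) * (L2_norm u)\<^sup>2" by (rule M(2))
      qed
      have E2: "(\<integral>x. (\<theta> x)\<^sup>2 * (norm (?v x))\<^sup>2 \<partial>lborel) \<le> \<kappa> * (L2_norm u)\<^sup>2"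
        by (rule order_trans[OF E(2)]) (use small in \<open>auto intro!: mult_right_mono\<close>)
      have le: "norm ((norm (?I x * ?v x))\<^sup>2) \<le> norm ((1 / c\<^sup>2) * ((\<theta> x)\<^sup>2 * (norm (?v x))\<^sup>2))" for x
      proof (cases "x \<in> B")
        case True
        have "norm (0 + (1 / R) *\<^sub>R x) \<le> 1/2" using r(1)[OF True] R by (simp add: field_simps)
        then have "c \<le> \<theta> x" unfolding c_def \<theta>_def by (rule bump_ge)
        then have "c\<^sup>2 \<le> (\<theta> x)\<^sup>2" using c by (intro power_mono) auto
        then have "1 \<le> (1 / c\<^sup>2) * (\<theta> x)\<^sup>2" using c by (simp add: field_simps)
        then have "1 * (norm (?v x))\<^sup>2 \<le> ((1 / c\<^sup>2) * (\<theta> x)\<^sup>2) * (norm (?v x))\<^sup>2" by (intro mult_right_mono) auto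
        then show ?thesis using True by (simp add: mult.assoc)
      qed simp
      have Iv_meas: "(\<lambda>x. ?I x * ?v x) \<in> borel_measurable borel"
      proof -
        have [measurable]: "?v \<in> borel_measurable borel"
          by (intro borel_measurable_continuous_onI conv_continuous test_function_mollifier ek u)
        show ?thesis unfolding B_def by measurable
      qed
      have Iv_int: "integrable lborel (\<lambda>x. (norm (?I x * ?v x))\<^sup>2)"
        by (rule Bochner_Integration.integrable_bound[OF integrable_mult_right[OF E(1), of "1 / c\<^sup>2"]])
           (use Iv_meas le in auto)
      then have Iv: "(\<lambda>x. ?I x * ?v x) \<in> L2" using Iv_meas by (simp add: L2_def)
      have "(L2_norm (\<lambda>x. ?I x * ?v x))\<^sup>2 \<le> (\<integral>x. (1 / c\<^sup>2) * ((\<theta> x)\<^sup>2 * (norm (?v x))\<^sup>2) \<partial>lborel)"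
        unfolding L2_norm_power2
        by (rule integral_mono[OF Iv_int integrable_mult_right[OF E(1)]]) (use le in simp)
      also have "\<dots> = (1 / c\<^sup>2) * (\<integral>x. (\<theta> x)\<^sup>2 * (norm (?v x))\<^sup>2 \<partial>lborel)" by (rule Bochner_Integration.integral_mult_right[OF E(1)])
      also have "\<dots> \<le> (1 / c\<^sup>2) * (\<kappa> * (L2_norm u)\<^sup>2)" by (intro mult_left_mono E2) auto
      finally have "L2_norm (\<lambda>x. ?I x * ?v x) \<le> sqrt (\<kappa> * ((L2_norm u)\<^sup>2 / c\<^sup>2))"
        by (intro real_le_rsqrt) simp
      \<comment> \<open>Since the indicator is idempotent it can be inserted twice, and
        Cauchy-Schwarz then sees the mollification on the box only.\<close>
      moreover have "norm (LINT x|lborel. ?I x * (?I x * ?v x)) \<le> L2_norm ?I * L2_norm (\<lambda>x. ?I x * ?v x)"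
        by (rule L2_norm_pairing_le[OF I Iv])
      moreover have "?I x * (?I x * ?v x) = ?I x * ?v x" for x by (simp add: indicator_def)
      ultimately show ?case
        by (simp only:) (meson L2_norm_nonneg mult_left_mono order_trans)
    qed
    then show "\<exists>N. \<forall>k\<ge>N. norm (LINT x|lborel. ?I x * mollify (ek k) u x) \<le> L2_norm ?I * sqrt (\<kappa> * ((L2_norm u)\<^sup>2 / c\<^sup>2))"
      unfolding eventually_sequentially .
  qed
  have "norm (LINT x|lborel. ?I x * u x) \<le> L2_norm ?I * sqrt (0 * ((L2_norm u)\<^sup>2 / c\<^sup>2))"
  proof (rule LIMSEQ_le_const)
    show "(\<lambda>k. L2_norm ?I * sqrt (ek k * ((L2_norm u)\<^sup>2 / c\<^sup>2))) \<longlonglongrightarrow> L2_norm ?I * sqrt (0 * ((L2_norm u)\<^sup>2 / c\<^sup>2))"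
      by (intro tendsto_mult tendsto_const tendsto_real_sqrt ek0)
    show "\<exists>N. \<forall>k\<ge>N. norm (LINT x|lborel. ?I x * u x) \<le> L2_norm ?I * sqrt (ek k * ((L2_norm u)\<^sup>2 / c\<^sup>2))"
      using bound[OF ek(1)] by blast
  qed
  then show "(LINT x|lborel. complex_of_real (1 * indicator (box a b) x) * u x) = 0"
    unfolding B_def by simp
qed

section \<open>The closed realization\<close>

lemma test_function_lincomb:
  assumes "\<phi> \<in> test_function" "\<psi> \<in> test_function"
  shows "(\<lambda>x. a * \<phi> x + b * \<psi> x) \<in> test_function"
proof -
  obtain R where R: "\<And>x. norm x > R \<Longrightarrow> \<phi> x = 0" using assms(1) by (auto simp: test_function_iff)
  obtain R' where R': "\<And>x. norm x > R' \<Longrightarrow> \<psi> x = 0" using assms(2) by (auto simp: test_function_iff)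
  have "smooth (\<lambda>x. a * \<phi> x + b * \<psi> x)"
    by (intro smooth_add smooth_mult smooth_const test_function_smooth assms)
  moreover have "a * \<phi> x + b * \<psi> x = 0" if "norm x > max R R'" for x using that R R' by simp
  ultimately show ?thesis unfolding test_function_iff by blast
qed

lemma partial_lincomb:
  fixes f g :: "real^'n \<Rightarrow> complex"
  assumes "smooth f" "smooth g"
  shows "partial i (\<lambda>x. a * f x + b * g x) = (\<lambda>x. a * partial i f x + b * partial i g x)"
proof
  fix x
  have "has_partial (\<lambda>x. a * f x + b * g x) i x ((0 * f x + a * partial i f x) + (0 * g x + b * partial i g x))"
    by (intro has_partial_add has_partial_mult has_partial_const smooth_has_partial assms)
  then show "partial i (\<lambda>x. a * f x + b * g x) x = a * partial i f x + b * partial i g x"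
    by (simp add: has_partial_eq)
qed

lemma schroedinger_lincomb:
  assumes "smooth f" "smooth g"
  shows "schroedinger \<eta> V (\<lambda>x. a * f x + b * g x) x = a * schroedinger \<eta> V f x + b * schroedinger \<eta> V g x"
  unfolding schroedinger_def laplacian_def
  by (simp add: partial_lincomb assms smooth_partial sum.distrib sum_distrib_left algebra_simps)

text \<open>Integrate \<open>\<partial>\<^sub>i (\<theta> \<phi>\<^sup>* \<partial>\<^sub>i \<phi>)\<close>.\<close>

lemma green_identity:
  fixes \<phi> :: "real^'n \<Rightarrow> complex" and \<theta> :: "real^'n \<Rightarrow> real"
  assumes \<phi>: "\<phi> \<in> test_function"
    and \<theta>': "\<And>i x. has_partial \<theta> i x (\<theta>' i x)" and cont: "continuous_on UNIV \<theta>" "\<And>i. continuous_on UNIV (\<theta>' i)"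
  defines "D \<equiv> \<lambda>x. (\<Sum>i\<in>UNIV. of_real (\<theta>' i x) * (cnj (\<phi> x) * partial i \<phi> x) +
      of_real (\<theta> x) * (cnj (partial i \<phi> x) * partial i \<phi> x + cnj (\<phi> x) * partial i (partial i \<phi>) x))"
  shows "integrable lborel D" "integral\<^sup>L lborel D = 0"
proof -
  obtain R where R: "\<And>x. norm x > R \<Longrightarrow> \<phi> x = 0" using \<phi> by (auto simp: test_function_iff)
  let ?D = "\<lambda>i x. of_real (\<theta>' i x) * (cnj (\<phi> x) * partial i \<phi> x) +
      of_real (\<theta> x) * (cnj (partial i \<phi> x) * partial i \<phi> x + cnj (\<phi> x) * partial i (partial i \<phi>) x)"
  let ?F = "\<lambda>i x. of_real (\<theta> x) * (cnj (\<phi> x) * partial i \<phi> x)"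
  note sm = test_function_smooth[OF \<phi>]
  have P: "has_partial (?F i) i x (?D i x)" for i x
    by (intro has_partial_mult has_partial_linear[OF bounded_linear_of_real] \<theta>'
        has_partial_linear[OF bounded_linear_cnj] smooth_has_partial smooth_partial sm)
  have F: "continuous_on UNIV (?F i)" and D: "continuous_on UNIV (?D i)" for i
    by (intro continuous_intros cont smooth_continuous smooth_partial sm)+
  have F0: "?F i x = 0" if "norm x > R" for i x using R[OF that] by simp
  have int: "integrable lborel (?D i)" for i
    by (rule integrable_compact_support[OF D has_partial_eq_0_outside[of R, OF F0 P]])
  have zero: "integral\<^sup>L lborel (?D i) = 0" for i
    by (rule integral_partial_compact_support[OF P F D F0])
  show "integrable lborel D" unfolding D_def by (intro Bochner_Integration.integrable_sum int)
  show "integral\<^sup>L lborel D = 0" unfolding D_def by (subst Bochner_Integration.integral_sum) (simp_all add: int zero)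
qed

text \<open>The difference of the two integrands in direction i is the i-th derivative of
  \<open>partial i u * \<phi> - u * partial i \<phi>\<close>, because the products of first
  derivatives cancel.\<close>

lemma laplacian_symmetric:
  fixes u \<phi> :: "real^'n \<Rightarrow> complex"
  assumes u: "u \<in> schwartz" and \<phi>: "\<phi> \<in> schwartz"
  shows "(LINT x|lborel. laplacian u x * \<phi> x) = (LINT x|lborel. u x * laplacian \<phi> x)"
proof -
  note s = schwartz_partial[OF u] schwartz_partial[OF \<phi>] schwartz_partial[OF schwartz_partial[OF u]] schwartz_partial[OF schwartz_partial[OF \<phi>]]
  have int: "integrable lborel (\<lambda>x. a x * b x)" if "a \<in> schwartz" "b \<in> schwartz" for a b :: "real^'n \<Rightarrow> complex"
    using that by (intro L2_integrable_mult schwartz_L2)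
  have "(LINT x|lborel. partial i (partial i u) x * \<phi> x - u x * partial i (partial i \<phi>) x) = 0" for i
  proof (rule integral_partial_eq_0)
    show "integrable lborel (\<lambda>x. partial i u x * \<phi> x - u x * partial i \<phi> x)"
      by (intro Bochner_Integration.integrable_diff int u \<phi> s)
    show "integrable lborel (\<lambda>x. partial i (partial i u) x * \<phi> x - u x * partial i (partial i \<phi>) x)"
      by (intro Bochner_Integration.integrable_diff int u \<phi> s)
    show "continuous_on UNIV (\<lambda>x. partial i (partial i u) x * \<phi> x - u x * partial i (partial i \<phi>) x)"
      by (intro continuous_intros schwartz_continuous u \<phi> s)
    show "has_partial (\<lambda>x. partial i u x * \<phi> x - u x * partial i \<phi> x) i x
        (partial i (partial i u) x * \<phi> x - u x * partial i (partial i \<phi>) x)" for x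
    proof -
      have "has_partial (\<lambda>x. partial i u x * \<phi> x - u x * partial i \<phi> x) i x
          ((partial i (partial i u) x * \<phi> x + partial i u x * partial i \<phi> x) -
           (partial i u x * partial i \<phi> x + u x * partial i (partial i \<phi>) x))"
        by (intro has_partial_diff has_partial_mult schwartz_has_partial u \<phi> s)
      then show ?thesis by simp
    qed
  qed
  then have "(LINT x|lborel. partial i (partial i u) x * \<phi> x) = (LINT x|lborel. u x * partial i (partial i \<phi>) x)" for i
    by (subst (asm) Bochner_Integration.integral_diff) (auto intro!: int u \<phi> s)
  then show ?thesis
    unfolding laplacian_def sum_distrib_left sum_distrib_right
    by (subst (1 2) Bochner_Integration.integral_sum) (auto intro!: int u \<phi> s)
qed

lemma schroedinger_symmetric:
  fixes u \<phi> V :: "real^'n \<Rightarrow> complex"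
  assumes V: "slow_growth V" and u: "u \<in> schwartz" and \<phi>: "\<phi> \<in> schwartz"
  shows "(LINT x|lborel. schroedinger \<eta> V u x * \<phi> x) = (LINT x|lborel. u x * schroedinger \<eta> V \<phi> x)"
proof -
  let ?c = "- of_real (\<eta>\<^sup>2) :: complex"
  have int: "integrable lborel (\<lambda>x. a x * b x)" if "a \<in> schwartz" "b \<in> schwartz" for a b :: "real^'n \<Rightarrow> complex"
    using that by (intro L2_integrable_mult schwartz_L2)
  have Vu: "integrable lborel (\<lambda>x. V x * u x * \<phi> x)" using int[OF schwartz_mult[OF V u] \<phi>] .
  have "(LINT x|lborel. schroedinger \<eta> V u x * \<phi> x) = (LINT x|lborel. ?c * (laplacian u x * \<phi> x) + V x * u x * \<phi> x)"
    by (intro Bochner_Integration.integral_cong refl) (simp add: schroedinger_def algebra_simps)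
  also have "\<dots> = ?c * (LINT x|lborel. laplacian u x * \<phi> x) + (LINT x|lborel. V x * u x * \<phi> x)"
    by (subst Bochner_Integration.integral_add)
       (auto intro!: integrable_mult_right int schwartz_laplacian u \<phi> Vu simp del: mult_minus_left)
  also have "\<dots> = ?c * (LINT x|lborel. u x * laplacian \<phi> x) + (LINT x|lborel. V x * u x * \<phi> x)"
    by (simp only: laplacian_symmetric[OF u \<phi>])
  also have "\<dots> = (LINT x|lborel. ?c * (u x * laplacian \<phi> x) + V x * u x * \<phi> x)"
    by (subst Bochner_Integration.integral_add)
       (auto intro!: integrable_mult_right int schwartz_laplacian u \<phi> Vu simp del: mult_minus_left)
  also have "\<dots> = (LINT x|lborel. u x * schroedinger \<eta> V \<phi> x)"
    by (intro Bochner_Integration.integral_cong refl) (simp add: schroedinger_def algebra_simps)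
  finally show ?thesis .
qed

section \<open>The graphs of the operator and the passage to their closures\<close>

definition schroedinger_graph :: "real \<Rightarrow> (real^'n \<Rightarrow> complex) \<Rightarrow> (real^'n \<Rightarrow> complex) set \<Rightarrow> 'n L2_graph" where
  "schroedinger_graph \<eta> V S = {(u, schroedinger \<eta> V u) | u. u \<in> S}"

text \<open>The maximal realization. The operator moves to the test function without conjugation, as
  it is its own transpose. Elements are functions, so every representative of a class
  occurs.\<close>

definition weak_graph :: "real \<Rightarrow> (real^'n \<Rightarrow> complex) \<Rightarrow> 'n L2_graph" where
  "weak_graph \<eta> V = {(u, f). u \<in> L2 \<and> f \<in> L2 \<and>
    (\<forall>\<phi>\<in>test_function. (LINT x|lborel. u x * schroedinger \<eta> V \<phi> x) = (LINT x|lborel. f x * \<phi> x))}"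

lemma L2_closure_mono: "G \<subseteq> H \<Longrightarrow> L2_closure G \<subseteq> L2_closure H"
  unfolding L2_closure_def by blast

text \<open>Graphs consist of functions rather than classes, so membership in a closure has to be
  transported between representatives by hand.\<close>

lemma L2_closure_cong_AE:
  assumes "(v, g) \<in> L2_closure G" and u: "u \<in> L2" and f: "f \<in> L2"
    and "AE x in lborel. u x = v x" and "AE x in lborel. f x = g x"
  shows "(u, f) \<in> L2_closure G"
proof -
  obtain a b where ab: "\<And>k::nat. (a k, b k) \<in> G \<and> a k \<in> L2 \<and> b k \<in> L2"
    and lim: "(\<lambda>k. L2_norm (\<lambda>x. a k x - v x)) \<longlonglongrightarrow> 0" "(\<lambda>k. L2_norm (\<lambda>x. b k x - g x)) \<longlonglongrightarrow> 0"
    and vg: "v \<in> L2" "g \<in> L2"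
    using assms(1) unfolding L2_closure_def by blast
  have eq: "L2_norm (\<lambda>x. c x - w x) = L2_norm (\<lambda>x. c x - w' x)"
    if "c \<in> L2" "w \<in> L2" "w' \<in> L2" "AE x in lborel. w x = w' x" for c w w' :: "real^'a \<Rightarrow> complex"
    using that(4) L2_measurable[OF that(1)] L2_measurable[OF that(2)] L2_measurable[OF that(3)]
    by (intro L2_norm_cong_AE) auto
  have eqs: "L2_norm (\<lambda>x. a k x - u x) = L2_norm (\<lambda>x. a k x - v x)" "L2_norm (\<lambda>x. b k x - f x) = L2_norm (\<lambda>x. b k x - g x)" for k
    using eq[of "a k" u v] eq[of "b k" f g] ab[of k] u f vg assms(4,5) by blast+
  show ?thesis unfolding L2_closure_def mem_Collect_eq prod.case
    by (intro conjI exI[of _ a] exI[of _ b] u f) (use ab in blast, simp_all only: eqs lim)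
qed

text \<open>On Schwartz functions P can be moved to \<phi>, and both pairings are continuous in the
  \<open>L2\<close> norm.\<close>

lemma closure_subset_weak_graph:
  assumes V: "slow_growth V"
  shows "L2_closure (schroedinger_graph \<eta> V schwartz) \<subseteq> weak_graph \<eta> V"
proof
  fix w assume "w \<in> L2_closure (schroedinger_graph \<eta> V schwartz)"
  then obtain u f a b where w: "w = (u, f)" and uf: "u \<in> L2" "f \<in> L2"
    and ab: "\<And>k::nat. (a k, b k) \<in> schroedinger_graph \<eta> V schwartz"
    and lim: "(\<lambda>k. L2_norm (\<lambda>x. a k x - u x)) \<longlonglongrightarrow> 0" "(\<lambda>k. L2_norm (\<lambda>x. b k x - f x)) \<longlonglongrightarrow> 0"
    unfolding L2_closure_def by blast
  have a: "a k \<in> schwartz" and b: "b k = schroedinger \<eta> V (a k)" for k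
    using ab[of k] by (auto simp: schroedinger_graph_def)
  have aL: "a k \<in> L2" and bL: "b k \<in> L2" for k
    unfolding b by (intro schwartz_L2 schwartz_schroedinger V a)+
  have "(LINT x|lborel. u x * schroedinger \<eta> V \<phi> x) = (LINT x|lborel. f x * \<phi> x)" if "\<phi> \<in> test_function" for \<phi>
  proof (rule LIMSEQ_unique)
    have \<phi>: "\<phi> \<in> schwartz" by (rule test_function_schwartz[OF that])
    show "(\<lambda>k. LINT x|lborel. b k x * \<phi> x) \<longlonglongrightarrow> (LINT x|lborel. f x * \<phi> x)"
      by (rule L2_pairing_tendsto[OF bL uf(2) lim(2) schwartz_L2[OF \<phi>]])
    show "(\<lambda>k. LINT x|lborel. b k x * \<phi> x) \<longlonglongrightarrow> (LINT x|lborel. u x * schroedinger \<eta> V \<phi> x)"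
      unfolding b schroedinger_symmetric[OF V a \<phi>]
      by (rule L2_pairing_tendsto[OF aL uf(1) lim(1) schwartz_L2[OF schwartz_schroedinger[OF V \<phi>]]])
  qed
  then show "w \<in> weak_graph \<eta> V" using uf by (simp add: w weak_graph_def)
qed

text \<open>Both sides of the bound are continuous along sequences that converge in the graph
  norm.\<close>

lemma closure_estimate:
  assumes V: "slow_growth V"
    and est: "\<And>\<phi>. \<phi> \<in> test_function \<Longrightarrow> L2_norm \<phi> \<le> c * L2_norm (\<lambda>x. schroedinger \<eta> V \<phi> x - z * \<phi> x)"
    and uf: "(u, f) \<in> L2_closure (schroedinger_graph \<eta> V test_function)"
  shows "L2_norm u \<le> c * L2_norm (\<lambda>x. f x - z * u x)"
proof -
  obtain a b where uf: "u \<in> L2" "f \<in> L2"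
    and ab: "\<And>k::nat. (a k, b k) \<in> schroedinger_graph \<eta> V test_function \<and> a k \<in> L2 \<and> b k \<in> L2"
    and lim: "(\<lambda>k. L2_norm (\<lambda>x. a k x - u x)) \<longlonglongrightarrow> 0" "(\<lambda>k. L2_norm (\<lambda>x. b k x - f x)) \<longlonglongrightarrow> 0"
    using uf unfolding L2_closure_def by blast
  have aL: "a k \<in> L2" and bL: "b k \<in> L2" for k using ab by blast+
  have le: "L2_norm (a k) \<le> c * L2_norm (\<lambda>x. b k x - z * a k x)" for k
    using ab[of k] est by (auto simp: schroedinger_graph_def)
  have d: "(\<lambda>k. L2_norm (\<lambda>x. (b k x - z * a k x) - (f x - z * u x))) \<longlonglongrightarrow> 0"
  proof (rule Lim_null_comparison[OF always_eventually[OF allI]])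
    show "(\<lambda>k. L2_norm (\<lambda>x. b k x - f x) + norm z * L2_norm (\<lambda>x. a k x - u x)) \<longlonglongrightarrow> 0"
      using tendsto_add[OF lim(2) tendsto_mult_left[OF lim(1), of "norm z"]] by simp
    fix k
    have "L2_norm (\<lambda>x. (b k x - z * a k x) - (f x - z * u x)) = L2_norm (\<lambda>x. (b k x - f x) + (- z) * (a k x - u x))"
      by (simp add: algebra_simps)
    also have "\<dots> \<le> L2_norm (\<lambda>x. b k x - f x) + L2_norm (\<lambda>x. (- z) * (a k x - u x))"
      by (intro L2_norm_triangle L2_diff L2_scale aL bL uf)
    also have "L2_norm (\<lambda>x. (- z) * (a k x - u x)) = norm z * L2_norm (\<lambda>x. a k x - u x)"
      by (subst L2_norm_scale) simp
    finally show "norm (L2_norm (\<lambda>x. (b k x - z * a k x) - (f x - z * u x))) \<le>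
        L2_norm (\<lambda>x. b k x - f x) + norm z * L2_norm (\<lambda>x. a k x - u x)"
      by (simp only: real_norm_def abs_of_nonneg[OF L2_norm_nonneg])
  qed
  have "(\<lambda>k. c * L2_norm (\<lambda>x. b k x - z * a k x)) \<longlonglongrightarrow> c * L2_norm (\<lambda>x. f x - z * u x)"
    by (intro tendsto_mult tendsto_const L2_norm_tendsto L2_diff L2_scale aL bL uf d)
  then show ?thesis
    using LIMSEQ_le[OF L2_norm_tendsto[OF aL uf(1) lim(1)]] le by blast
qed

text \<open>A function annihilating (P - z) \<phi> for all test functions solves P w = z w weakly,
  because the bilinear transpose of P is P; no adjoint operator enters. Weak injectivity therefore
  makes the range dense, and the a priori bound turns converging right-hand sides into a Cauchy
  sequence of test functions.\<close>

lemma closure_range: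
  fixes V :: "real^'n \<Rightarrow> complex"
  assumes V: "slow_growth V" and c: "0 \<le> c"
    and est: "\<And>\<phi>. \<phi> \<in> test_function \<Longrightarrow> L2_norm \<phi> \<le> c * L2_norm (\<lambda>x. schroedinger \<eta> V \<phi> x - z * \<phi> x)"
    and inj: "\<And>w. (w, \<lambda>x. z * w x) \<in> weak_graph \<eta> V \<Longrightarrow> AE x in lborel. w x = 0"
    and f: "f \<in> L2"
  shows "\<exists>u. (u, \<lambda>x. f x + z * u x) \<in> L2_closure (schroedinger_graph \<eta> V test_function)"
proof -
  define Q where "Q \<phi> = (\<lambda>x. schroedinger \<eta> V \<phi> x - z * \<phi> x)" for \<phi>
  have P_L2: "schroedinger \<eta> V \<phi> \<in> L2" if "\<phi> \<in> test_function" for \<phi>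
    by (intro schwartz_L2 schwartz_schroedinger V test_function_schwartz that)
  have Q_L2: "Q \<phi> \<in> L2" if "\<phi> \<in> test_function" for \<phi>
    unfolding Q_def by (intro L2_diff L2_scale P_L2 test_function_L2 that)
  have lin: "Q (\<lambda>x. a * \<phi> x + b * \<psi> x) = (\<lambda>x. a * Q \<phi> x + b * Q \<psi> x)"
    if "\<phi> \<in> test_function" "\<psi> \<in> test_function" for a b \<phi> \<psi>
    using that by (simp add: Q_def fun_eq_iff schroedinger_lincomb test_function_smooth algebra_simps)
  have zero: "(\<lambda>x. 0) \<in> test_function" by (simp add: test_function_iff smooth_const)
  have "\<exists>s. (\<forall>k::nat. s k \<in> Q ` test_function) \<and> (\<lambda>k. L2_norm (\<lambda>x. s k x - f x)) \<longlonglongrightarrow> 0"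
  proof (rule L2_dense_if_annihilator_trivial[OF _ _ _ _ f])
    show "Q ` test_function \<subseteq> L2" using Q_L2 by blast
    have "Q (\<lambda>x. 0) = (\<lambda>x. 0)" using lin[OF zero zero, of 0 0] by simp
    then show "(\<lambda>x. 0) \<in> Q ` test_function" using zero by (metis imageI)
    show "(\<lambda>x. a * s x + b * t x) \<in> Q ` test_function" if st: "s \<in> Q ` test_function" "t \<in> Q ` test_function" for s t a b
    proof -
      obtain \<phi> \<psi> where *: "\<phi> \<in> test_function" "\<psi> \<in> test_function" "s = Q \<phi>" "t = Q \<psi>" using st by blast
      show ?thesis unfolding *(3,4) lin[OF *(1,2), symmetric] by (intro imageI test_function_lincomb *)
    qed
    show "AE x in lborel. w x = 0" if w: "w \<in> L2" and ann: "\<And>s. s \<in> Q ` test_function \<Longrightarrow> (LINT x|lborel. w x * s x) = 0" for w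
    proof (rule inj)
      have "(LINT x|lborel. w x * schroedinger \<eta> V \<phi> x) = (LINT x|lborel. z * w x * \<phi> x)" if \<phi>: "\<phi> \<in> test_function" for \<phi>
      proof -
        have "0 = (LINT x|lborel. w x * schroedinger \<eta> V \<phi> x - z * w x * \<phi> x)"
          using ann[OF imageI[OF \<phi>]] by (simp add: Q_def algebra_simps)
        also have "\<dots> = (LINT x|lborel. w x * schroedinger \<eta> V \<phi> x) - (LINT x|lborel. z * w x * \<phi> x)"
          by (intro Bochner_Integration.integral_diff L2_integrable_mult L2_scale w P_L2 test_function_L2 \<phi>)
        finally show ?thesis by simp
      qed
      then show "(w, \<lambda>x. z * w x) \<in> weak_graph \<eta> V"
        using w L2_scale[OF w] by (simp add: weak_graph_def)
    qed
  qed
  then obtain s where s: "\<And>k. s k \<in> Q ` test_function" and slim: "(\<lambda>k. L2_norm (\<lambda>x. s k x - f x)) \<longlonglongrightarrow> 0" by blast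
  have "\<exists>\<phi>. \<phi> \<in> test_function \<and> s k = Q \<phi>" for k using s[of k] by blast
  then obtain \<phi> where \<phi>: "\<And>k. \<phi> k \<in> test_function" and sQ: "\<And>k. s k = Q (\<phi> k)" by metis
  have sL: "s k \<in> L2" for k unfolding sQ by (rule Q_L2[OF \<phi>])
  have diff: "L2_norm (\<lambda>x. \<phi> m x - \<phi> n x) \<le> c * L2_norm (\<lambda>x. s m x - s n x)" for m n
  proof -
    have t: "(\<lambda>x. 1 * \<phi> m x + (-1) * \<phi> n x) \<in> test_function" by (intro test_function_lincomb \<phi>)
    have "L2_norm (\<lambda>x. 1 * \<phi> m x + (-1) * \<phi> n x) \<le> c * L2_norm (Q (\<lambda>x. 1 * \<phi> m x + (-1) * \<phi> n x))"
      unfolding Q_def by (rule est[OF t])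
    then show ?thesis unfolding lin[OF \<phi> \<phi>] sQ by simp
  qed
  have "\<exists>u\<in>L2. (\<lambda>k. L2_norm (\<lambda>x. \<phi> k x - u x)) \<longlonglongrightarrow> 0"
  proof (rule L2_complete)
    show "\<phi> k \<in> L2" for k by (rule test_function_L2[OF \<phi>])
    fix e :: real assume e: "0 < e"
    \<comment> \<open>c + 1 instead of c, since c may be 0.\<close>
    define d where "d = e / (2 * (c + 1))"
    have d: "0 < d" "c * (2 * d) \<le> e"
      unfolding d_def using e c by (simp_all add: field_simps)
    obtain N where N: "\<And>k. k \<ge> N \<Longrightarrow> L2_norm (\<lambda>x. s k x - f x) < d"
      using order_tendstoD(2)[OF slim d(1)] unfolding eventually_sequentially by blast
    have "L2_norm (\<lambda>x. \<phi> m x - \<phi> n x) \<le> e" if "m \<ge> N" "n \<ge> N" for m n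
    proof -
      have "L2_norm (\<lambda>x. s m x - s n x) \<le> L2_norm (\<lambda>x. s m x - f x) + L2_norm (\<lambda>x. f x - s n x)"
        by (rule L2_norm_triangle_diff[OF sL f sL])
      also have "\<dots> \<le> 2 * d"
        using N[OF that(1)] N[OF that(2)] L2_norm_diff_commute[of f "s n"] by linarith
      finally have "c * L2_norm (\<lambda>x. s m x - s n x) \<le> c * (2 * d)" using c by (intro mult_left_mono)
      then show ?thesis using diff[of m n] d(2) by linarith
    qed
    then show "\<exists>N. \<forall>m\<ge>N. \<forall>n\<ge>N. L2_norm (\<lambda>x. \<phi> m x - \<phi> n x) \<le> e" by blast
  qed
  then obtain u where u: "u \<in> L2" and ulim: "(\<lambda>k. L2_norm (\<lambda>x. \<phi> k x - u x)) \<longlonglongrightarrow> 0" by blast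
  have plim: "(\<lambda>k. L2_norm (\<lambda>x. schroedinger \<eta> V (\<phi> k) x - (f x + z * u x))) \<longlonglongrightarrow> 0"
  proof (rule Lim_null_comparison[OF always_eventually[OF allI]])
    show "(\<lambda>k. L2_norm (\<lambda>x. s k x - f x) + norm z * L2_norm (\<lambda>x. \<phi> k x - u x)) \<longlonglongrightarrow> 0"
      using tendsto_add[OF slim tendsto_mult_left[OF ulim, of "norm z"]] by simp
    fix k
    have "L2_norm (\<lambda>x. schroedinger \<eta> V (\<phi> k) x - (f x + z * u x)) = L2_norm (\<lambda>x. (s k x - f x) + z * (\<phi> k x - u x))"
      by (simp add: sQ Q_def algebra_simps)
    also have "\<dots> \<le> L2_norm (\<lambda>x. s k x - f x) + L2_norm (\<lambda>x. z * (\<phi> k x - u x))"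
      by (intro L2_norm_triangle L2_diff L2_scale sL f u test_function_L2 \<phi>)
    finally show "norm (L2_norm (\<lambda>x. schroedinger \<eta> V (\<phi> k) x - (f x + z * u x))) \<le>
        L2_norm (\<lambda>x. s k x - f x) + norm z * L2_norm (\<lambda>x. \<phi> k x - u x)"
      by (simp only: real_norm_def abs_of_nonneg[OF L2_norm_nonneg] L2_norm_scale)
  qed
  have "\<exists>v g. (\<forall>k::nat. (v k, g k) \<in> schroedinger_graph \<eta> V test_function \<and> v k \<in> L2 \<and> g k \<in> L2) \<and>
      (\<lambda>k. L2_norm (\<lambda>x. v k x - u x)) \<longlonglongrightarrow> 0 \<and> (\<lambda>k. L2_norm (\<lambda>x. g k x - (f x + z * u x))) \<longlonglongrightarrow> 0"
  proof (rule exI[of _ \<phi>], rule exI[of _ "\<lambda>k. schroedinger \<eta> V (\<phi> k)"], intro conjI allI)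
    show "(\<phi> k, schroedinger \<eta> V (\<phi> k)) \<in> schroedinger_graph \<eta> V test_function" for k
      unfolding schroedinger_graph_def using \<phi> by blast
  qed (intro test_function_L2 P_L2 \<phi> ulim plim)+
  then have "(u, \<lambda>x. f x + z * u x) \<in> L2_closure (schroedinger_graph \<eta> V test_function)"
    unfolding L2_closure_def using u L2_add[OF f L2_scale[OF u]] by blast
  then show ?thesis by blast
qed

section \<open>Energy and dissipativity on test functions; equality of the realizations\<close>

lemma schroedinger_pairing:
  fixes V :: "real^'n \<Rightarrow> complex"
  assumes V: "slow_growth V" and \<phi>: "\<phi> \<in> test_function"
  shows "(\<lambda>x. schroedinger \<eta> V \<phi> x - z * \<phi> x) \<in> L2"
    "integrable lborel (\<lambda>x. norm (\<phi> x) * norm (schroedinger \<eta> V \<phi> x - z * \<phi> x))"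
    "(LINT x|lborel. norm (\<phi> x) * norm (schroedinger \<eta> V \<phi> x - z * \<phi> x)) \<le>
      L2_norm \<phi> * L2_norm (\<lambda>x. schroedinger \<eta> V \<phi> x - z * \<phi> x)"
proof -
  show *: "(\<lambda>x. schroedinger \<eta> V \<phi> x - z * \<phi> x) \<in> L2"
    by (intro L2_diff L2_scale schwartz_L2 schwartz_schroedinger V test_function_schwartz \<phi>)
  show "integrable lborel (\<lambda>x. norm (\<phi> x) * norm (schroedinger \<eta> V \<phi> x - z * \<phi> x))"
    using integrable_norm[OF L2_integrable_mult[OF test_function_L2[OF \<phi>] *]] by (simp add: norm_mult)
  show "(LINT x|lborel. norm (\<phi> x) * norm (schroedinger \<eta> V \<phi> x - z * \<phi> x)) \<le>
      L2_norm \<phi> * L2_norm (\<lambda>x. schroedinger \<eta> V \<phi> x - z * \<phi> x)"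
    by (rule L2_Cauchy_Schwarz[OF test_function_L2[OF \<phi>] *])
qed

text \<open>The real part of the pairing of (P - z) \<phi> with the conjugate of \<phi>, integrated
  with the Green identity for the constant weight 1; the nonnegative term with Re V is
  dropped.\<close>

lemma energy_estimate:
  fixes V :: "real^'n \<Rightarrow> complex"
  assumes V: "slow_growth V" and V_nonneg: "\<And>x. 0 \<le> Re (V x)" and \<phi>: "\<phi> \<in> test_function"
  shows "integrable lborel (\<lambda>x. \<eta>\<^sup>2 * (\<Sum>i\<in>UNIV. (norm (partial i \<phi> x))\<^sup>2))"
    "(LINT x|lborel. \<eta>\<^sup>2 * (\<Sum>i\<in>UNIV. (norm (partial i \<phi> x))\<^sup>2)) \<le>
      L2_norm \<phi> * L2_norm (\<lambda>x. schroedinger \<eta> V \<phi> x - z * \<phi> x) + Re z * (L2_norm \<phi>)\<^sup>2"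
proof -
  let ?f = "\<lambda>x. schroedinger \<eta> V \<phi> x - z * \<phi> x"
  let ?D = "\<lambda>x. (\<Sum>i\<in>UNIV. of_real 0 * (cnj (\<phi> x) * partial i \<phi> x) +
      of_real 1 * (cnj (partial i \<phi> x) * partial i \<phi> x + cnj (\<phi> x) * partial i (partial i \<phi>) x)) :: complex"
  have D: "integrable lborel ?D" "integral\<^sup>L lborel ?D = 0"
    by (intro green_identity[OF \<phi>, of "\<lambda>x. 1" "\<lambda>i x. 0"] has_partial_const continuous_on_const)+
  show int: "integrable lborel (\<lambda>x. \<eta>\<^sup>2 * (\<Sum>i\<in>UNIV. (norm (partial i \<phi> x))\<^sup>2))"
    by (intro integrable_mult_right Bochner_Integration.integrable_sum L2_integrable test_function_L2 test_function_partial \<phi>)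
  have ReD: "integrable lborel (\<lambda>x. Re (?D x))" "(LINT x|lborel. Re (?D x)) = 0"
    using integrable_Re[OF D(1)] integral_Re[OF D(1)] D(2) by simp_all
  note pair = schroedinger_pairing[OF V \<phi>, of \<eta> z]
  have pointwise: "\<eta>\<^sup>2 * (\<Sum>i\<in>UNIV. (norm (partial i \<phi> x))\<^sup>2) \<le>
      norm (\<phi> x) * norm (?f x) + \<eta>\<^sup>2 * Re (?D x) + Re z * (norm (\<phi> x))\<^sup>2" for x
  proof -
    have "Re (?D x) = (\<Sum>i\<in>UNIV. (norm (partial i \<phi> x))\<^sup>2) + Re (cnj (\<phi> x) * laplacian \<phi> x)"
      unfolding laplacian_def
      by (simp add: cmod_power2) (simp add: sum.distrib sum_distrib_left power2_eq_square)
    moreover have "Re (cnj (\<phi> x) * ?f x) = - \<eta>\<^sup>2 * Re (cnj (\<phi> x) * laplacian \<phi> x) + (Re (V x) - Re z) * (norm (\<phi> x))\<^sup>2"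
      unfolding schroedinger_def by (simp add: cmod_power2) (simp add: power2_eq_square algebra_simps)
    moreover have "Re (cnj (\<phi> x) * ?f x) \<le> norm (\<phi> x) * norm (?f x)"
      using complex_Re_le_cmod[of "cnj (\<phi> x) * ?f x"] unfolding norm_mult complex_mod_cnj .
    moreover have "0 \<le> Re (V x) * (norm (\<phi> x))\<^sup>2" by (intro mult_nonneg_nonneg V_nonneg) auto
    ultimately show ?thesis by (simp only: algebra_simps)
  qed
  have N: "integrable lborel (\<lambda>x. (norm (\<phi> x))\<^sup>2)" by (rule L2_integrable[OF test_function_L2[OF \<phi>]])
  have "(LINT x|lborel. \<eta>\<^sup>2 * (\<Sum>i\<in>UNIV. (norm (partial i \<phi> x))\<^sup>2)) \<le>
      (LINT x|lborel. norm (\<phi> x) * norm (?f x) + \<eta>\<^sup>2 * Re (?D x) + Re z * (norm (\<phi> x))\<^sup>2)"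
    by (intro integral_mono int pointwise Bochner_Integration.integrable_add integrable_mult_right pair ReD(1) N)
  also have "\<dots> = (LINT x|lborel. norm (\<phi> x) * norm (?f x)) + \<eta>\<^sup>2 * (LINT x|lborel. Re (?D x)) + Re z * (LINT x|lborel. (norm (\<phi> x))\<^sup>2)"
    using pair(2) ReD(1) N
      Bochner_Integration.integral_add[OF Bochner_Integration.integrable_add[OF pair(2) integrable_mult_right[OF ReD(1), of "\<eta>\<^sup>2"]] integrable_mult_right[OF N, of "Re z"]]
      Bochner_Integration.integral_add[OF pair(2) integrable_mult_right[OF ReD(1), of "\<eta>\<^sup>2"]]
    by (simp only: Bochner_Integration.integral_mult_right)
  also have "\<dots> \<le> L2_norm \<phi> * L2_norm ?f + Re z * (L2_norm \<phi>)\<^sup>2"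
    unfolding ReD(2) L2_norm_power2 using pair(3) by simp
  finally show "(LINT x|lborel. \<eta>\<^sup>2 * (\<Sum>i\<in>UNIV. (norm (partial i \<phi> x))\<^sup>2)) \<le>
      L2_norm \<phi> * L2_norm (\<lambda>x. schroedinger \<eta> V \<phi> x - z * \<phi> x) + Re z * (L2_norm \<phi>)\<^sup>2" .
qed

text \<open>Drop the gradient term from the energy inequality and divide by the norm of \<phi>.
  Useful where Re z is negative.\<close>

lemma dissipative_estimate:
  fixes V :: "real^'n \<Rightarrow> complex"
  assumes V: "slow_growth V" and V_nonneg: "\<And>x. 0 \<le> Re (V x)" and \<phi>: "\<phi> \<in> test_function"
  shows "- Re z * L2_norm \<phi> \<le> L2_norm (\<lambda>x. schroedinger \<eta> V \<phi> x - z * \<phi> x)"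
proof (cases "L2_norm \<phi> = 0")
  case True
  then show ?thesis by (simp add: L2_norm_nonneg)
next
  case False
  then have pos: "0 < L2_norm \<phi>" using L2_norm_nonneg[of \<phi>] by linarith
  have "0 \<le> (LINT x|lborel. \<eta>\<^sup>2 * (\<Sum>i\<in>UNIV. (norm (partial i \<phi> x))\<^sup>2))"
    by (intro Bochner_Integration.integral_nonneg mult_nonneg_nonneg sum_nonneg) auto
  also note energy_estimate(2)[OF V V_nonneg \<phi>, of \<eta> z]
  finally have "L2_norm \<phi> * (- Re z * L2_norm \<phi>) \<le> L2_norm \<phi> * L2_norm (\<lambda>x. schroedinger \<eta> V \<phi> x - z * \<phi> x)"
    by (simp add: power2_eq_square mult_ac)
  then show ?thesis using pos by (rule mult_left_le_imp_le)
qed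

text \<open>Only z = -1 enters. Given (u, f) in the weak graph, solve (P + 1) v = f + u within the
  closure taken from test functions. Then u - v is a weak null solution of P + 1 and vanishes, so
  (u, f) agrees almost everywhere with an element of that closure. Test functions thus form a
  core.\<close>

lemma weak_graph_eq_closure:
  fixes V :: "real^'n \<Rightarrow> complex"
  assumes V: "slow_growth V" and V_nonneg: "\<And>x. 0 \<le> Re (V x)"
  shows "weak_graph \<eta> V = L2_closure (schroedinger_graph \<eta> V test_function)"
    "L2_closure (schroedinger_graph \<eta> V schwartz) = weak_graph \<eta> V"
proof -
  let ?C = "L2_closure (schroedinger_graph \<eta> V test_function)"
  have V_cont: "continuous_on UNIV V" using V by (simp add: slow_growth_def smooth_continuous)
  have sub: "?C \<subseteq> L2_closure (schroedinger_graph \<eta> V schwartz)"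
    by (rule L2_closure_mono) (auto simp: schroedinger_graph_def test_function_schwartz)
  note sub2 = closure_subset_weak_graph[OF V, of \<eta>]
  have P_L2: "schroedinger \<eta> V \<phi> \<in> L2" if "\<phi> \<in> test_function" for \<phi>
    by (intro schwartz_L2 schwartz_schroedinger V test_function_schwartz that)
  have inj: "AE x in lborel. w x = 0" if w: "(w, \<lambda>x. (-1) * w x) \<in> weak_graph \<eta> V" for w
  proof (rule weak_null_solution_zero[OF _ V_cont V_nonneg])
    show wL: "w \<in> L2" using w by (simp add: weak_graph_def)
    fix \<phi> :: "real^'n \<Rightarrow> complex" assume \<phi>: "\<phi> \<in> test_function"
    have eq: "(LINT x|lborel. w x * schroedinger \<eta> V \<phi> x) = (LINT x|lborel. (-1) * w x * \<phi> x)"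
      using w \<phi> by (simp add: weak_graph_def)
    have "(LINT x|lborel. w x * (schroedinger \<eta> V \<phi> x + \<phi> x)) = (LINT x|lborel. w x * schroedinger \<eta> V \<phi> x) + (LINT x|lborel. w x * \<phi> x)"
      unfolding distrib_left
      by (intro Bochner_Integration.integral_add L2_integrable_mult wL P_L2 test_function_L2 \<phi>)
    then show "(LINT x|lborel. w x * (schroedinger \<eta> V \<phi> x + \<phi> x)) = 0" using eq by simp
  qed
  have est: "L2_norm \<phi> \<le> 1 * L2_norm (\<lambda>x. schroedinger \<eta> V \<phi> x - (-1) * \<phi> x)" if "\<phi> \<in> test_function" for \<phi>
    using dissipative_estimate[OF V V_nonneg that, of "-1" \<eta>] by simp
  have "w \<in> ?C" if w: "w \<in> weak_graph \<eta> V" for w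
  proof -
    obtain u f where wuf: "w = (u, f)" by (cases w)
    have uf: "u \<in> L2" "f \<in> L2" and weak: "\<And>\<phi>. \<phi> \<in> test_function \<Longrightarrow> (LINT x|lborel. u x * schroedinger \<eta> V \<phi> x) = (LINT x|lborel. f x * \<phi> x)"
      using w by (auto simp: wuf weak_graph_def)
    obtain v where v: "(v, \<lambda>x. (f x + u x) + (-1) * v x) \<in> ?C"
      using closure_range[OF V _ est inj L2_add[OF uf(2,1)]] by auto
    then have "(v, \<lambda>x. (f x + u x) + (-1) * v x) \<in> weak_graph \<eta> V" using sub sub2 by blast
    then have vL: "v \<in> L2" "(\<lambda>x. (f x + u x) + (-1) * v x) \<in> L2"
      and vweak: "\<And>\<phi>. \<phi> \<in> test_function \<Longrightarrow> (LINT x|lborel. v x * schroedinger \<eta> V \<phi> x) = (LINT x|lborel. ((f x + u x) + (-1) * v x) * \<phi> x)"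
      by (auto simp: weak_graph_def)
    have "AE x in lborel. u x - v x = 0"
    proof (rule inj)
      have "(LINT x|lborel. (u x - v x) * schroedinger \<eta> V \<phi> x) = (LINT x|lborel. (-1) * (u x - v x) * \<phi> x)"
        if \<phi>: "\<phi> \<in> test_function" for \<phi>
      proof -
        have "(LINT x|lborel. (u x - v x) * schroedinger \<eta> V \<phi> x) = (LINT x|lborel. f x * \<phi> x) - (LINT x|lborel. ((f x + u x) + (-1) * v x) * \<phi> x)"
          unfolding left_diff_distrib weak[OF \<phi>, symmetric] vweak[OF \<phi>, symmetric]
          by (intro Bochner_Integration.integral_diff L2_integrable_mult uf vL P_L2 \<phi>)
        also have "\<dots> = (LINT x|lborel. f x * \<phi> x - ((f x + u x) + (-1) * v x) * \<phi> x)"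
          by (intro Bochner_Integration.integral_diff[symmetric] L2_integrable_mult uf vL test_function_L2 \<phi>)
        finally show ?thesis by (simp add: algebra_simps)
      qed
      then show "(\<lambda>x. u x - v x, \<lambda>x. (-1) * (u x - v x)) \<in> weak_graph \<eta> V"
        using L2_diff[OF uf(1) vL(1)] L2_scale[OF L2_diff[OF uf(1) vL(1)], of "-1"] by (simp add: weak_graph_def)
    qed
    then have "AE x in lborel. u x = v x" "AE x in lborel. f x = (f x + u x) + (-1) * v x"
      by (auto elim!: AE_mp intro!: AE_I2)
    then show ?thesis unfolding wuf by (intro L2_closure_cong_AE[OF v] uf)
  qed
  then show "weak_graph \<eta> V = ?C" "L2_closure (schroedinger_graph \<eta> V schwartz) = weak_graph \<eta> V"
    using sub sub2 by blast+
qed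

text \<open>The pairings with test functions determine f by the fundamental lemma, so the operator
  is well defined on classes.\<close>

lemma weak_graph_unique:
  fixes V :: "real^'n \<Rightarrow> complex"
  assumes V: "slow_growth V" and "(u, f) \<in> weak_graph \<eta> V" "(v, g) \<in> weak_graph \<eta> V" and uv: "AE x in lborel. u x = v x"
  shows "AE x in lborel. f x = g x"
proof -
  have L: "u \<in> L2" "f \<in> L2" "v \<in> L2" "g \<in> L2" using assms(2,3) by (auto simp: weak_graph_def)
  have "AE x in lborel. f x - g x = 0"
  proof (rule L2_AE_zero_if_test_integrals_zero[OF L2_diff[OF L(2,4)]])
    fix \<phi> :: "real^'n \<Rightarrow> complex" assume \<phi>: "\<phi> \<in> test_function"
    note [measurable] = L2_measurable[OF L(1)] L2_measurable[OF L(3)]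
      schwartz_measurable[OF schwartz_schroedinger[OF V test_function_schwartz[OF \<phi>], of \<eta>]]
    have "(LINT x|lborel. (f x - g x) * \<phi> x) = (LINT x|lborel. f x * \<phi> x) - (LINT x|lborel. g x * \<phi> x)"
      unfolding left_diff_distrib
      by (intro Bochner_Integration.integral_diff L2_integrable_mult L test_function_L2 \<phi>)
    also have "\<dots> = (LINT x|lborel. u x * schroedinger \<eta> V \<phi> x) - (LINT x|lborel. v x * schroedinger \<eta> V \<phi> x)"
      using assms(2,3) \<phi> by (simp add: weak_graph_def)
    also have "(LINT x|lborel. u x * schroedinger \<eta> V \<phi> x) = (LINT x|lborel. v x * schroedinger \<eta> V \<phi> x)"
      using uv by (intro integral_cong_AE) auto
    finally show "(LINT x|lborel. (f x - g x) * \<phi> x) = 0" by simp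
  qed
  then show ?thesis by (auto elim!: AE_mp intro!: AE_I2)
qed

section \<open>The subelliptic estimate\<close>

text \<open>Expand the square of \<epsilon> r a - b and divide by \<epsilon>. In the application r
  is sqrt \<delta>, a is |\<phi>| and b is \<eta> times the size of a derivative of \<phi>.\<close>

lemma young_ineq:
  fixes a b r \<epsilon> :: real
  assumes "0 < \<epsilon>" shows "2 * r * a * b \<le> \<epsilon> * r\<^sup>2 * a\<^sup>2 + b\<^sup>2 / \<epsilon>"
proof -
  have "0 \<le> (\<epsilon> * r * a - b)\<^sup>2 / \<epsilon>" using assms by simp
  also have "(\<epsilon> * r * a - b)\<^sup>2 = \<epsilon> * (\<epsilon> * r\<^sup>2 * a\<^sup>2 - 2 * r * a * b) + b\<^sup>2"
    by (simp add: power2_eq_square algebra_simps)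
  also have "\<dots> / \<epsilon> = \<epsilon> * r\<^sup>2 * a\<^sup>2 - 2 * r * a * b + b\<^sup>2 / \<epsilon>"
    using assms by (simp add: add_divide_distrib)
  finally show ?thesis by simp
qed

lemma abs_div_1_plus_square_le: "\<bar>t\<bar> / (1 + t\<^sup>2) \<le> (1::real)"
proof -
  have "0 \<le> (\<bar>t\<bar> - 1)\<^sup>2" by simp
  then have "2 * \<bar>t\<bar> \<le> 1 + t\<^sup>2" by (simp add: power2_diff)
  then have "\<bar>t\<bar> \<le> 1 + t\<^sup>2" using abs_ge_zero[of t] by linarith
  moreover have "0 < 1 + t\<^sup>2" by (simp add: add_pos_nonneg)
  ultimately show ?thesis by simp
qed

lemma abs_arctan_le_2: "\<bar>arctan t\<bar> \<le> 2"
proof -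
  have "pi / 2 < 2" using pi_less_4 by simp
  then show ?thesis using arctan_lbound[of t] arctan_ubound[of t] by linarith
qed

lemma mult_arctan_nonneg: "0 \<le> t * arctan t"
  by (cases "0 \<le> t") (auto simp: mult_nonneg_nonneg mult_nonpos_nonpos)

text \<open>arctan 1 = pi / 4 is at least 1/2, and arctan is increasing and odd.\<close>

lemma mult_arctan_ge:
  assumes "1 \<le> \<bar>t\<bar>" shows "1/2 \<le> t * arctan t"
proof -
  have "1/2 \<le> pi / 4" using pi_gt3 by simp
  also have "\<dots> = arctan 1" by (simp add: arctan_one)
  also have "\<dots> \<le> arctan \<bar>t\<bar>" unfolding arctan_le_iff by (rule assms)
  finally have "1/2 \<le> arctan \<bar>t\<bar>" .
  then have "1 * (1/2) \<le> \<bar>t\<bar> * arctan \<bar>t\<bar>" using assms by (intro mult_mono) auto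
  also have "\<bar>t\<bar> * arctan \<bar>t\<bar> = t * arctan t" by (simp add: abs_if arctan_minus)
  finally show ?thesis by simp
qed

text \<open>Where \<open>V2 - \<mu>\<close> is small the gradient \<open>g\<close> of \<open>V2\<close> has size at least of order \<open>\<surd>\<Lambda>\<close>, and
  \<open>\<delta> = (\<eta>\<^sup>2 q)^(1/3)\<close> with \<open>q = \<Lambda> + \<bar>g\<bar>\<^sup>2\<close> is the spectral scale of the complex Airy operator
  \<open>(\<eta> D)\<^sup>2 + i \<surd>q t\<close>. The multiplier is a function of \<open>s = (V2 - \<mu>) / \<delta>\<close>, and \<open>X\<close> is a vector field
  whose divergence is bounded below by \<open>\<delta>\<close> on \<open>\<bar>s\<bar> \<le> 1\<close>.\<close>

locale subelliptic =
  fixes V2 :: "real^'n \<Rightarrow> real" and g :: "'n \<Rightarrow> real^'n \<Rightarrow> real" and H :: "'n \<Rightarrow> 'n \<Rightarrow> real^'n \<Rightarrow> real"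
    and B \<eta> \<Lambda> \<mu> \<tau> :: real
  assumes V2_partial: "has_partial V2 i x (g i x)"
    and g_partial: "has_partial (g i) j x (H i j x)"
    and V2_cont: "continuous_on UNIV V2" and g_cont: "continuous_on UNIV (g i)" and H_cont: "continuous_on UNIV (H i j)"
    and H_le: "\<bar>H i j x\<bar> \<le> B"
    and \<eta>_pos: "0 < \<eta>" and lam_pos: "0 < \<Lambda>" and \<tau>_pos: "0 < \<tau>"
    and small: "(\<eta>\<^sup>2 * \<Lambda>) powr (1/3) \<le> \<tau> * \<Lambda>"
    and \<tau>_le: "B * real CARD('n) * \<tau> \<le> 1"
begin

definition "q x = \<Lambda> + (\<Sum>i\<in>UNIV. (g i x)\<^sup>2)"
definition "q' j x = (\<Sum>i\<in>UNIV. 2 * g i x * H i j x)"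
definition "\<delta> x = (\<eta>\<^sup>2 * q x) powr (1/3)"
text \<open>\<delta> is the cube root of a multiple of q, so its logarithmic derivative is one third
  of that of q.\<close>

definition "\<delta>' j x = \<delta> x * q' j x / (3 * q x)"
definition "s x = (V2 x - \<mu>) / \<delta> x"
definition "s' j x = g j x / \<delta> x - s x * q' j x / (3 * q x)"
definition "\<theta> x = arctan (s x)"
definition "\<theta>' j x = s' j x / (1 + (s x)\<^sup>2)"
text \<open>The gradient direction of V2, scaled so that differentiating arctan s along \<delta>^2 g
  / q gives \<delta> |g|^2 / (q (1 + s^2)) to leading order, while the field itself is only of order
  \<eta> sqrt \<delta>.\<close>

definition "X j x = \<theta> x * ((\<delta> x)\<^sup>2 * g j x / q x)"
definition "X' j x = \<theta>' j x * ((\<delta> x)\<^sup>2 * g j x / q x) +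
  \<theta> x * ((\<delta> x)\<^sup>2 * H j j x / q x - (\<delta> x)\<^sup>2 * g j x * q' j x / (3 * (q x)\<^sup>2))"

section \<open>Size and derivatives of the scale, the multiplier and the vector field\<close>

lemma q_ge: "\<Lambda> \<le> q x" and q_pos: "0 < q x"
proof -
  show "\<Lambda> \<le> q x" unfolding q_def by (simp add: sum_nonneg)
  then show "0 < q x" using lam_pos by linarith
qed

lemma \<delta>_pos: "0 < \<delta> x"
  unfolding \<delta>_def using q_pos[of x] \<eta>_pos by simp

lemma \<delta>_cube: "\<delta> x ^ 3 = \<eta>\<^sup>2 * q x"
proof -
  have "\<delta> x ^ 3 = \<delta> x powr 3" using \<delta>_pos[of x] by (simp add: powr_numeral)
  also have "\<dots> = \<eta>\<^sup>2 * q x" unfolding \<delta>_def powr_powr using q_pos[of x] by simp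
  finally show ?thesis .
qed

lemma \<delta>_ge: "(\<eta>\<^sup>2 * \<Lambda>) powr (1/3) \<le> \<delta> x"
  unfolding \<delta>_def using q_ge[of x] lam_pos by (intro powr_mono2 mult_left_mono) auto

text \<open>\<delta> / q is proportional to q^(-2/3), so the smallness assumed at the lower bound
  \<Lambda> of q carries over to every larger q. Comparing cubes keeps the argument within integer
  powers.\<close>

lemma \<delta>_le: "\<delta> x \<le> \<tau> * q x"
proof -
  define d where "d = (\<eta>\<^sup>2 * \<Lambda>) powr (1/3)"
  have d: "0 \<le> d" "d \<le> \<tau> * \<Lambda>" using small by (auto simp: d_def)
  have "d ^ 3 = d powr 3" using \<eta>_pos lam_pos by (simp add: powr_numeral d_def)
  also have "\<dots> = \<eta>\<^sup>2 * \<Lambda>" unfolding d_def powr_powr using lam_pos by simp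
  finally have d3: "\<eta>\<^sup>2 * \<Lambda> = d ^ 3" by simp
  have "\<eta>\<^sup>2 * \<Lambda> \<le> (\<tau> * \<Lambda>) ^ 3" unfolding d3 using d by (intro power_mono) auto
  then have "\<eta>\<^sup>2 * \<Lambda> \<le> (\<tau> ^ 3 * \<Lambda>\<^sup>2) * \<Lambda>" by (simp add: power_mult_distrib power3_eq_cube power2_eq_square mult_ac)
  then have "\<eta>\<^sup>2 \<le> \<tau> ^ 3 * \<Lambda>\<^sup>2" using lam_pos by (rule mult_right_le_imp_le)
  also have "\<dots> \<le> \<tau> ^ 3 * (q x)\<^sup>2" using q_ge[of x] lam_pos \<tau>_pos by (intro mult_left_mono power_mono) auto
  finally have "\<eta>\<^sup>2 * q x \<le> \<tau> ^ 3 * (q x)\<^sup>2 * q x" using q_pos[of x] by (intro mult_right_mono) auto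
  then have "\<delta> x ^ 3 \<le> (\<tau> * q x) ^ 3"
    unfolding \<delta>_cube by (simp add: power_mult_distrib power3_eq_cube power2_eq_square mult_ac)
  then show ?thesis using \<tau>_pos q_pos[of x] by (intro power_le_imp_le_base[of "\<delta> x" 2]) (auto simp: numeral_3_eq_3)
qed

text \<open>The scaling relation of the Airy operator; through it a factor \<eta> |g| is at most
  \<delta>^(3/2).\<close>

lemma \<eta>_sqrt_q: "\<eta> * sqrt (q x) = \<delta> x * sqrt (\<delta> x)"
proof -
  have "(\<eta> * sqrt (q x))\<^sup>2 = \<eta>\<^sup>2 * q x" using q_pos[of x] by (simp add: power_mult_distrib)
  also have "\<dots> = (\<delta> x)\<^sup>2 * \<delta> x" unfolding \<delta>_cube[symmetric] by (simp add: power3_eq_cube power2_eq_square)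
  also have "\<dots> = (\<delta> x * sqrt (\<delta> x))\<^sup>2" using \<delta>_pos[of x] by (simp add: power_mult_distrib)
  finally have "(\<eta> * sqrt (q x))\<^sup>2 = (\<delta> x * sqrt (\<delta> x))\<^sup>2" .
  then show ?thesis
    using q_pos[of x] \<delta>_pos[of x] \<eta>_pos by (subst (asm) power2_eq_iff_nonneg) auto
qed

lemma g_le: "\<bar>g j x\<bar> \<le> sqrt (q x)"
proof (rule real_le_rsqrt)
  have "(g j x)\<^sup>2 \<le> (\<Sum>i\<in>UNIV. (g i x)\<^sup>2)" by (intro member_le_sum) auto
  then show "\<bar>g j x\<bar>\<^sup>2 \<le> q x" unfolding q_def using lam_pos by simp
qed

lemma B_nonneg: "0 \<le> B"
  by (rule order_trans[OF abs_ge_zero H_le])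

lemma q'_le: "\<bar>q' j x\<bar> \<le> 2 * B * real CARD('n) * sqrt (q x)"
proof -
  have "\<bar>q' j x\<bar> \<le> (\<Sum>i\<in>UNIV. \<bar>2 * g i x * H i j x\<bar>)" unfolding q'_def by (rule sum_abs)
  also have "\<dots> \<le> (\<Sum>i\<in>(UNIV::'n set). 2 * (sqrt (q x) * B))"
  proof (rule sum_mono)
    fix i
    have "\<bar>g i x\<bar> * \<bar>H i j x\<bar> \<le> sqrt (q x) * B" using q_pos[of x] by (intro mult_mono g_le H_le) auto
    then show "\<bar>2 * g i x * H i j x\<bar> \<le> 2 * (sqrt (q x) * B)" by (simp add: abs_mult)
  qed
  finally show ?thesis by (simp add: mult_ac)
qed

lemma q_partial: "has_partial q j x (q' j x)"
proof -
  have "has_partial (\<lambda>x. \<Lambda> + (\<Sum>i\<in>UNIV. (g i x)\<^sup>2)) j x (0 + (\<Sum>i\<in>UNIV. 2 * g i x * H i j x))"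
    by (intro has_partial_add has_partial_const has_partial_sum has_partial_power2 g_partial)
  then show ?thesis by (simp add: q_def[abs_def] q'_def)
qed

lemma \<delta>_partial: "has_partial \<delta> j x (\<delta>' j x)"
proof -
  let ?c = "1/3 * (\<eta>\<^sup>2 * q x) powr (1/3 - 1)"
  have pos: "0 < \<eta>\<^sup>2 * q x" using q_pos[of x] \<eta>_pos by simp
  have "has_partial (\<lambda>x. (\<eta>\<^sup>2 * q x) powr (1/3)) j x (?c * (0 * q x + \<eta>\<^sup>2 * q' j x))"
    by (intro has_partial_chain[where \<phi> = "\<lambda>t. t powr (1/3)" and f = "\<lambda>x. \<eta>\<^sup>2 * q x", OF has_real_derivative_powr[OF pos]] has_partial_mult has_partial_const q_partial)
  moreover have "?c * (0 * q x + \<eta>\<^sup>2 * q' j x) = \<delta>' j x"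
  proof -
    have "(\<eta>\<^sup>2 * q x) powr (1/3 - 1) = \<delta> x / (\<eta>\<^sup>2 * q x)"
      unfolding powr_diff \<delta>_def using pos by simp
    then show ?thesis using pos \<eta>_pos q_pos[of x] by (simp add: \<delta>'_def field_simps)
  qed
  ultimately show ?thesis by (simp add: \<delta>_def[abs_def])
qed

lemma s_partial: "has_partial s j x (s' j x)"
proof -
  have nz: "\<delta> x \<noteq> 0" "q x \<noteq> 0" using \<delta>_pos[of x] q_pos[of x] by auto
  have "has_partial (\<lambda>x. (V2 x - \<mu>) / \<delta> x) j x (((g j x - 0) * \<delta> x - (V2 x - \<mu>) * \<delta>' j x) / (\<delta> x)\<^sup>2)"
    by (intro has_partial_divide has_partial_diff has_partial_const V2_partial \<delta>_partial nz)
  moreover have "((g j x - 0) * \<delta> x - (V2 x - \<mu>) * \<delta>' j x) / (\<delta> x)\<^sup>2 = s' j x"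
    unfolding s'_def \<delta>'_def s_def using nz by (simp add: field_simps power2_eq_square)
  ultimately show ?thesis by (simp add: s_def[abs_def])
qed

lemma \<theta>_partial: "has_partial \<theta> j x (\<theta>' j x)"
proof -
  have "has_partial (\<lambda>x. arctan (s x)) j x (inverse (1 + (s x)\<^sup>2) * s' j x)"
    by (rule has_partial_chain[OF DERIV_arctan s_partial])
  then show ?thesis by (simp add: \<theta>_def[abs_def] \<theta>'_def divide_inverse mult.commute)
qed

lemma X_partial: "has_partial (X j) j x (X' j x)"
proof -
  have nz: "q x \<noteq> 0" using q_pos[of x] by auto
  let ?d = "((2 * \<delta> x * \<delta>' j x * g j x + (\<delta> x)\<^sup>2 * H j j x) * q x - (\<delta> x)\<^sup>2 * g j x * q' j x) / (q x)\<^sup>2"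
  have "has_partial (\<lambda>x. \<theta> x * ((\<delta> x)\<^sup>2 * g j x / q x)) j x (\<theta>' j x * ((\<delta> x)\<^sup>2 * g j x / q x) + \<theta> x * ?d)"
    by (intro has_partial_mult has_partial_divide has_partial_power2 \<theta>_partial \<delta>_partial g_partial q_partial nz)
  moreover have "?d = (\<delta> x)\<^sup>2 * H j j x / q x - (\<delta> x)\<^sup>2 * g j x * q' j x / (3 * (q x)\<^sup>2)"
    unfolding \<delta>'_def using nz by (simp add: field_simps power2_eq_square)
  ultimately show ?thesis by (simp add: X_def[abs_def] X'_def)
qed

lemma conts:
  "continuous_on UNIV q" "continuous_on UNIV (q' j)" "continuous_on UNIV \<delta>" "continuous_on UNIV s"
  "continuous_on UNIV (s' j)" "continuous_on UNIV \<theta>" "continuous_on UNIV (\<theta>' j)" "continuous_on UNIV (X j)" "continuous_on UNIV (X' j)"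
proof -
  have nz: "q x \<noteq> 0" "\<delta> x \<noteq> 0" "\<eta>\<^sup>2 * q x \<noteq> 0" "1 + (s x)\<^sup>2 \<noteq> 0" "3 * q x \<noteq> 0" "3 * (q x)\<^sup>2 \<noteq> 0" for x
    using q_pos[of x] \<delta>_pos[of x] \<eta>_pos by (auto simp: add_nonneg_eq_0_iff)
  show q: "continuous_on UNIV q" unfolding q_def[abs_def] by (intro continuous_intros g_cont)
  show q': "continuous_on UNIV (q' j)" for j unfolding q'_def[abs_def] by (intro continuous_intros g_cont H_cont)
  show d: "continuous_on UNIV \<delta>" unfolding \<delta>_def[abs_def] using nz by (intro continuous_intros q) auto
  show s: "continuous_on UNIV s" unfolding s_def[abs_def] using nz by (intro continuous_intros V2_cont d) auto
  show s': "continuous_on UNIV (s' j)" for j unfolding s'_def[abs_def] using nz by (intro continuous_intros g_cont d s q q') auto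
  show t: "continuous_on UNIV \<theta>" unfolding \<theta>_def[abs_def] by (intro continuous_intros s)
  show t': "continuous_on UNIV (\<theta>' j)" for j unfolding \<theta>'_def[abs_def] using nz by (intro continuous_intros s s') auto
  show "continuous_on UNIV (X j)" for j unfolding X_def[abs_def] using nz by (intro continuous_intros t d g_cont q) auto
  show "continuous_on UNIV (X' j)" for j unfolding X'_def[abs_def] using nz by (intro continuous_intros t t' d g_cont q q' H_cont) auto
qed

text \<open>The part g / \<delta> contributes at most sqrt \<delta> by the scaling relation. The
  part from the variation of \<delta> carries s / (1 + s^2), bounded by 1, and \<delta> / q \<le>
  \<tau>, so the condition on B n \<tau> bounds it by sqrt \<delta> as well.\<close>

lemma \<theta>'_le: "\<eta> * \<bar>\<theta>' j x\<bar> \<le> 2 * sqrt (\<delta> x)"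
proof -
  let ?n = "real CARD('n)" and ?w = "1 + (s x)\<^sup>2" and ?r = "sqrt (\<delta> x)"
  have w: "1 \<le> ?w" by simp
  have q: "0 < q x" and d: "0 < \<delta> x" by (rule q_pos \<delta>_pos)+
  have "\<bar>\<theta>' j x\<bar> \<le> \<bar>g j x\<bar> / \<delta> x / ?w + \<bar>s x\<bar> / ?w * (\<bar>q' j x\<bar> / (3 * q x))"
  proof -
    have eq: "\<theta>' j x = g j x / \<delta> x / ?w - s x / ?w * (q' j x / (3 * q x))"
      unfolding \<theta>'_def s'_def by (simp add: diff_divide_distrib)
    have "\<bar>\<theta>' j x\<bar> \<le> \<bar>g j x / \<delta> x / ?w\<bar> + \<bar>s x / ?w * (q' j x / (3 * q x))\<bar>"
      unfolding eq by (rule abs_triangle_ineq4)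
    then show ?thesis using q d w by (simp add: abs_mult)
  qed
  also have "\<dots> \<le> sqrt (q x) / \<delta> x / 1 + 1 * (2 * B * ?n * sqrt (q x) / (3 * q x))"
    using q d w B_nonneg
    by (intro add_mono mult_mono frac_le divide_nonneg_nonneg g_le abs_div_1_plus_square_le q'_le divide_right_mono) auto
  finally have "\<eta> * \<bar>\<theta>' j x\<bar> \<le> \<eta> * (sqrt (q x) / \<delta> x / 1 + 1 * (2 * B * ?n * sqrt (q x) / (3 * q x)))"
    using \<eta>_pos by (intro mult_left_mono) auto
  also have "\<dots> = (\<eta> * sqrt (q x)) / \<delta> x + (\<eta> * sqrt (q x)) * (2 * B * ?n) / (3 * q x)" by (simp add: algebra_simps)
  also have "\<dots> = ?r + (2/3 * (B * ?n) * (\<delta> x / q x)) * ?r" unfolding \<eta>_sqrt_q using d by simp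
  also have "\<dots> \<le> ?r + 1 * ?r"
  proof (intro add_left_mono mult_right_mono)
    have "\<delta> x / q x \<le> \<tau>" using \<delta>_le[of x] q by (simp add: field_simps)
    then have "2/3 * (B * ?n) * (\<delta> x / q x) \<le> 2/3 * (B * ?n) * \<tau>" using B_nonneg by (intro mult_left_mono) auto
    also have "\<dots> \<le> 1" using \<tau>_le by simp
    finally show "2/3 * (B * ?n) * (\<delta> x / q x) \<le> 1" .
  qed (use d in simp)
  finally show ?thesis by simp
qed

text \<open>By the scaling relation \<delta>^2 / sqrt q equals \<eta> sqrt \<delta>; the factor 2
  bounds arctan.\<close>

lemma X_le: "\<bar>X j x\<bar> \<le> 2 * \<eta> * sqrt (\<delta> x)"
proof -
  have q: "0 < q x" and d: "0 < \<delta> x" by (rule q_pos \<delta>_pos)+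
  have eq: "(\<delta> x)\<^sup>2 * sqrt (q x) = \<eta> * sqrt (\<delta> x) * q x"
  proof -
    have "(\<delta> x)\<^sup>2 * sqrt (q x) = (\<delta> x * sqrt (\<delta> x)) * sqrt (\<delta> x) * sqrt (q x)"
      using d by (simp add: power2_eq_square)
    also have "\<dots> = \<eta> * sqrt (\<delta> x) * (sqrt (q x) * sqrt (q x))"
      unfolding \<eta>_sqrt_q[symmetric] by (simp add: mult_ac)
    also have "sqrt (q x) * sqrt (q x) = q x" using q by simp
    finally show ?thesis .
  qed
  have "\<bar>X j x\<bar> = \<bar>\<theta> x\<bar> * ((\<delta> x)\<^sup>2 * \<bar>g j x\<bar> / q x)" using q by (simp add: X_def abs_mult)
  also have "\<dots> \<le> 2 * ((\<delta> x)\<^sup>2 * sqrt (q x) / q x)"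
    unfolding \<theta>_def using q by (intro mult_mono abs_arctan_le_2 divide_right_mono mult_left_mono g_le) auto
  also have "\<dots> = 2 * \<eta> * sqrt (\<delta> x)" unfolding eq using q by simp
  finally show ?thesis .
qed

text \<open>The leading term comes from differentiating V2 inside s. Everything else contains a
  second derivative of V2, bounded by B, and the factor \<delta>^2 / q \<le> \<tau> \<delta>, so it
  is a small multiple of \<delta>.\<close>

lemma divergence_ge:
  "\<delta> x * ((\<Sum>j\<in>UNIV. (g j x)\<^sup>2) / (q x * (1 + (s x)\<^sup>2))) - 5 * B * (real CARD('n))\<^sup>2 * \<tau> * \<delta> x \<le> (\<Sum>j\<in>UNIV. X' j x)"
proof -
  let ?n = "real CARD('n)" and ?w = "1 + (s x)\<^sup>2" and ?d = "\<delta> x" and ?q = "q x"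
  have q: "0 < ?q" and d: "0 < ?d" by (rule q_pos \<delta>_pos)+
  have w: "0 < ?w" by (simp add: add_pos_nonneg)
  have n: "1 \<le> ?n" by (simp add: Suc_leI)
  have dq: "?d\<^sup>2 / ?q \<le> \<tau> * ?d"
  proof -
    have "?d * ?d \<le> (\<tau> * ?q) * ?d" using \<delta>_le[of x] d by (intro mult_right_mono) auto
    then show ?thesis using q by (simp add: field_simps power2_eq_square)
  qed
  have "?d * ((g j x)\<^sup>2 / (?q * ?w)) - 5 * B * ?n * \<tau> * ?d \<le> X' j x" for j
  proof -
    let ?e = "s x / ?w * (q' j x * g j x * ?d\<^sup>2 / (3 * ?q\<^sup>2))"
    let ?f = "?d\<^sup>2 * H j j x / ?q - ?d\<^sup>2 * g j x * q' j x / (3 * ?q\<^sup>2)"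
    have X': "X' j x = ?d * ((g j x)\<^sup>2 / (?q * ?w)) - ?e + \<theta> x * ?f"
    proof -
      have "s' j x / ?w * (?d\<^sup>2 * g j x / ?q) = ?d * ((g j x)\<^sup>2 / (?q * ?w)) - ?e"
        unfolding s'_def using d q w by (simp add: divide_simps) (simp add: power2_eq_square algebra_simps)
      then show ?thesis unfolding X'_def \<theta>'_def by simp
    qed
    have qg: "\<bar>q' j x\<bar> * \<bar>g j x\<bar> \<le> 2 * B * ?n * ?q"
    proof -
      have "\<bar>q' j x\<bar> * \<bar>g j x\<bar> \<le> (2 * B * ?n * sqrt ?q) * sqrt ?q"
        using q B_nonneg by (intro mult_mono q'_le g_le) auto
      then show ?thesis using q by (simp add: mult.assoc)
    qed
    have third: "\<bar>q' j x\<bar> * \<bar>g j x\<bar> * ?d\<^sup>2 / (3 * ?q\<^sup>2) \<le> 2/3 * B * ?n * (\<tau> * ?d)"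
    proof -
      have "\<bar>q' j x\<bar> * \<bar>g j x\<bar> * ?d\<^sup>2 / (3 * ?q\<^sup>2) \<le> (2 * B * ?n * ?q) * ?d\<^sup>2 / (3 * ?q\<^sup>2)"
        using q by (intro divide_right_mono mult_right_mono qg) auto
      also have "\<dots> = 2/3 * B * ?n * (?d\<^sup>2 / ?q)" using q by (simp add: power2_eq_square)
      also have "\<dots> \<le> 2/3 * B * ?n * (\<tau> * ?d)" using B_nonneg by (intro mult_left_mono dq) auto
      finally show ?thesis .
    qed
    have e: "\<bar>?e\<bar> \<le> 2/3 * B * ?n * (\<tau> * ?d)"
    proof -
      have "\<bar>?e\<bar> = \<bar>s x\<bar> / ?w * (\<bar>q' j x\<bar> * \<bar>g j x\<bar> * ?d\<^sup>2 / (3 * ?q\<^sup>2))" using w by (simp add: abs_mult)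
      also have "\<dots> \<le> 1 * (2/3 * B * ?n * (\<tau> * ?d))"
        by (intro mult_mono abs_div_1_plus_square_le third) auto
      finally show ?thesis by simp
    qed
    have f: "\<bar>?f\<bar> \<le> B * (\<tau> * ?d) + 2/3 * B * ?n * (\<tau> * ?d)"
    proof -
      have "\<bar>?f\<bar> \<le> \<bar>?d\<^sup>2 * H j j x / ?q\<bar> + \<bar>?d\<^sup>2 * g j x * q' j x / (3 * ?q\<^sup>2)\<bar>" by (rule abs_triangle_ineq4)
      also have "\<bar>?d\<^sup>2 * H j j x / ?q\<bar> = \<bar>H j j x\<bar> * (?d\<^sup>2 / ?q)" using q by (simp add: abs_mult)
      also have "\<dots> \<le> B * (\<tau> * ?d)" using q B_nonneg by (intro mult_mono H_le dq) auto
      also have "\<bar>?d\<^sup>2 * g j x * q' j x / (3 * ?q\<^sup>2)\<bar> = \<bar>q' j x\<bar> * \<bar>g j x\<bar> * ?d\<^sup>2 / (3 * ?q\<^sup>2)" by (simp add: abs_mult mult_ac)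
      also have "\<dots> \<le> 2/3 * B * ?n * (\<tau> * ?d)" by (rule third)
      finally show ?thesis by simp
    qed
    define E where "E = ?e"
    define F where "F = \<theta> x * ?f"
    define P where "P = B * ?n * (\<tau> * ?d)"
    have "\<bar>\<theta> x * ?f\<bar> \<le> 2 * (B * (\<tau> * ?d) + 2/3 * B * ?n * (\<tau> * ?d))"
      unfolding abs_mult \<theta>_def by (intro mult_mono abs_arctan_le_2 f) auto
    then have F: "\<bar>F\<bar> \<le> 2 * (B * (\<tau> * ?d) + 2/3 * P)" unfolding F_def P_def by (simp only: mult.assoc)
    have E: "\<bar>E\<bar> \<le> 2/3 * P" using e unfolding E_def P_def by (simp only: mult.assoc)
    have "B * (\<tau> * ?d) * 1 \<le> B * (\<tau> * ?d) * ?n"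
      using n B_nonneg \<tau>_pos d by (intro mult_left_mono) auto
    then have P: "B * (\<tau> * ?d) \<le> P" unfolding P_def by (simp add: mult_ac)
    have P0: "0 \<le> P" unfolding P_def using B_nonneg \<tau>_pos d by simp
    \<comment> \<open>The errors add up to 2/3 + 2 (1 + 2/3) = 4 times P; the constant 5 leaves
      room.\<close>
    have "?d * ((g j x)\<^sup>2 / (?q * ?w)) - 5 * P \<le> ?d * ((g j x)\<^sup>2 / (?q * ?w)) - E + F"
    proof -
      have 1: "E \<le> 2/3 * P" using E by linarith
      have 2: "- F \<le> 2 * (B * (\<tau> * ?d) + 2/3 * P)" using F by linarith
      have "e - f \<le> 5 * p" if "e \<le> 2/3 * p" "- f \<le> 2 * (b + 2/3 * p)" "b \<le> p" "0 \<le> p" for e f p b :: real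
      proof -
        have "2 * (b + 2/3 * p) = 2 * b + 4/3 * p" by simp
        then show ?thesis using that by linarith
      qed
      from this[OF 1 2 P P0] have "E - F \<le> 5 * P" .
      then show ?thesis by linarith
    qed
    then show ?thesis unfolding X' E_def F_def P_def by (simp only: mult.assoc)
  qed
  then have "(\<Sum>j\<in>UNIV. ?d * ((g j x)\<^sup>2 / (?q * ?w)) - 5 * B * ?n * \<tau> * ?d) \<le> (\<Sum>j\<in>UNIV. X' j x)"
    by (intro sum_mono)
  moreover have "(\<Sum>j\<in>(UNIV::'n set). 5 * B * ?n * \<tau> * ?d) = 5 * B * ?n\<^sup>2 * \<tau> * ?d"
    by (simp add: power2_eq_square mult_ac)
  ultimately show ?thesis
    by (simp only: sum_subtractf sum_distrib_left[symmetric] sum_divide_distrib[symmetric])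
qed

text \<open>\<open>K\<close> is the divergence of the field with components \<open>X j\<close> times
  |\<phi>|^2, which is compactly supported.\<close>

lemma divergence_theorem:
  fixes \<phi> :: "real^'n \<Rightarrow> complex"
  assumes \<phi>: "\<phi> \<in> test_function"
  defines "K \<equiv> \<lambda>x. \<Sum>j\<in>UNIV. X' j x * (norm (\<phi> x))\<^sup>2 + X j x * (2 * Re (cnj (\<phi> x) * partial j \<phi> x))"
  shows "integrable lborel K" "integral\<^sup>L lborel K = 0"
proof -
  obtain R where R: "\<And>x. norm x > R \<Longrightarrow> \<phi> x = 0" using \<phi> by (auto simp: test_function_iff)
  note sm = test_function_smooth[OF \<phi>]
  let ?N = "\<lambda>x. (norm (\<phi> x))\<^sup>2"
  have N: "has_partial ?N j x (2 * Re (cnj (\<phi> x) * partial j \<phi> x))" for j x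
  proof -
    have "has_partial (\<lambda>x. Re (cnj (\<phi> x) * \<phi> x)) j x (Re (cnj (partial j \<phi> x) * \<phi> x + cnj (\<phi> x) * partial j \<phi> x))"
      by (intro has_partial_linear[OF bounded_linear_Re] has_partial_mult has_partial_linear[OF bounded_linear_cnj] smooth_has_partial sm)
    moreover have "(\<lambda>x. Re (cnj (\<phi> x) * \<phi> x)) = ?N"
      unfolding cmod_power2 by (simp add: fun_eq_iff power2_eq_square)
    moreover have "Re (cnj (partial j \<phi> x) * \<phi> x + cnj (\<phi> x) * partial j \<phi> x) = 2 * Re (cnj (\<phi> x) * partial j \<phi> x)"
      by (simp add: algebra_simps)
    ultimately show ?thesis by simp
  qed
  let ?K = "\<lambda>j x. X' j x * ?N x + X j x * (2 * Re (cnj (\<phi> x) * partial j \<phi> x))"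
  have P: "has_partial (\<lambda>x. X j x * ?N x) j x (?K j x)" for j x
    by (intro has_partial_mult X_partial N)
  have F: "continuous_on UNIV (\<lambda>x. X j x * ?N x)" and K: "continuous_on UNIV (?K j)" for j
    by (intro continuous_intros conts smooth_continuous smooth_partial sm)+
  have F0: "X j x * ?N x = 0" if "norm x > R" for j x using R[OF that] by simp
  have int: "integrable lborel (?K j)" for j
    by (rule integrable_compact_support[OF K has_partial_eq_0_outside[of R, OF F0 P]])
  have zero: "integral\<^sup>L lborel (?K j) = 0" for j
    by (rule integral_partial_compact_support[OF P F K F0])
  show "integrable lborel K" unfolding K_def by (intro Bochner_Integration.integrable_sum int)
  have "integral\<^sup>L lborel K = (\<Sum>j\<in>UNIV. integral\<^sup>L lborel (?K j))"
    unfolding K_def by (rule Bochner_Integration.integral_sum) (rule int)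
  then show "integral\<^sup>L lborel K = 0" by (simp only: zero sum.neutral_const)
qed

text \<open>Off the zero set of \<open>V2 - \<mu>\<close> the bound comes from the multiplier \<open>arctan s\<close>, near it from
  the divergence of \<open>X\<close>.\<close>

lemma coercive:
  assumes c0: "0 < c0" and T: "\<And>x. \<bar>V2 x\<bar> - T \<le> c0 * (\<Sum>i\<in>UNIV. (g i x)\<^sup>2)"
    and \<mu>: "T + 3/4 * \<Lambda> \<le> \<bar>\<mu>\<bar>" and \<tau>4: "\<tau> \<le> 1/4"
  shows "1 / (4 * c0 + 6) \<le> s x * arctan (s x) + (\<Sum>j\<in>UNIV. (g j x)\<^sup>2) / (q x * (1 + (s x)\<^sup>2))"
proof (cases "1 \<le> \<bar>s x\<bar>")
  case True
  have "1 / (4 * c0 + 6) \<le> 1/2" using c0 by (simp add: field_simps)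
  moreover have "0 \<le> (\<Sum>j\<in>UNIV. (g j x)\<^sup>2) / (q x * (1 + (s x)\<^sup>2))"
    using q_pos[of x] by (intro divide_nonneg_nonneg sum_nonneg mult_nonneg_nonneg) auto
  ultimately show ?thesis using mult_arctan_ge[OF True] by linarith
next
  case False
  define S where "S = (\<Sum>j\<in>UNIV. (g j x)\<^sup>2)"
  have S0: "0 \<le> S" unfolding S_def by (simp add: sum_nonneg)
  have q: "q x = \<Lambda> + S" by (simp add: q_def S_def)
  have "\<bar>V2 x - \<mu>\<bar> \<le> \<delta> x"
    using False \<delta>_pos[of x] by (simp add: s_def abs_divide pos_divide_less_eq)
  also have "\<dots> \<le> 1/4 * q x"
    using \<delta>_le[of x] mult_right_mono[OF \<tau>4, of "q x"] q_pos[of x] by linarith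
  \<comment> \<open>|V2| \<ge> |\<mu>| - |V2 - \<mu>|, and the subtracted term is at most q / 4. In
    the comparison with the growth hypothesis T cancels, which is why the lower bound on |\<mu>|
    starts from T.\<close>
  finally have "T + 3/4 * \<Lambda> - 1/4 * (\<Lambda> + S) \<le> \<bar>V2 x\<bar>" using \<mu> unfolding q by linarith
  then have "T + 3/4 * \<Lambda> - 1/4 * (\<Lambda> + S) \<le> T + c0 * S" using T[of x, folded S_def] by linarith
  then have "\<Lambda> / 2 \<le> c0 * S + S / 4" by (simp add: field_simps)
  then have "\<Lambda> \<le> (2 * c0 + 1/2) * S" by (simp add: algebra_simps)
  \<comment> \<open>The bound (2 c0 + 3/2) S is rounded up to (2 c0 + 3) S; doubling it, because 1 +
    s^2 \<le> 2, produces the constant 4 c0 + 6.\<close>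
  then have qS: "q x \<le> (2 * c0 + 3) * S" unfolding q using S0 by (simp add: algebra_simps)
  have "(s x)\<^sup>2 \<le> 1" using False by (simp add: abs_square_le_1)
  then have "q x * (1 + (s x)\<^sup>2) \<le> q x * 2" using q_pos[of x] by (intro mult_left_mono) auto
  also have "\<dots> \<le> (4 * c0 + 6) * S" using qS by (simp add: algebra_simps)
  finally have "1 / (4 * c0 + 6) \<le> S / (q x * (1 + (s x)\<^sup>2))"
  proof -
    assume *: "q x * (1 + (s x)\<^sup>2) \<le> (4 * c0 + 6) * S"
    have w: "0 < q x * (1 + (s x)\<^sup>2)" using q_pos[of x] by (simp add: add_pos_nonneg)
    have "q x * (1 + (s x)\<^sup>2) / (4 * c0 + 6) \<le> S"
      using * c0 by (subst pos_divide_le_eq) (auto simp: mult.commute)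
    then show ?thesis by (subst pos_le_divide_eq[OF w]) simp
  qed
  then show ?thesis using mult_arctan_nonneg[of "s x"] unfolding S_def by linarith
qed

text \<open>Two identities are added before integration: the imaginary part of the equation tested
  with arctan s, and the divergence of X |\<phi>|^2. Their exact derivative terms stay in place
  because they integrate to 0. The first-order cross terms are bounded by multiples of 2 sqrt
  \<delta> |\<phi>| \<eta> |\<partial>\<phi>| and split by Young's inequality; one share comes from
  the derivative of \<theta> and two from X, whence the factors 3.\<close>

lemma pointwise_estimate:
  fixes \<phi> :: "real^'n \<Rightarrow> complex" and V :: "real^'n \<Rightarrow> complex"
  assumes V: "Im (V x) = V2 x" and z: "Im z = \<mu>" and \<epsilon>: "0 < \<epsilon>"
    and c: "c \<le> s x * arctan (s x) + (\<Sum>j\<in>UNIV. (g j x)\<^sup>2) / (q x * (1 + (s x)\<^sup>2))"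
  shows "c * (\<delta> x * (norm (\<phi> x))\<^sup>2) \<le>
    2 * (norm (\<phi> x) * norm (schroedinger \<eta> V \<phi> x - z * \<phi> x))
    + \<eta>\<^sup>2 * Im (\<Sum>i\<in>UNIV. of_real (\<theta>' i x) * (cnj (\<phi> x) * partial i \<phi> x) +
        of_real (\<theta> x) * (cnj (partial i \<phi> x) * partial i \<phi> x + cnj (\<phi> x) * partial i (partial i \<phi>) x))
    + (\<Sum>j\<in>UNIV. X' j x * (norm (\<phi> x))\<^sup>2 + X j x * (2 * Re (cnj (\<phi> x) * partial j \<phi> x)))
    + (3 * real CARD('n) * \<epsilon> + 5 * B * (real CARD('n))\<^sup>2 * \<tau>) * (\<delta> x * (norm (\<phi> x))\<^sup>2)
    + 3 / \<epsilon> * (\<eta>\<^sup>2 * (\<Sum>i\<in>UNIV. (norm (partial i \<phi> x))\<^sup>2))"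
proof -
  let ?n = "real CARD('n)" and ?N = "(norm (\<phi> x))\<^sup>2" and ?a = "norm (\<phi> x)" and ?r = "sqrt (\<delta> x)"
  let ?f = "schroedinger \<eta> V \<phi> x - z * \<phi> x" and ?b = "\<lambda>i. norm (partial i \<phi> x)"
  let ?w = "\<lambda>i. cnj (\<phi> x) * partial i \<phi> x"
  let ?D = "\<Sum>i\<in>UNIV. of_real (\<theta>' i x) * ?w i +
        of_real (\<theta> x) * (cnj (partial i \<phi> x) * partial i \<phi> x + cnj (\<phi> x) * partial i (partial i \<phi>) x)"
  let ?L = "cnj (\<phi> x) * laplacian \<phi> x" and ?M = "\<Sum>i\<in>UNIV. (?b i)\<^sup>2"
  have d: "0 < \<delta> x" by (rule \<delta>_pos)
  have w_le: "norm (?w i) = ?a * ?b i" for i by (simp add: norm_mult)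
  have y: "2 * ?r * ?a * (\<eta> * ?b i) \<le> \<epsilon> * (\<delta> x * ?N) + 1 / \<epsilon> * (\<eta>\<^sup>2 * (?b i)\<^sup>2)" for i
    using young_ineq[OF \<epsilon>, of ?r ?a "\<eta> * ?b i"] d by (simp add: power_mult_distrib mult_ac)
  have sum_y: "(\<Sum>i\<in>UNIV. \<epsilon> * (\<delta> x * ?N) + 1 / \<epsilon> * (\<eta>\<^sup>2 * (?b i)\<^sup>2)) = ?n * \<epsilon> * (\<delta> x * ?N) + 1 / \<epsilon> * (\<eta>\<^sup>2 * ?M)"
    by (simp add: sum.distrib sum_distrib_left mult_ac)

  have ImD: "Im ?D = (\<Sum>i\<in>UNIV. \<theta>' i x * Im (?w i)) + \<theta> x * Im ?L"
    unfolding laplacian_def by (simp add: sum.distrib sum_distrib_left algebra_simps)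
  have "Im (cnj (\<phi> x) * ?f) = - \<eta>\<^sup>2 * Im ?L + (V2 x - \<mu>) * ?N"
    unfolding schroedinger_def using V z by (simp add: cmod_power2) (simp add: power2_eq_square algebra_simps)
  then have "(V2 x - \<mu>) * ?N = Im (cnj (\<phi> x) * ?f) + \<eta>\<^sup>2 * Im ?L" by linarith
  then have "\<theta> x * (V2 x - \<mu>) * ?N = \<theta> x * (Im (cnj (\<phi> x) * ?f) + \<eta>\<^sup>2 * Im ?L)"
    by (simp only: mult.assoc)
  also have "\<dots> = \<theta> x * Im (cnj (\<phi> x) * ?f) + \<eta>\<^sup>2 * (\<theta> x * Im ?L)"
    by (simp only: distrib_left mult.left_commute)
  also have "\<theta> x * Im ?L = Im ?D - (\<Sum>i\<in>UNIV. \<theta>' i x * Im (?w i))" using ImD by linarith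
  also have "\<theta> x * Im (cnj (\<phi> x) * ?f) + \<eta>\<^sup>2 * (Im ?D - (\<Sum>i\<in>UNIV. \<theta>' i x * Im (?w i))) =
      \<theta> x * Im (cnj (\<phi> x) * ?f) + \<eta>\<^sup>2 * Im ?D + (\<Sum>i\<in>UNIV. - (\<eta>\<^sup>2 * (\<theta>' i x * Im (?w i))))"
    by (simp only: sum_negf sum_distrib_left[symmetric] right_diff_distrib)
  finally have eq: "\<theta> x * (V2 x - \<mu>) * ?N = \<theta> x * Im (cnj (\<phi> x) * ?f) + \<eta>\<^sup>2 * Im ?D + (\<Sum>i\<in>UNIV. - (\<eta>\<^sup>2 * (\<theta>' i x * Im (?w i))))" .
  have t1: "\<theta> x * Im (cnj (\<phi> x) * ?f) \<le> 2 * (?a * norm ?f)"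
  proof -
    have "\<bar>\<theta> x * Im (cnj (\<phi> x) * ?f)\<bar> \<le> 2 * norm (cnj (\<phi> x) * ?f)"
      unfolding abs_mult \<theta>_def by (intro mult_mono abs_arctan_le_2 abs_Im_le_cmod) auto
    then show ?thesis unfolding norm_mult complex_mod_cnj by linarith
  qed
  have "- (\<eta>\<^sup>2 * (\<theta>' i x * Im (?w i))) \<le> \<epsilon> * (\<delta> x * ?N) + 1 / \<epsilon> * (\<eta>\<^sup>2 * (?b i)\<^sup>2)" for i
  proof -
    have "- (\<eta>\<^sup>2 * (\<theta>' i x * Im (?w i))) \<le> \<bar>\<eta>\<^sup>2 * (\<theta>' i x * Im (?w i))\<bar>" by linarith
    also have "\<dots> = (\<eta> * \<bar>\<theta>' i x\<bar>) * (\<eta> * \<bar>Im (?w i)\<bar>)" using \<eta>_pos by (simp add: abs_mult power2_eq_square)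
    also have "\<dots> \<le> (2 * ?r) * (\<eta> * (?a * ?b i))"
      using \<eta>_pos d abs_Im_le_cmod[of "?w i", unfolded w_le] by (intro mult_mono \<theta>'_le mult_left_mono) auto
    also have "\<dots> = 2 * ?r * ?a * (\<eta> * ?b i)" by simp
    finally show ?thesis using y[of i] by linarith
  qed
  then have "(\<Sum>i\<in>UNIV. - (\<eta>\<^sup>2 * (\<theta>' i x * Im (?w i)))) \<le> ?n * \<epsilon> * (\<delta> x * ?N) + 1 / \<epsilon> * (\<eta>\<^sup>2 * ?M)"
    unfolding sum_y[symmetric] by (intro sum_mono)
  moreover have "\<theta> x * (V2 x - \<mu>) = s x * arctan (s x) * \<delta> x" unfolding \<theta>_def s_def using d by simp
  ultimately have est1: "s x * arctan (s x) * \<delta> x * ?N \<le> 2 * (?a * norm ?f) + \<eta>\<^sup>2 * Im ?D + ?n * \<epsilon> * (\<delta> x * ?N) + 1 / \<epsilon> * (\<eta>\<^sup>2 * ?M)"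
    using eq t1 by simp

  let ?K = "\<Sum>j\<in>UNIV. X' j x * ?N + X j x * (2 * Re (?w j))"
  \<comment> \<open>The derivative of |\<phi>|^2 brings an additional factor 2, so this term takes
    two shares of Young's inequality.\<close>
  have "- (X j x * (2 * Re (?w j))) \<le> 2 * (\<epsilon> * (\<delta> x * ?N) + 1 / \<epsilon> * (\<eta>\<^sup>2 * (?b j)\<^sup>2))" for j
  proof -
    have "- (X j x * (2 * Re (?w j))) \<le> \<bar>X j x * (2 * Re (?w j))\<bar>" by linarith
    also have "\<dots> = \<bar>X j x\<bar> * (2 * \<bar>Re (?w j)\<bar>)" by (simp only: abs_mult abs_numeral)
    also have "\<dots> \<le> (2 * \<eta> * ?r) * (2 * (?a * ?b j))"
      using \<eta>_pos d abs_Re_le_cmod[of "?w j", unfolded w_le] by (intro mult_mono X_le mult_left_mono) auto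
    also have "\<dots> = 2 * (2 * ?r * ?a * (\<eta> * ?b j))" by simp
    finally show ?thesis by (rule order_trans[OF _ mult_left_mono[OF y]]) simp
  qed
  then have "(\<Sum>j\<in>UNIV. - (X j x * (2 * Re (?w j)))) \<le> (\<Sum>j\<in>UNIV. 2 * (\<epsilon> * (\<delta> x * ?N) + 1 / \<epsilon> * (\<eta>\<^sup>2 * (?b j)\<^sup>2)))"
    by (intro sum_mono)
  also have "\<dots> = 2 * (?n * \<epsilon> * (\<delta> x * ?N) + 1 / \<epsilon> * (\<eta>\<^sup>2 * ?M))"
    unfolding sum_y[symmetric] by (rule sum_distrib_left[symmetric])
  finally have "- (\<Sum>j\<in>UNIV. X j x * (2 * Re (?w j))) \<le> 2 * (?n * \<epsilon> * (\<delta> x * ?N) + 1 / \<epsilon> * (\<eta>\<^sup>2 * ?M))"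
    by (simp only: sum_negf)
  moreover have "?K = (\<Sum>j\<in>UNIV. X' j x) * ?N + (\<Sum>j\<in>UNIV. X j x * (2 * Re (?w j)))"
    by (simp only: sum.distrib sum_distrib_right)
  moreover have "(\<delta> x * ((\<Sum>j\<in>UNIV. (g j x)\<^sup>2) / (q x * (1 + (s x)\<^sup>2))) - 5 * B * ?n\<^sup>2 * \<tau> * \<delta> x) * ?N \<le> (\<Sum>j\<in>UNIV. X' j x) * ?N"
    by (intro mult_right_mono divergence_ge) auto
  ultimately have est2: "(\<delta> x * ((\<Sum>j\<in>UNIV. (g j x)\<^sup>2) / (q x * (1 + (s x)\<^sup>2))) - 5 * B * ?n\<^sup>2 * \<tau> * \<delta> x) * ?N \<le>
      ?K + 2 * (?n * \<epsilon> * (\<delta> x * ?N) + 1 / \<epsilon> * (\<eta>\<^sup>2 * ?M))" by linarith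
  have "c * (\<delta> x * ?N) \<le> (s x * arctan (s x) + (\<Sum>j\<in>UNIV. (g j x)\<^sup>2) / (q x * (1 + (s x)\<^sup>2))) * (\<delta> x * ?N)"
    using d by (intro mult_right_mono c) auto
  also have "\<dots> = s x * arctan (s x) * \<delta> x * ?N + \<delta> x * ((\<Sum>j\<in>UNIV. (g j x)\<^sup>2) / (q x * (1 + (s x)\<^sup>2))) * ?N"
  proof -
    have "(a + b) * (d * n) = a * d * n + d * b * n" for a b d n :: real by (simp add: algebra_simps)
    then show ?thesis .
  qed
  finally show ?thesis using est1 est2 by (simp only: algebra_simps) (simp add: algebra_simps)
qed

text \<open>Of the coercive weight c \<delta>, one half absorbs the errors proportional to \<delta>;
  the rest is bounded below by the constant scale (\<eta>^2 \<Lambda>)^(1/3). Half of that remainder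
  pays for the term 3 / \<epsilon> Re z coming from the energy identity, which leaves c / 4.\<close>

lemma integrated_estimate:
  fixes \<phi> :: "real^'n \<Rightarrow> complex" and V :: "real^'n \<Rightarrow> complex"
  assumes \<phi>: "\<phi> \<in> test_function"
    and V: "slow_growth V" and V_nonneg: "\<And>x. 0 \<le> Re (V x)" and V_Im: "\<And>x. Im (V x) = V2 x"
    and z: "Im z = \<mu>" and \<epsilon>: "0 < \<epsilon>"
    and coer: "\<And>x. c \<le> s x * arctan (s x) + (\<Sum>j\<in>UNIV. (g j x)\<^sup>2) / (q x * (1 + (s x)\<^sup>2))"
    and c: "3 * real CARD('n) * \<epsilon> + 5 * B * (real CARD('n))\<^sup>2 * \<tau> \<le> c / 2" "0 < c"
    and Re_z: "3 / \<epsilon> * Re z \<le> c / 4 * (\<eta>\<^sup>2 * \<Lambda>) powr (1/3)"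
  shows "c / 4 * (\<eta>\<^sup>2 * \<Lambda>) powr (1/3) * L2_norm \<phi> \<le> (2 + 3 / \<epsilon>) * L2_norm (\<lambda>x. schroedinger \<eta> V \<phi> x - z * \<phi> x)"
proof -
  let ?f = "\<lambda>x. schroedinger \<eta> V \<phi> x - z * \<phi> x" and ?d0 = "(\<eta>\<^sup>2 * \<Lambda>) powr (1/3)"
  define D where "D = (\<lambda>x. \<Sum>i\<in>UNIV. of_real (\<theta>' i x) * (cnj (\<phi> x) * partial i \<phi> x) +
        of_real (\<theta> x) * (cnj (partial i \<phi> x) * partial i \<phi> x + cnj (\<phi> x) * partial i (partial i \<phi>) x))"
  define K where "K = (\<lambda>x. \<Sum>j\<in>UNIV. X' j x * (norm (\<phi> x))\<^sup>2 + X j x * (2 * Re (cnj (\<phi> x) * partial j \<phi> x)))"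
  define M where "M = (\<lambda>x. \<eta>\<^sup>2 * (\<Sum>i\<in>UNIV. (norm (partial i \<phi> x))\<^sup>2))"
  define W where "W = (\<lambda>x. norm (\<phi> x) * norm (?f x))"
  have D: "integrable lborel D" "integral\<^sup>L lborel D = 0"
    unfolding D_def by (intro green_identity \<phi> \<theta>_partial conts)+
  have ImD: "integrable lborel (\<lambda>x. Im (D x))" "(LINT x|lborel. Im (D x)) = 0"
    using integrable_Im[OF D(1)] integral_Im[OF D(1)] D(2) by simp_all
  have K: "integrable lborel K" "integral\<^sup>L lborel K = 0"
    unfolding K_def by (rule divergence_theorem[OF \<phi>])+
  have W: "integrable lborel W" "integral\<^sup>L lborel W \<le> L2_norm \<phi> * L2_norm ?f"
    unfolding W_def by (rule schroedinger_pairing[OF V \<phi>])+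
  have M: "integrable lborel M" "integral\<^sup>L lborel M \<le> L2_norm \<phi> * L2_norm ?f + Re z * (L2_norm \<phi>)\<^sup>2"
    unfolding M_def by (rule energy_estimate[OF V V_nonneg \<phi>])+
  have N: "integrable lborel (\<lambda>x. (norm (\<phi> x))\<^sup>2)" by (rule L2_integrable[OF test_function_L2[OF \<phi>]])
  have pw: "c / 2 * ?d0 * (norm (\<phi> x))\<^sup>2 \<le> 2 * W x + \<eta>\<^sup>2 * Im (D x) + K x + 3 / \<epsilon> * M x" for x
  proof -
    let ?E = "\<delta> x * (norm (\<phi> x))\<^sup>2"
    have E: "0 \<le> ?E" using \<delta>_pos[of x] by simp
    have "c * ?E \<le> 2 * W x + \<eta>\<^sup>2 * Im (D x) + K x
        + (3 * real CARD('n) * \<epsilon> + 5 * B * (real CARD('n))\<^sup>2 * \<tau>) * ?E + 3 / \<epsilon> * M x"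
      unfolding W_def D_def K_def M_def by (rule pointwise_estimate[OF V_Im z \<epsilon> coer])
    moreover have "(3 * real CARD('n) * \<epsilon> + 5 * B * (real CARD('n))\<^sup>2 * \<tau>) * ?E \<le> c / 2 * ?E"
      by (intro mult_right_mono c E)
    moreover have "c / 2 * (?d0 * (norm (\<phi> x))\<^sup>2) \<le> c / 2 * ?E"
      using c(2) by (intro mult_left_mono mult_right_mono \<delta>_ge) auto
    moreover have "c * ?E = c / 2 * ?E + c / 2 * ?E" by simp
    ultimately show ?thesis by (simp only: mult.assoc)
  qed
  have i1: "integrable lborel (\<lambda>x. 2 * W x + \<eta>\<^sup>2 * Im (D x))"
    by (intro Bochner_Integration.integrable_add integrable_mult_right W ImD)
  have i2: "integrable lborel (\<lambda>x. 2 * W x + \<eta>\<^sup>2 * Im (D x) + K x)"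
    by (intro Bochner_Integration.integrable_add i1 K)
  have i3: "integrable lborel (\<lambda>x. 3 / \<epsilon> * M x)" by (intro integrable_mult_right M)
  have "c / 2 * ?d0 * (L2_norm \<phi>)\<^sup>2 = (LINT x|lborel. c / 2 * ?d0 * (norm (\<phi> x))\<^sup>2)"
    unfolding L2_norm_power2 by simp
  also have "\<dots> \<le> (LINT x|lborel. 2 * W x + \<eta>\<^sup>2 * Im (D x) + K x + 3 / \<epsilon> * M x)"
    by (intro integral_mono pw Bochner_Integration.integrable_add[OF i2 i3] integrable_mult_right N)
  also have "\<dots> = (LINT x|lborel. 2 * W x + \<eta>\<^sup>2 * Im (D x)) + integral\<^sup>L lborel K + 3 / \<epsilon> * integral\<^sup>L lborel M"
    using Bochner_Integration.integral_add[OF i2 i3] Bochner_Integration.integral_add[OF i1 K(1)] by simp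
  also have "(LINT x|lborel. 2 * W x + \<eta>\<^sup>2 * Im (D x)) = 2 * integral\<^sup>L lborel W"
    using Bochner_Integration.integral_add[OF integrable_mult_right[OF W(1), of 2] integrable_mult_right[OF ImD(1), of "\<eta>\<^sup>2"]] ImD(2) by simp
  also have "2 * integral\<^sup>L lborel W + integral\<^sup>L lborel K + 3 / \<epsilon> * integral\<^sup>L lborel M \<le>
      2 * (L2_norm \<phi> * L2_norm ?f) + 0 + 3 / \<epsilon> * (L2_norm \<phi> * L2_norm ?f + Re z * (L2_norm \<phi>)\<^sup>2)"
    using \<epsilon> by (intro add_mono mult_left_mono W M) (auto simp: K)
  also have "\<dots> = (2 + 3 / \<epsilon>) * (L2_norm \<phi> * L2_norm ?f) + (3 / \<epsilon> * Re z) * (L2_norm \<phi>)\<^sup>2"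
    by (simp add: algebra_simps)
  also have "\<dots> \<le> (2 + 3 / \<epsilon>) * (L2_norm \<phi> * L2_norm ?f) + (c / 4 * ?d0) * (L2_norm \<phi>)\<^sup>2"
    by (intro add_left_mono mult_right_mono Re_z) auto
  finally have "c / 4 * ?d0 * (L2_norm \<phi>)\<^sup>2 \<le> (2 + 3 / \<epsilon>) * (L2_norm \<phi> * L2_norm ?f)" by linarith
  then have main: "L2_norm \<phi> * (c / 4 * ?d0 * L2_norm \<phi>) \<le> L2_norm \<phi> * ((2 + 3 / \<epsilon>) * L2_norm ?f)"
    by (simp only: power2_eq_square mult_ac)
  show ?thesis
  proof (cases "L2_norm \<phi> = 0")
    case True
    then show ?thesis using \<epsilon> by (simp add: L2_norm_nonneg)
  next
    case False
    then have "0 < L2_norm \<phi>" using L2_norm_nonneg[of \<phi>] by linarith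
    then show ?thesis by (rule mult_left_le_imp_le[OF main])
  qed
qed

end

section \<open>Growth of the potential\<close>

text \<open>The set where the essential bound fails is open by continuity and null, hence
  empty.\<close>

lemma Linf_continuous_bounded:
  fixes f :: "real^'n \<Rightarrow> complex"
  assumes f: "f \<in> Linf" and cont: "continuous_on UNIV f"
  shows "\<exists>B\<ge>0. \<forall>x. norm (f x) \<le> B"
proof -
  obtain B where B: "AE x in lborel. norm (f x) \<le> B" using f by (auto simp: Linf_def)
  have opn: "open {x. B < norm (f x)}"
    by (intro open_Collect_less continuous_intros cont)
  have "{x. B < norm (f x)} \<in> null_sets lborel"
  proof (subst AE_iff_null_sets)
    show "{x. B < norm (f x)} \<in> sets lborel" using opn by simp
    show "AE x in lborel. x \<notin> {x. B < norm (f x)}" using B by eventually_elim simp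
  qed
  then have "negligible {x. B < norm (f x)}"
    by (simp add: negligible_iff_null_sets null_sets_completionI)
  then have "{x. B < norm (f x)} = {}" using open_not_negligible[OF opn] by blast
  then have le: "norm (f x) \<le> B" for x by (auto simp: not_less[symmetric])
  have "0 \<le> B" by (rule order_trans[OF norm_ge_zero le])
  then show ?thesis using le by blast
qed

text \<open>The mean value inequality on the ball of radius |x| around 0, with the derivative
  controlled by its values on the axes.\<close>

lemma growth_if_partials_growth:
  fixes f :: "real^'n \<Rightarrow> complex"
  assumes f: "\<And>x. f differentiable (at x)"
    and growth: "\<And>i. \<exists>C. \<forall>x. norm (partial i f x) \<le> C * (1 + norm x) ^ k"
  shows "\<exists>C. \<forall>x. norm (f x) \<le> C * (1 + norm x) ^ Suc k"
proof -
  obtain C where C: "\<And>i x. norm (partial i f x) \<le> C i * (1 + norm x) ^ k" using growth by metis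
  define S where "S = (\<Sum>i\<in>UNIV. \<bar>C i\<bar>)"
  have S0: "0 \<le> S" unfolding S_def by (simp add: sum_nonneg)
  obtain F where F: "\<And>x. (f has_derivative F x) (at x)" using f unfolding differentiable_def by metis
  have F_axis: "F x (axis i 1) = partial i f x" for x i
    using has_partial_eq[OF has_derivative_imp_has_partial[OF F]] by metis
  have F_le: "onorm (F y) \<le> S * (1 + norm x) ^ k" if "norm y \<le> norm x" for x y
  proof (rule onorm_bound)
    show "0 \<le> S * (1 + norm x) ^ k" using S0 by simp
    fix h
    have lin: "linear (F y)" by (rule has_derivative_linear[OF F])
    have "F y h = F y (\<Sum>i\<in>UNIV. h $ i *\<^sub>R axis i 1)"
      using basis_expansion[of h] by (simp add: scalar_mult_eq_scaleR)
    also have "\<dots> = (\<Sum>i\<in>UNIV. h $ i *\<^sub>R partial i f y)"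
      by (simp add: linear_sum[OF lin] linear_scale[OF lin] F_axis)
    finally have "norm (F y h) \<le> (\<Sum>i\<in>UNIV. norm (h $ i *\<^sub>R partial i f y))" by (simp only: norm_sum)
    also have "\<dots> \<le> (\<Sum>i\<in>UNIV. norm h * (\<bar>C i\<bar> * (1 + norm x) ^ k))"
    proof (rule sum_mono)
      fix i
      have "norm (partial i f y) \<le> \<bar>C i\<bar> * (1 + norm y) ^ k"
        by (rule order_trans[OF C]) (intro mult_right_mono, auto)
      also have "\<dots> \<le> \<bar>C i\<bar> * (1 + norm x) ^ k" using that by (intro mult_left_mono power_mono) auto
      finally show "norm (h $ i *\<^sub>R partial i f y) \<le> norm h * (\<bar>C i\<bar> * (1 + norm x) ^ k)"
        unfolding norm_scaleR by (intro mult_mono component_le_norm_cart) auto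
    qed
    also have "\<dots> = S * (1 + norm x) ^ k * norm h"
      unfolding S_def by (simp add: sum_distrib_left sum_distrib_right mult_ac)
    finally show "norm (F y h) \<le> S * (1 + norm x) ^ k * norm h" .
  qed
  have "norm (f x) \<le> (norm (f 0) + S) * (1 + norm x) ^ Suc k" for x
  proof -
    have "norm (f x - f 0) \<le> S * (1 + norm x) ^ k * norm (x - 0)"
    proof (rule differentiable_bound[of "cball 0 (norm x)" f F])
      show "(f has_derivative F y) (at y within cball 0 (norm x))" for y by (rule has_derivative_at_withinI[OF F])
      show "onorm (F y) \<le> S * (1 + norm x) ^ k" if "y \<in> cball 0 (norm x)" for y using that by (intro F_le) simp
    qed auto
    also have "\<dots> \<le> S * (1 + norm x) ^ k * (1 + norm x)" using S0 by (intro mult_left_mono) auto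
    finally have "norm (f x) \<le> norm (f 0) + S * (1 + norm x) ^ Suc k"
      using norm_triangle_ineq2[of "f x" "f 0"] by (simp add: mult_ac)
    moreover have "norm (f 0) * 1 \<le> norm (f 0) * (1 + norm x) ^ Suc k"
      by (intro mult_left_mono one_le_power) auto
    ultimately show ?thesis by (simp add: distrib_right)
  qed
  then show ?thesis by blast
qed

text \<open>Integrating twice from bounded second derivatives gives at most linear growth of the
  gradient and quadratic growth of V.\<close>

lemma slow_growth_if_second_partials_bounded:
  fixes V :: "real^'n \<Rightarrow> complex"
  assumes V: "smooth V" and bd: "\<And>\<alpha>. 2 \<le> length \<alpha> \<Longrightarrow> \<exists>B\<ge>0. \<forall>x. norm (partials \<alpha> V x) \<le> B"
  shows "slow_growth V"
  unfolding slow_growth_def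
proof (intro conjI allI)
  have diff: "partials \<alpha> V differentiable (at x)" for \<alpha> x using V by (simp add: smooth_def)
  have 2: "\<exists>C. \<forall>x. norm (partials \<alpha> V x) \<le> C * (1 + norm x) ^ 0" if "2 \<le> length \<alpha>" for \<alpha>
    using bd[OF that] by auto
  have 1: "\<exists>C. \<forall>x. norm (partials [i] V x) \<le> C * (1 + norm x) ^ Suc 0" for i
    by (rule growth_if_partials_growth[OF diff]) (use 2[of "[_, i]"] in simp)
  have 0: "\<exists>C. \<forall>x. norm (partials [] V x) \<le> C * (1 + norm x) ^ Suc (Suc 0)"
    by (rule growth_if_partials_growth[OF diff]) (use 1 in simp)
  fix \<alpha> :: "'n list"
  consider "\<alpha> = []" | i where "\<alpha> = [i]" | "2 \<le> length \<alpha>"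
    by (cases \<alpha> rule: remdups_adj.cases) auto
  then show "\<exists>k C. \<forall>x. norm (partials \<alpha> V x) \<le> C * (1 + norm x) ^ k"
    using 0 1 2 by cases blast+
qed (rule V)

section \<open>Realizations of the Weyl quantization\<close>

text \<open>The symbol is even in \<xi>, so \<open>p x (- \<xi>)\<close> is the symbol itself and
  the distribution defined by duality is tested with the same operator.\<close>

lemma weyl_closure_eq_weak_graph:
  fixes V :: "real^'n \<Rightarrow> complex"
  assumes V: "slow_growth V" and V_nonneg: "\<And>x. 0 \<le> Re (V x)"
    and p: "p = (\<lambda>x \<xi>. of_real ((norm \<xi>)\<^sup>2) + V x)"
  shows "weyl_closure h p = weak_graph (h / (2 * pi)) V"
    "weak_graph (h / (2 * pi)) V = {(u, f). u \<in> L2 \<and> f \<in> L2 \<and> weyl_distr_eq h p u f}"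
proof -
  have weyl: "weyl h p u = schroedinger (h / (2 * pi)) V u" if "u \<in> schwartz" for u
    unfolding p by (rule weyl_schroedinger[OF V that])
  have "{(u, weyl h p u) | u. u \<in> schwartz} = schroedinger_graph (h / (2 * pi)) V schwartz"
    unfolding schroedinger_graph_def using weyl by auto
  then show "weyl_closure h p = weak_graph (h / (2 * pi)) V"
    unfolding weyl_closure_def using weak_graph_eq_closure(2)[OF V V_nonneg] by metis
  have "(\<lambda>x \<xi>. p x (- \<xi>)) = p" by (simp add: p)
  then have "weyl_distr h p u \<phi> = (LINT x|lborel. u x * schroedinger (h / (2 * pi)) V \<phi> x)"
    if "\<phi> \<in> test_function" for u \<phi>
    unfolding weyl_distr_def using weyl[OF test_function_schwartz[OF that]] by metis
  then show "weak_graph (h / (2 * pi)) V = {(u, f). u \<in> L2 \<and> f \<in> L2 \<and> weyl_distr_eq h p u f}"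
    unfolding weak_graph_def weyl_distr_eq_def by auto
qed

text \<open>The estimate serves twice. The maximal realization is the closure from test functions,
  so the bound holds on all of it and gives injectivity; this injectivity is also the triviality of
  the annihilator of the range, and so yields surjectivity.\<close>

lemma resolvent_if_estimate:
  fixes V :: "real^'n \<Rightarrow> complex"
  assumes V: "slow_growth V" and V_nonneg: "\<And>x. 0 \<le> Re (V x)" and c: "0 \<le> c"
    and est: "\<And>\<phi>. \<phi> \<in> test_function \<Longrightarrow> L2_norm \<phi> \<le> c * L2_norm (\<lambda>x. schroedinger \<eta> V \<phi> x - z * \<phi> x)"
  defines "R \<equiv> shifted (weak_graph \<eta> V) z"
  shows "L2_invertible (Domain (weak_graph \<eta> V)) R" "L2_opnorm (R\<inverse>) \<le> ennreal c"
proof -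
  note W = weak_graph_eq_closure(1)[OF V V_nonneg, of \<eta>]
  have est_W: "L2_norm u \<le> c * L2_norm (\<lambda>x. f x - z * u x)" if "(u, f) \<in> weak_graph \<eta> V" for u f
    using closure_estimate[OF V est] that unfolding W by blast
  have in_L2: "u \<in> L2" "f \<in> L2" if "(u, f) \<in> weak_graph \<eta> V" for u f
    using that by (auto simp: weak_graph_def)
  have inj: "AE x in lborel. w x = 0" if w: "(w, \<lambda>x. z * w x) \<in> weak_graph \<eta> V" for w
  proof -
    have "L2_norm w \<le> c * L2_norm (\<lambda>x. z * w x - z * w x)" by (rule est_W[OF w])
    also have "\<dots> = 0" by (simp add: L2_norm_def)
    finally show ?thesis
      using L2_norm_nonneg[of w] L2_norm_eq_0_iff[OF in_L2(1)[OF w]] by linarith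
  qed
  have R_iff: "(u, F) \<in> R \<longleftrightarrow> (\<exists>f. (u, f) \<in> weak_graph \<eta> V \<and> F = (\<lambda>x. f x - z * u x))" for u F
    unfolding R_def shifted_def by auto
  have range: "F \<in> Range R" if F: "F \<in> L2" for F
  proof -
    obtain u where "(u, \<lambda>x. F x + z * u x) \<in> weak_graph \<eta> V"
      using closure_range[OF V c est inj F] unfolding W by blast
    then have "(u, F) \<in> R" unfolding R_iff by (intro exI[of _ "\<lambda>x. F x + z * u x"]) simp
    then show ?thesis by blast
  qed
  have range': "F \<in> L2" if "F \<in> Range R" for F
    using that in_L2 by (auto simp: R_iff intro!: L2_diff L2_scale)
  have uniq: "(AE x in lborel. u x = v x) \<longleftrightarrow> (AE x in lborel. f x - z * u x = g x - z * v x)"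
    if uf: "(u, f) \<in> weak_graph \<eta> V" and vg: "(v, g) \<in> weak_graph \<eta> V" for u f v g
  proof
    assume uv: "AE x in lborel. u x = v x"
    from uv weak_graph_unique[OF V uf vg uv]
    show "AE x in lborel. f x - z * u x = g x - z * v x" by eventually_elim simp
  next
    assume eq: "AE x in lborel. f x - z * u x = g x - z * v x"
    note L = in_L2[OF uf] in_L2[OF vg]
    \<comment> \<open>Equal right-hand sides make the difference a weak solution of P w = z w, to
      which injectivity applies.\<close>
    have "(\<lambda>x. u x - v x, \<lambda>x. z * (u x - v x)) \<in> weak_graph \<eta> V"
    proof -
      have d: "(\<lambda>x. u x - v x) \<in> L2" by (intro L2_diff L)
      have "(LINT x|lborel. (u x - v x) * schroedinger \<eta> V \<phi> x) = (LINT x|lborel. z * (u x - v x) * \<phi> x)"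
        if \<phi>: "\<phi> \<in> test_function" for \<phi>
      proof -
        have P: "schroedinger \<eta> V \<phi> \<in> L2"
          by (intro schwartz_L2 schwartz_schroedinger V test_function_schwartz \<phi>)
        note [measurable] = L2_measurable[OF L(1)] L2_measurable[OF L(2)] L2_measurable[OF L(3)]
          L2_measurable[OF L(4)] L2_measurable[OF test_function_L2[OF \<phi>]]
        have "(LINT x|lborel. (u x - v x) * schroedinger \<eta> V \<phi> x) =
            (LINT x|lborel. u x * schroedinger \<eta> V \<phi> x) - (LINT x|lborel. v x * schroedinger \<eta> V \<phi> x)"
          unfolding left_diff_distrib by (intro Bochner_Integration.integral_diff L2_integrable_mult L P)
        also have "\<dots> = (LINT x|lborel. f x * \<phi> x) - (LINT x|lborel. g x * \<phi> x)"
          using uf vg \<phi> by (simp add: weak_graph_def)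
        also have "\<dots> = (LINT x|lborel. f x * \<phi> x - g x * \<phi> x)"
          by (intro Bochner_Integration.integral_diff[symmetric] L2_integrable_mult L test_function_L2 \<phi>)
        also have "\<dots> = (LINT x|lborel. z * (u x - v x) * \<phi> x)"
        proof (rule integral_cong_AE)
          show "AE x in lborel. f x * \<phi> x - g x * \<phi> x = z * (u x - v x) * \<phi> x"
            using eq
          proof eventually_elim
            case (elim x)
            then have "f x - g x = z * (u x - v x)" by (simp add: algebra_simps)
            then show ?case by (simp add: left_diff_distrib[symmetric])
          qed
        qed measurable
        finally show ?thesis .
      qed
      then show ?thesis using d L2_scale[OF d] by (simp add: weak_graph_def)
    qed
    from inj[OF this] show "AE x in lborel. u x = v x" by eventually_elim simp
  qed
  have dom: "Domain R = Domain (weak_graph \<eta> V)"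
    unfolding Domain_iff set_eq_iff R_iff by blast
  show "L2_invertible (Domain (weak_graph \<eta> V)) R"
    unfolding L2_invertible_def
  proof (intro conjI dom)
    show "Range R = L2" using range range' by blast
    show "\<forall>(u, f)\<in>R. \<forall>(v, g)\<in>R. (AE x in lborel. u x = v x) \<longleftrightarrow> (AE x in lborel. f x = g x)"
    proof (clarify)
      fix u F v G assume "(u, F) \<in> R" "(v, G) \<in> R"
      then obtain f g where *: "(u, f) \<in> weak_graph \<eta> V" "(v, g) \<in> weak_graph \<eta> V"
        "F = (\<lambda>x. f x - z * u x)" "G = (\<lambda>x. g x - z * v x)" unfolding R_iff by blast
      show "(AE x in lborel. u x = v x) \<longleftrightarrow> (AE x in lborel. F x = G x)"
        unfolding *(3,4) by (rule uniq[OF *(1,2)])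
    qed
  qed
  have "L2_norm u \<le> c * L2_norm F" if "(u, F) \<in> R" for u F
    using that est_W unfolding R_iff by blast
  then have "\<forall>(F, u)\<in>R\<inverse>. L2_norm u \<le> c * L2_norm F" by auto
  then show "L2_opnorm (R\<inverse>) \<le> ennreal c"
    unfolding L2_opnorm_def using c by (intro Inf_lower) blast
qed

section \<open>Constants and scales of the resolvent bound\<close>

lemma norm_gradient_power2: "(norm (gradient f x))\<^sup>2 = (\<Sum>i\<in>UNIV. (partial i f x)\<^sup>2)"
  unfolding power2_norm_eq_inner inner_vec_def gradient_def by (simp add: power2_eq_square)

text \<open>\<epsilon> = c / (12 n) gives 3 n \<epsilon> = c / 4, and \<tau> is chosen so that 5 B
  n^2 \<tau> \<le> c / 4. B + 1 guards against B = 0; c is the coercivity constant.\<close>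

lemma resolvent_estimate_constants:
  fixes B c0 :: real and n :: real
  assumes B: "0 \<le> B" and c0: "0 < c0" and n: "1 \<le> n"
  obtains c \<epsilon> \<tau> where "c = 1 / (4 * c0 + 6)" "0 < c" "c \<le> 1" "0 < \<epsilon>" "\<epsilon> \<le> 1" "0 < \<tau>" "\<tau> \<le> 1/4"
    "B * n * \<tau> \<le> 1" "3 * n * \<epsilon> + 5 * B * n\<^sup>2 * \<tau> \<le> c / 2"
proof -
  define c where "c = 1 / (4 * c0 + 6)"
  define \<epsilon> where "\<epsilon> = c / (12 * n)"
  define \<tau> where "\<tau> = min (1/4) (c / (20 * (B + 1) * n\<^sup>2))"
  have c: "0 < c" "c \<le> 1" unfolding c_def using c0 by (auto simp: field_simps)
  have n2: "n \<le> n\<^sup>2" using n by (simp add: power2_eq_square)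
  have den: "0 < 20 * (B + 1) * n\<^sup>2" using B n by simp
  have \<tau>: "0 < \<tau>" "\<tau> \<le> 1/4" unfolding \<tau>_def using c den by (simp_all only: min.cobounded1) simp
  have "\<tau> \<le> c / (20 * (B + 1) * n\<^sup>2)" unfolding \<tau>_def by simp
  then have "\<tau> * (20 * (B + 1) * n\<^sup>2) \<le> c" using den by (simp add: pos_le_divide_eq)
  moreover have "0 \<le> \<tau> * n\<^sup>2" using \<tau> by simp
  ultimately have 1: "20 * (B * n\<^sup>2 * \<tau>) \<le> c" by (simp add: algebra_simps)
  have "B * n * \<tau> \<le> B * n\<^sup>2 * \<tau>" using B n2 \<tau> by (intro mult_right_mono mult_left_mono) auto
  then have 2: "B * n * \<tau> \<le> 1" using 1 c by linarith
  have 3: "0 < \<epsilon>" "\<epsilon> \<le> 1" unfolding \<epsilon>_def using c n by (auto simp: field_simps)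
  have "3 * n * \<epsilon> = c / 4" unfolding \<epsilon>_def using n by simp
  then have "3 * n * \<epsilon> + 5 * B * n\<^sup>2 * \<tau> \<le> c / 2" using 1 by simp
  then show thesis using that[of c \<epsilon> \<tau>] c \<tau> 2 3 c_def by blast
qed

text \<open>Converts \<eta> back to h; the powers h^(2/3) and (2 pi)^(2/3) in the final bound arise
  here.\<close>

lemma scale_eq:
  fixes h \<Lambda> :: real
  assumes "0 < h" "0 < \<Lambda>"
  shows "((h / (2 * pi))\<^sup>2 * \<Lambda>) powr (1/3) = h powr (2/3) * \<Lambda> powr (1/3) / (2 * pi) powr (2/3)"
proof -
  have "(h / (2 * pi))\<^sup>2 = (h / (2 * pi)) powr 2" using assms by (simp add: powr_numeral)
  then have "((h / (2 * pi))\<^sup>2 * \<Lambda>) powr (1/3) = ((h / (2 * pi)) powr 2) powr (1/3) * \<Lambda> powr (1/3)"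
    using assms by (simp add: powr_mult)
  also have "((h / (2 * pi)) powr 2) powr (1/3) = (h / (2 * pi)) powr (2/3)"
    unfolding powr_powr by simp
  also have "\<dots> = h powr (2/3) / (2 * pi) powr (2/3)"
    by (rule powr_divide)
  finally show ?thesis by simp
qed

text \<open>From h \<le> \<tau>^2 \<Lambda> and \<eta> \<le> h one gets \<eta>^2 \<Lambda> \<le>
  \<tau>^4 \<Lambda>^3 \<le> (\<tau> \<Lambda>)^3. This is what determines M = 1 / \<tau>^2.\<close>

lemma scale_small:
  fixes h \<Lambda> \<tau> :: real
  assumes h: "0 < h" and \<tau>: "0 < \<tau>" "\<tau> \<le> 1" and \<Lambda>: "1 / \<tau>\<^sup>2 * h \<le> \<Lambda>"
  shows "((h / (2 * pi))\<^sup>2 * \<Lambda>) powr (1/3) \<le> \<tau> * \<Lambda>"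
proof -
  have h_le: "h \<le> \<tau>\<^sup>2 * \<Lambda>" using \<Lambda> \<tau> by (simp add: field_simps)
  have pos: "0 < \<Lambda>" using h \<tau> \<Lambda> by (smt (verit) divide_pos_pos mult_pos_pos zero_less_power)
  have "h / (2 * pi) \<le> h / 1" using h pi_gt3 by (intro divide_left_mono) auto
  then have "(h / (2 * pi))\<^sup>2 \<le> (\<tau>\<^sup>2 * \<Lambda>)\<^sup>2" using h h_le by (intro power_mono) auto
  also have "\<dots> = \<tau> ^ 3 * \<Lambda>\<^sup>2 * \<tau>" by (simp add: power2_eq_square power3_eq_cube)
  also have "\<dots> \<le> \<tau> ^ 3 * \<Lambda>\<^sup>2 * 1" using \<tau> by (intro mult_left_mono) auto
  finally have "(h / (2 * pi))\<^sup>2 * \<Lambda> \<le> (\<tau> ^ 3 * \<Lambda>\<^sup>2 * 1) * \<Lambda>" using pos by (intro mult_right_mono) auto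
  also have "\<dots> = (\<tau> * \<Lambda>) powr 3"
    using \<tau> pos by (simp add: powr_numeral power2_eq_square power3_eq_cube)
  finally have "((h / (2 * pi))\<^sup>2 * \<Lambda>) powr (1/3) \<le> ((\<tau> * \<Lambda>) powr 3) powr (1/3)"
    using pos by (intro powr_mono2) auto
  also have "\<dots> = \<tau> * \<Lambda>" unfolding powr_powr using \<tau> pos by simp
  finally show ?thesis .
qed

theorem theorem2:
  fixes V1 V2 :: "real^'n \<Rightarrow> real"
    and V :: "real^'n \<Rightarrow> complex"
    and p :: "real^'n \<Rightarrow> real^'n \<Rightarrow> complex"
  assumes V_eq: "V = (\<lambda>x. of_real (V1 x) + \<i> * of_real (V2 x))"
    and V_smooth: "smooth V"
    and p_eq: "p = (\<lambda>x \<xi>. of_real ((norm \<xi>)\<^sup>2) + V x)"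
    and V1_nonneg: "\<forall>x. 0 \<le> V1 x"
    and V2_bound: "\<exists>c>0. \<forall>x. \<bar>V2 x\<bar> \<le> c * (1 + (norm (gradient V2 x))\<^sup>2)"
    and V_deriv: "\<forall>\<alpha>. 2 \<le> length \<alpha> \<longrightarrow> partials \<alpha> V \<in> Linf"
  shows
    "(\<forall>h. 0 < h \<and> h \<le> 1 \<longrightarrow>
        Domain (weyl_closure h p) = D_max h p \<and>
        (\<forall>(u, f) \<in> weyl_closure h p. weyl_distr_eq h p u f)) \<and>
     (\<forall>T K :: real.
        0 \<le> T \<longrightarrow> (\<exists>c>0. \<forall>x. \<bar>V2 x\<bar> - T \<le> c * (norm (gradient V2 x))\<^sup>2) \<longrightarrow> 1 < K \<longrightarrow>
        (\<exists>h0 A M C :: real. 0 < h0 \<and> h0 \<le> 1 \<and> 0 < A \<and> 0 < M \<and> 0 < C \<and>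
          (\<forall>h z. 0 < h \<longrightarrow> h < h0 \<longrightarrow> K * T + M * h \<le> cmod z \<longrightarrow>
             Re z \<le> A * h powr (2/3) * (cmod z - T) powr (1/3) \<longrightarrow>
             L2_invertible (D_max h p) (shifted (weyl_closure h p) z) \<and>
             L2_opnorm ((shifted (weyl_closure h p) z)\<inverse>)
               \<le> ennreal (C * h powr (- 2/3) * (cmod z - T) powr (- 1/3)))))"
proof -
  have bd: "\<exists>B\<ge>0. \<forall>x. norm (partials \<alpha> V x) \<le> B" if "2 \<le> length \<alpha>" for \<alpha>
  proof (rule Linf_continuous_bounded)
    show "partials \<alpha> V \<in> Linf" using V_deriv that by blast
    show "continuous_on UNIV (partials \<alpha> V)"
      using V_smooth unfolding smooth_def
      by (meson continuous_at_imp_continuous_on differentiable_imp_continuous_within)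
  qed
  have V: "slow_growth V" by (rule slow_growth_if_second_partials_bounded[OF V_smooth bd])
  have ReV: "Re (V x) = V1 x" and ImV: "Im (V x) = V2 x" for x by (simp_all add: V_eq)
  have V_nonneg: "0 \<le> Re (V x)" for x using V1_nonneg ReV by simp
  note W = weyl_closure_eq_weak_graph[OF V V_nonneg p_eq]
  have dom: "Domain (weak_graph (h / (2 * pi)) V) = D_max h p" for h
    unfolding W(2) D_max_def by auto

  define g where "g i x = Im (partial i V x)" for i x
  define H where "H i j x = Im (partial j (partial i V) x)" for i j x
  have V2_partial: "has_partial V2 i x (g i x)" for i x
    using has_partial_linear[OF bounded_linear_Im smooth_has_partial[OF V_smooth]] by (simp add: ImV g_def)
  have g_eq: "partial i V2 x = g i x" for i x by (rule has_partial_eq[OF V2_partial])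
  have g_partial: "has_partial (g i) j x (H i j x)" for i j x
    unfolding g_def[abs_def] H_def
    by (rule has_partial_linear[OF bounded_linear_Im smooth_has_partial[OF smooth_partial[OF V_smooth]]])
  have conts: "continuous_on UNIV V2" "continuous_on UNIV (g i)" "continuous_on UNIV (H i j)" for i j
  proof -
    have "continuous_on UNIV (\<lambda>x. Im (V x))" by (intro continuous_intros smooth_continuous V_smooth)
    then show "continuous_on UNIV V2" by (simp add: ImV)
    show "continuous_on UNIV (g i)" "continuous_on UNIV (H i j)"
      unfolding g_def[abs_def] H_def[abs_def] by (intro continuous_intros smooth_continuous smooth_partial V_smooth)+
  qed
  \<comment> \<open>One constant for all pairs of directions: the sum of the individual
    bounds.\<close>
  obtain B where B: "0 \<le> B" "\<And>i j x. \<bar>H i j x\<bar> \<le> B"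
  proof -
    have "\<exists>b\<ge>0. \<forall>x. norm (partial j (partial i V) x) \<le> b" for i j
      using bd[of "[j, i]"] by simp
    then have ex: "\<exists>b. 0 \<le> b \<and> (\<forall>x. norm (partial j (partial i V) x) \<le> b)" for i j by blast
    define b where "b i j = (SOME b. 0 \<le> b \<and> (\<forall>x. norm (partial j (partial i V) x) \<le> b))" for i j
    have "0 \<le> b i j \<and> (\<forall>x. norm (partial j (partial i V) x) \<le> b i j)" for i j
      unfolding b_def by (rule someI_ex[OF ex])
    then have b: "\<And>i j. 0 \<le> b i j" "\<And>i j x. norm (partial j (partial i V) x) \<le> b i j" by blast+
    have "\<bar>H i j x\<bar> \<le> (\<Sum>i\<in>UNIV. \<Sum>j\<in>UNIV. b i j)" for i j x
    proof -
      have "\<bar>H i j x\<bar> \<le> b i j" unfolding H_def by (rule order_trans[OF abs_Im_le_cmod b(2)])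
      also have "\<dots> \<le> (\<Sum>j\<in>UNIV. b i j)" using b(1) by (intro member_le_sum) auto
      also have "\<dots> \<le> (\<Sum>i\<in>UNIV. \<Sum>j\<in>UNIV. b i j)"
        by (rule member_le_sum[of i UNIV "\<lambda>i. \<Sum>j\<in>UNIV. b i j"]) (auto intro!: sum_nonneg b)
      finally show ?thesis .
    qed
    moreover have "0 \<le> (\<Sum>i\<in>UNIV. \<Sum>j\<in>UNIV. b i j)" by (intro sum_nonneg b)
    ultimately show thesis by (rule that[rotated])
  qed

  have part1: "Domain (weyl_closure h p) = D_max h p \<and> (\<forall>(u, f) \<in> weyl_closure h p. weyl_distr_eq h p u f)" for h
    unfolding W(1) dom using W(2)[of h] by auto

  have part2: "\<exists>h0 A M C :: real. 0 < h0 \<and> h0 \<le> 1 \<and> 0 < A \<and> 0 < M \<and> 0 < C \<and>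
          (\<forall>h z. 0 < h \<longrightarrow> h < h0 \<longrightarrow> K * T + M * h \<le> cmod z \<longrightarrow>
             Re z \<le> A * h powr (2/3) * (cmod z - T) powr (1/3) \<longrightarrow>
             L2_invertible (D_max h p) (shifted (weyl_closure h p) z) \<and>
             L2_opnorm ((shifted (weyl_closure h p) z)\<inverse>)
               \<le> ennreal (C * h powr (- 2/3) * (cmod z - T) powr (- 1/3)))"
    if T: "0 \<le> T" and ex: "\<exists>c>0. \<forall>x. \<bar>V2 x\<bar> - T \<le> c * (norm (gradient V2 x))\<^sup>2" and K: "1 < K" for T K
  proof -
    obtain c0 where c0: "0 < c0" "\<And>x. \<bar>V2 x\<bar> - T \<le> c0 * (\<Sum>i\<in>UNIV. (g i x)\<^sup>2)"
      using ex unfolding norm_gradient_power2 g_eq by blast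
    let ?n = "real CARD('n)"
    have n: "1 \<le> ?n" by (simp add: Suc_leI)
    obtain c \<epsilon> \<tau> where c_def: "c = 1 / (4 * c0 + 6)" and c: "0 < c" "c \<le> 1" and \<epsilon>: "0 < \<epsilon>" "\<epsilon> \<le> 1"
      and \<tau>: "0 < \<tau>" "\<tau> \<le> 1/4" "B * ?n * \<tau> \<le> 1" and sum_le: "3 * ?n * \<epsilon> + 5 * B * ?n\<^sup>2 * \<tau> \<le> c / 2"
      by (rule resolvent_estimate_constants[OF B(1) c0(1) n])
    define \<kappa> where "\<kappa> = (2 * pi) powr (2/3)"
    have \<kappa>: "0 < \<kappa>" by (simp add: \<kappa>_def)
    \<comment> \<open>With this slope, 3 / \<epsilon> times Re z is at most c / 4 times d, the
      amount the integrated estimate can absorb.\<close>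
    define A' where "A' = c * \<epsilon> / 12"
    have A': "0 < A'" "A' \<le> 1"
    proof -
      show "0 < A'" using c \<epsilon> by (simp add: A'_def)
      have "c * \<epsilon> \<le> 1 * 1" using c \<epsilon> by (intro mult_mono) auto
      then show "A' \<le> 1" by (simp add: A'_def)
    qed
    \<comment> \<open>The constant 2 + 3 / \<epsilon> of the integrated estimate, divided by c /
      4.\<close>
    define C' where "C' = 4 / c * (2 + 3 / \<epsilon>)"
    have C': "1 \<le> C'"
    proof -
      have "1 \<le> 4 / c" using c by simp
      moreover have "1 \<le> 2 + 3 / \<epsilon>" using \<epsilon>(1) by (simp add: add_increasing2)
      ultimately show ?thesis unfolding C'_def using mult_mono[of 1 "4 / c" 1 "2 + 3 / \<epsilon>"] c by simp
    qed
    have main: "L2_invertible (D_max h p) (shifted (weyl_closure h p) z) \<and>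
             L2_opnorm ((shifted (weyl_closure h p) z)\<inverse>)
               \<le> ennreal ((\<kappa> * C') * h powr (- 2/3) * (cmod z - T) powr (- 1/3))"
      if h: "0 < h" and z: "K * T + 1 / \<tau>\<^sup>2 * h \<le> cmod z"
        and Re_z: "Re z \<le> A' / \<kappa> * h powr (2/3) * (cmod z - T) powr (1/3)" for h z
    proof -
      define \<Lambda> where "\<Lambda> = cmod z - T"
      define \<eta> where "\<eta> = h / (2 * pi)"
      define d where "d = (\<eta>\<^sup>2 * \<Lambda>) powr (1/3)"
      \<comment> \<open>K T \<ge> T, so subtracting T from |z| leaves at least M h.\<close>
      have "1 * T \<le> K * T" using T K by (intro mult_right_mono) auto
      then have \<Lambda>_ge: "1 / \<tau>\<^sup>2 * h \<le> \<Lambda>" using z unfolding \<Lambda>_def by linarith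
      have "0 < 1 / \<tau>\<^sup>2 * h" using h \<tau> by simp
      then have \<Lambda>: "0 < \<Lambda>" using \<Lambda>_ge by linarith
      have \<eta>: "0 < \<eta>" using h by (simp add: \<eta>_def)
      have d_pos: "0 < d" unfolding d_def using \<eta> \<Lambda> by simp
      have d_small: "d \<le> \<tau> * \<Lambda>"
        unfolding d_def \<eta>_def by (rule scale_small[OF h \<tau>(1) _ \<Lambda>_ge]) (use \<tau> in simp)
      also have "\<dots> \<le> 1/4 * \<Lambda>" using \<tau> \<Lambda> by (intro mult_right_mono) auto
      finally have d_le: "d \<le> \<Lambda> / 4" by simp
      have d_eq: "d = h powr (2/3) * \<Lambda> powr (1/3) / \<kappa>"
        unfolding d_def \<eta>_def \<kappa>_def by (rule scale_eq[OF h \<Lambda>])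
      have Re_z': "Re z \<le> A' * d" using Re_z unfolding d_eq \<Lambda>_def by (simp add: mult_ac)
      have est: "L2_norm \<phi> \<le> C' / d * L2_norm (\<lambda>x. schroedinger \<eta> V \<phi> x - z * \<phi> x)"
        if \<phi>: "\<phi> \<in> test_function" for \<phi>
      proof -
        let ?N = "L2_norm (\<lambda>x. schroedinger \<eta> V \<phi> x - z * \<phi> x)"
        \<comment> \<open>If Re z \<le> - \<Lambda> / 4, dissipativity alone suffices because d
          \<le> \<Lambda> / 4. Otherwise |Re z| \<le> \<Lambda> / 4, and |z| = T + \<Lambda> forces
          |Im z| \<ge> T + 3/4 \<Lambda>, as coercivity demands.\<close>
        have "d * L2_norm \<phi> \<le> C' * ?N"
        proof (cases "Re z \<le> - (\<Lambda> / 4)")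
          case True
          have "d * L2_norm \<phi> \<le> - Re z * L2_norm \<phi>"
            using True d_le by (intro mult_right_mono L2_norm_nonneg) auto
          also have "\<dots> \<le> ?N" by (rule dissipative_estimate[OF V V_nonneg \<phi>])
          also have "\<dots> \<le> C' * ?N" using mult_right_mono[OF C' L2_norm_nonneg] by simp
          finally show ?thesis .
        next
          case False
          have "A' * d \<le> 1 * d" using A' d_pos by (intro mult_right_mono) auto
          then have "\<bar>Re z\<bar> \<le> \<Lambda> / 4" using False Re_z' d_le by linarith
          then have Im_z: "T + 3/4 * \<Lambda> \<le> \<bar>Im z\<bar>" using cmod_le[of z] unfolding \<Lambda>_def by (simp add: field_simps)
          interpret S: subelliptic V2 g H B \<eta> \<Lambda> "Im z" \<tau>
            by unfold_locales (rule V2_partial g_partial conts B \<eta> \<Lambda> \<tau> d_small[unfolded d_def])+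
          have "3 / \<epsilon> * Re z \<le> 3 / \<epsilon> * (A' * d)" using \<epsilon> by (intro mult_left_mono Re_z') auto
          also have "\<dots> = c / 4 * d" using \<epsilon> by (simp add: A'_def)
          finally have Re3: "3 / \<epsilon> * Re z \<le> c / 4 * (\<eta>\<^sup>2 * \<Lambda>) powr (1/3)" unfolding d_def .
          have "c / 4 * d * L2_norm \<phi> \<le> (2 + 3 / \<epsilon>) * ?N"
            unfolding d_def
            by (rule S.integrated_estimate[OF \<phi> V V_nonneg ImV refl \<epsilon>(1)
                  S.coercive[OF c0(1) c0(2) Im_z \<tau>(2), folded c_def] sum_le c(1) Re3])
          then have le: "4 / c * (c / 4 * d * L2_norm \<phi>) \<le> 4 / c * ((2 + 3 / \<epsilon>) * ?N)"
            using c by (intro mult_left_mono) auto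
          have "d * L2_norm \<phi> = 4 / c * (c / 4 * d * L2_norm \<phi>)" using c by simp
          also note le
          also have "4 / c * ((2 + 3 / \<epsilon>) * ?N) = C' * ?N" by (simp only: C'_def mult.assoc)
          finally show ?thesis .
        qed
        then show ?thesis using d_pos by (simp add: field_simps)
      qed
      have "0 \<le> C' / d" using C' d_pos by simp
      note R = resolvent_if_estimate[OF V V_nonneg this est]
      have "C' / d = (\<kappa> * C') * h powr (- 2/3) * \<Lambda> powr (- 1/3)"
        unfolding d_eq using h \<Lambda> \<kappa> by (simp add: powr_minus_divide)
      then show ?thesis
        using R unfolding W(1) \<eta>_def dom \<Lambda>_def by simp
    qed
    \<comment> \<open>h0 = 1 works. A and C carry the factor \<kappa> = (2 pi)^(2/3) from the
      passage between \<eta> and h, and M = 1 / \<tau>^2 guarantees d \<le> \<tau>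
      \<Lambda>.\<close>
    show ?thesis
      by (rule exI[of _ 1], rule exI[of _ "A' / \<kappa>"], rule exI[of _ "1 / \<tau>\<^sup>2"], rule exI[of _ "\<kappa> * C'"])
         (use main A' \<kappa> \<tau> C' in auto)
  qed
  show ?thesis using part1 part2 by blast
qed

end
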